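(* Let $n=p+q$ with $p\ge q$. For any $2n\times2n$ real (resp. complex) symplectic matrix $S$, there exist a $2n\times 2n$ orthogonal (resp. unitary) symplectic matrix $U$, two real (resp. complex) symplectic matrices $S_p\in\mathrm{Sp}(2p,\mathbb{R})$ and $S_q\in\mathrm{Sp}(2q,\mathbb{R})$ (resp. $S_p\in\mathrm{Sp}(2p,\mathbb{C})$ and $S_q\in\mathrm{Sp}(2q,\mathbb{C})$), and $q$ unique (up to order and signs) real numbers $\theta_1,\dots,\theta_q$ such that $$S=U\begin{bmatrix} H & 0 \\ 0 & H^{-1} \end{bmatrix}\begin{bmatrix} X_1 & 0 & X_2 & 0 \\ 0 & Y_1 & 0 & Y_2 \\ X_3 & 0 & X_4 & 0 \\ 0 & Y_3 & 0 & Y_4 \end{bmatrix},$$ where $S_p=\begin{bmatrix} X_1 & X_2 \\ X_3 & X_4 \end{bmatrix}$ with $p\times p$ blocks $X_l$, $S_q=\begin{bmatrix} Y_1 & Y_2 \\ Y_3 & Y_4 \end{bmatrix}$ with $q\times q$ blocks $Y_l$, and $$H=\begin{bmatrix} Ch & 0 & Sh \\ 0 & I_{p-q} & 0 \\ Sh & 0 & Ch \end{bmatrix},\qquad H^{-1}=\begin{bmatrix} Ch & 0 & -Sh \\ 0 & I_{p-q} & 0 \\ -Sh & 0 & Ch \end{bmatrix}.$$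
   Context: For $\mathbb{F}\in\{\mathbb{R},\mathbb{C}\}$, $\mathrm{Sp}(2n,\mathbb{F})=\{S\in\mathbb{F}^{2n\times2n}:S^TJ_nS=J_n\}$ where $J_n=\begin{bmatrix} 0 & I_n \\ -I_n & 0 \end{bmatrix}$ and $^T$ is the ordinary (non-conjugate) transpose. An orthogonal (resp. unitary) symplectic matrix is a real orthogonal (resp. complex unitary) matrix lying in $\mathrm{Sp}(2n,\mathbb{R})$ (resp. $\mathrm{Sp}(2n,\mathbb{C})$). $Ch=\operatorname{diag}(\cosh\theta_1,\dots,\cosh\theta_q)$ and $Sh=\operatorname{diag}(\sinh\theta_1,\dots,\sinh\theta_q)$ are $q\times q$; the block sizes of $H$ are $q,\,p-q,\,q$. The last factor of the factorization has block sizes $p,q,p,q$. *)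

theory Defs
  imports
    "HOL-Combinatorics.Permutations"
    "Jordan_Normal_Form.Schur_Decomposition"
begin

definition symplectic_form :: "nat \<Rightarrow> 'a :: comm_ring_1 mat" where
  "symplectic_form n = four_block_mat (0\<^sub>m n n) (1\<^sub>m n) (- 1\<^sub>m n) (0\<^sub>m n n)"

definition symplectic_group :: "nat \<Rightarrow> 'a :: comm_ring_1 mat set" where
  "symplectic_group n =
     {S \<in> carrier_mat (2 * n) (2 * n). S\<^sup>T * symplectic_form n * S = symplectic_form n}"

text \<open>The constant \<^const>\<open>orthogonal_mat\<close> only requires pairwise orthogonal columns,
  so orthogonality and unitarity in the usual sense are spelled out here.\<close>

definition orthogonal_symplectic :: "nat \<Rightarrow> real mat set" where
  "orthogonal_symplectic n = {U \<in> symplectic_group n. inverts_mat U\<^sup>T U \<and> inverts_mat U U\<^sup>T}"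

definition unitary_symplectic :: "nat \<Rightarrow> complex mat set" where
  "unitary_symplectic n =
     {U \<in> symplectic_group n. inverts_mat (mat_adjoint U) U \<and> inverts_mat U (mat_adjoint U)}"

text \<open>Horizontal counterpart of \<^const>\<open>append_rows\<close>.\<close>

definition append_cols :: "'a :: zero mat \<Rightarrow> 'a mat \<Rightarrow> 'a mat" (infixr \<open>@\<^sub>c\<close> 70) where
  "A @\<^sub>c B = four_block_mat A B (0\<^sub>m 0 (dim_col A)) (0\<^sub>m 0 (dim_col B))"

text \<open>Only the values \<open>\<theta> 0, \<dots>, \<theta> (q - 1)\<close> matter below.\<close>

definition Ch :: "nat \<Rightarrow> (nat \<Rightarrow> real) \<Rightarrow> 'a :: real_field mat" where
  "Ch q \<theta> = mat_diag q (\<lambda>i. of_real (cosh (\<theta> i)))"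

definition Sh :: "nat \<Rightarrow> (nat \<Rightarrow> real) \<Rightarrow> 'a :: real_field mat" where
  "Sh q \<theta> = mat_diag q (\<lambda>i. of_real (sinh (\<theta> i)))"

definition hyp_mat :: "nat \<Rightarrow> nat \<Rightarrow> (nat \<Rightarrow> real) \<Rightarrow> 'a :: real_field mat" where
  "hyp_mat p q \<theta> =
     (Ch q \<theta>        @\<^sub>c 0\<^sub>m q (p - q)  @\<^sub>c Sh q \<theta>) @\<^sub>r
     (0\<^sub>m (p - q) q @\<^sub>c 1\<^sub>m (p - q)    @\<^sub>c 0\<^sub>m (p - q) q) @\<^sub>r
     (Sh q \<theta>        @\<^sub>c 0\<^sub>m q (p - q)  @\<^sub>c Ch q \<theta>)"

definition hyp_mat_inv :: "nat \<Rightarrow> nat \<Rightarrow> (nat \<Rightarrow> real) \<Rightarrow> 'a :: real_field mat" where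
  "hyp_mat_inv p q \<theta> =
     (Ch q \<theta>        @\<^sub>c 0\<^sub>m q (p - q)  @\<^sub>c - Sh q \<theta>) @\<^sub>r
     (0\<^sub>m (p - q) q @\<^sub>c 1\<^sub>m (p - q)    @\<^sub>c 0\<^sub>m (p - q) q) @\<^sub>r
     (- Sh q \<theta>      @\<^sub>c 0\<^sub>m q (p - q)  @\<^sub>c Ch q \<theta>)"

definition symplectic_direct_sum :: "nat \<Rightarrow> nat \<Rightarrow> 'a :: zero mat \<Rightarrow> 'a mat \<Rightarrow> 'a mat" where
  "symplectic_direct_sum p q Sp Sq =
     (case split_block Sp p p of (X1, X2, X3, X4) \<Rightarrow>
      case split_block Sq q q of (Y1, Y2, Y3, Y4) \<Rightarrow>
        (X1       @\<^sub>c 0\<^sub>m p q @\<^sub>c X2       @\<^sub>c 0\<^sub>m p q) @\<^sub>r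
        (0\<^sub>m q p @\<^sub>c Y1       @\<^sub>c 0\<^sub>m q p @\<^sub>c Y2) @\<^sub>r
        (X3       @\<^sub>c 0\<^sub>m p q @\<^sub>c X4       @\<^sub>c 0\<^sub>m p q) @\<^sub>r
        (0\<^sub>m q p @\<^sub>c Y3       @\<^sub>c 0\<^sub>m q p @\<^sub>c Y4))"

text \<open>\<open>K\<close> is the group from which the left factor is taken.\<close>

definition hyp_factorization ::
  "'a :: real_field mat set \<Rightarrow> nat \<Rightarrow> nat \<Rightarrow> 'a mat \<Rightarrow> 'a mat \<Rightarrow> 'a mat \<Rightarrow> 'a mat \<Rightarrow> (nat \<Rightarrow> real) \<Rightarrow> bool"
where
  "hyp_factorization K p q S U Sp Sq \<theta> \<longleftrightarrow>
     U \<in> K \<and> Sp \<in> symplectic_group p \<and> Sq \<in> symplectic_group q \<and>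
     S = U
       * four_block_mat (hyp_mat p q \<theta>) (0\<^sub>m (p + q) (p + q))
                        (0\<^sub>m (p + q) (p + q)) (hyp_mat_inv p q \<theta>)
       * symplectic_direct_sum p q Sp Sq"

definition eq_up_to_order_and_signs :: "nat \<Rightarrow> (nat \<Rightarrow> real) \<Rightarrow> (nat \<Rightarrow> real) \<Rightarrow> bool" where
  "eq_up_to_order_and_signs q \<theta> \<theta>' \<longleftrightarrow>
     (\<exists>\<pi>. \<pi> permutes {..<q} \<and> (\<forall>i<q. \<theta>' i = \<theta> (\<pi> i) \<or> \<theta>' i = - \<theta> (\<pi> i)))"

end

(*
The Gram matrix M = S^* S is positive definite, Hermitian and symplectic, and S = U D L with D the
hyperbolic factor (which is Hermitian) holds for a unitary U iff M = L^* D^2 L. So one has to find a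
symplectic basis adapted to the splitting into the p-part and the q-part in which M becomes D^2.

Let Sigma be the reflection with eigenspaces these two parts. The antilinear map tau x = J^T conj (M x)
satisfies tau^2 = -1. Let K and B be its components commuting and anticommuting with Sigma; then
K^2 + B^2 = -1 and K B = - B K. The operator -K^2 is self-adjoint and positive, and an eigenvector e with
eigenvalue c^2 yields a symplectic pair e, f with K e = c f, K f = - c e. Splitting off such pairs one after
the other diagonalizes the q-part. For a pair (e, f) of the q-part B^2 = c^2 - 1, so if c > 1 then (B f, B e),
rescaled by s = sqrt (c^2 - 1), is such a pair in the p-part; completing these to a frame of the p-part
adds only pairs with c = 1 and B = 0. Then c = cosh 2 theta and s = sinh 2 theta.

For uniqueness, M^{-1} Sigma M Sigma is similar to D^{-4}, whence
M^{-1} Sigma M Sigma + Sigma M^{-1} Sigma M is similar to a diagonal matrix with entries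
2 cosh 4 theta, so the characteristic polynomial determines the angles up to order and sign.
*)

theory Submission
  imports Defs
begin

section \<open>Eigenvectors of self-adjoint operators over the real and complex numbers\<close>

text \<open>The map \<open>tau\<close> is made so that \<open>om (tau x) y\<close> is minus the
  \<open>M\<close>-product of \<open>x\<close> and \<open>y\<close>. It merges the Hermitian and the
  symplectic form into one operator: up to sign, the entries of \<open>M\<close> in a symplectic
  basis are the coefficients of \<open>tau\<close> on that basis. In the target matrix the cosh
  entries stay inside a part and the sinh entries join the two parts, which is the splitting of
  \<open>tau\<close> into \<open>K\<close> and \<open>B\<close>. Diagonalizing \<open>M\<close>
  itself would ignore the parts; \<open>K\<close> respects them, but over the complex numbers it is
  only antilinear, so eigenvectors are taken from its square. They must exist over the ground field,
  and for real matrices this is what self-adjointness is for. The construction starts in the q-part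
  because q <= p guarantees a free slot in the p-part for every transported pair. In the uniqueness
  argument D^(-4) is not diagonal; adding its inverse cancels the sinh entries. What remains is a
  multiset of values of the even function cosh with known multiplicities, so exactly order and signs
  are lost.\<close>

definition conj_mat :: "'a :: conjugate mat \<Rightarrow> 'a mat" where
  "conj_mat A = map_mat conjugate A"

lemma conj_mat_carrier [simp]: "conj_mat A \<in> carrier_mat n m \<longleftrightarrow> A \<in> carrier_mat n m"
  by (auto simp: conj_mat_def)

lemma conj_mat_index [simp]:
  "i < dim_row A \<Longrightarrow> j < dim_col A \<Longrightarrow> conj_mat A $$ (i, j) = conjugate (A $$ (i, j))"
  "dim_row (conj_mat A) = dim_row A" "dim_col (conj_mat A) = dim_col A"
  by (auto simp: conj_mat_def)

lemma conj_mat_conj_mat [simp]: "conj_mat (conj_mat A) = A"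
  by (rule eq_matI) auto

lemma transpose_conj_mat: "(conj_mat A)\<^sup>T = conj_mat A\<^sup>T"
  by (rule eq_matI) auto

lemma mat_adjoint_eq: "mat_adjoint A = conj_mat A\<^sup>T"
  by (rule eq_matI) (auto simp: mat_adjoint_def mat_of_rows_def)

lemma conj_mat_mult_vec:
  fixes A :: "'a :: conjugatable_ring mat"
  assumes "A \<in> carrier_mat n m" "x \<in> carrier_vec m"
  shows "conjugate (A *\<^sub>v x) = conj_mat A *\<^sub>v conjugate x"
  using assms by (intro eq_vecI) (auto simp: scalar_prod_def sum_conjugate conjugate_dist_mul)

lemma conj_mat_mult:
  fixes A :: "'a :: conjugatable_ring mat"
  assumes "A \<in> carrier_mat n m" "B \<in> carrier_mat m k"
  shows "conj_mat (A * B) = conj_mat A * conj_mat B"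
  using assms by (intro eq_matI) (auto simp: scalar_prod_def sum_conjugate conjugate_dist_mul)

lemma conjugate_one [simp]: "conjugate (1 :: 'a :: conjugatable_field) = 1"
proof -
  have "conjugate (1 :: 'a) * conjugate 1 = conjugate 1"
    by (simp flip: conjugate_dist_mul)
  moreover have "conjugate (1 :: 'a) \<noteq> 0"
    by simp
  ultimately show ?thesis
    by (metis mult_cancel_left1)
qed

text \<open>Among the nonzero elements of the subspace, pick one whose coordinates in a triangularizing
  basis vanish from the earliest index on.\<close>

lemma invariant_subspace_eigenvector:
  fixes T :: "'a :: conjugatable_ordered_field mat"
  assumes T: "T \<in> carrier_mat n n"
    and split: "char_poly T = (\<Prod>a\<leftarrow>es. [:- a, 1:])"
    and X: "X \<subseteq> carrier_vec n"
    and step: "\<And>x a. x \<in> X \<Longrightarrow> T *\<^sub>v x - a \<cdot>\<^sub>v x \<in> X"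
    and x0: "x0 \<in> X" "x0 \<noteq> 0\<^sub>v n"
  obtains x a where "x \<in> X" "x \<noteq> 0\<^sub>v n" "T *\<^sub>v x = a \<cdot>\<^sub>v x"
proof -
  obtain B where B: "B \<in> carrier_mat n n" "upper_triangular B" and "similar_mat T B"
    using schur_decomposition_exists[OF T split] by blast
  then obtain P Q where "similar_mat_wit T B P Q"
    unfolding similar_mat_def by blast
  from similar_mat_witD2[OF T this] have
    PQ: "P * Q = 1\<^sub>m n" "Q * P = 1\<^sub>m n" "T = P * B * Q" "P \<in> carrier_mat n n" "Q \<in> carrier_mat n n"
    by auto
  define V where "V k = {x \<in> X. x \<noteq> 0\<^sub>v n \<and> (\<forall>i<n. k \<le> i \<longrightarrow> (Q *\<^sub>v x) $ i = 0)}" for k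
  define k where "k = (LEAST k. V k \<noteq> {})"
  have "x0 \<in> V n"
    using x0 by (auto simp: V_def)
  hence "V n \<noteq> {}"
    by blast
  hence "V k \<noteq> {}" and kn: "k \<le> n"
    unfolding k_def by (rule LeastI, rule Least_le)
  then obtain x where x: "x \<in> X" "x \<noteq> 0\<^sub>v n" "\<And>i. i < n \<Longrightarrow> k \<le> i \<Longrightarrow> (Q *\<^sub>v x) $ i = 0"
    by (auto simp: V_def)
  have xn: "x \<in> carrier_vec n"
    using x X by auto
  have PQx: "P *\<^sub>v (Q *\<^sub>v v) = v" if "v \<in> carrier_vec n" for v
    using that PQ by (simp flip: assoc_mult_mat_vec[of _ n n _ n])
  have "k \<noteq> 0"
  proof
    assume "k = 0"
    hence "Q *\<^sub>v x = 0\<^sub>v n"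
      using x PQ(5) by (intro eq_vecI) auto
    moreover have "P *\<^sub>v 0\<^sub>v n = 0\<^sub>v n"
      using PQ(4) by (intro eq_vecI) auto
    ultimately have "x = 0\<^sub>v n"
      using PQx[OF xn] by simp
    with x show False by blast
  qed
  then obtain m where k: "k = Suc m" and m: "m < n"
    using kn by (cases k) auto
  \<comment> \<open>Coordinate \<open>m\<close> is the last one of \<open>x\<close> that may be
    nonzero, and there \<open>T\<close> acts as multiplication by this diagonal entry. Subtracting
    that multiple kills coordinate \<open>m\<close>, so a nonzero \<open>y\<close> would lie in
    \<open>V m\<close>, against the minimality of \<open>k\<close>.\<close>
  define a where "a = B $$ (m, m)"
  define y where "y = T *\<^sub>v x - a \<cdot>\<^sub>v x"
  have yX: "y \<in> X"
    using step x by (simp add: y_def)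
  have yn: "y \<in> carrier_vec n"
    using yX X by auto
  have Qy: "Q *\<^sub>v y = B *\<^sub>v (Q *\<^sub>v x) - a \<cdot>\<^sub>v (Q *\<^sub>v x)"
  proof -
    have "Q *\<^sub>v (T *\<^sub>v x) = (Q * P) *\<^sub>v (B *\<^sub>v (Q *\<^sub>v x))"
      using PQ(3-5) xn B(1) by (simp add: assoc_mult_mat_vec[of _ n n _ n] mult_carrier_mat[of _ n n _ n])
    also have "\<dots> = B *\<^sub>v (Q *\<^sub>v x)"
      using PQ xn B(1) by simp
    finally show ?thesis
      using PQ(5) xn T by (simp add: y_def mult_minus_distrib_mat_vec[of _ n n] mult_mat_vec[of _ n n])
  qed
  have "(Q *\<^sub>v y) $ i = 0" if i: "i < n" "m \<le> i" for i
  proof -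
    have "(B *\<^sub>v (Q *\<^sub>v x)) $ i = (\<Sum>j<n. B $$ (i, j) * (Q *\<^sub>v x) $ j)"
      using i B(1) PQ(5) by (simp add: scalar_prod_def atLeast0LessThan)
    \<comment> \<open>Below row \<open>m\<close> triangularity removes the columns before
      \<open>m\<close>, and the coordinates of \<open>x\<close> vanish from \<open>k\<close> on;
      only column \<open>m\<close> is left.\<close>
    also have "\<dots> = (\<Sum>j<n. if j = m then B $$ (i, m) * (Q *\<^sub>v x) $ m else 0)"
    proof (rule sum.cong[OF refl])
      fix j assume j: "j \<in> {..<n}"
      consider "j < m" | "j = m" | "j \<ge> k"
        unfolding k by linarith
      thus "B $$ (i, j) * (Q *\<^sub>v x) $ j = (if j = m then B $$ (i, m) * (Q *\<^sub>v x) $ m else 0)"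
      proof cases
        case 1
        hence "B $$ (i, j) = 0"
          using B i by auto
        with 1 show ?thesis by simp
      next
        case 3
        with j x(3) show ?thesis by (auto simp: k)
      qed auto
    qed
    also have "\<dots> = B $$ (i, m) * (Q *\<^sub>v x) $ m"
      using m by simp
    also have "\<dots> = a * (Q *\<^sub>v x) $ i"
    proof (cases "i = m")
      case True
      thus ?thesis by (simp add: a_def)
    next
      case False
      hence "B $$ (i, m) = 0"
        using upper_triangularD[OF B(2), of m i] i B(1) by simp
      with i False x(3)[of i] show ?thesis by (simp add: k)
    qed
    finally show ?thesis
      using i xn PQ(5) B(1) by (simp add: Qy)
  qed
  moreover have "V m = {}"
    using not_less_Least[of m "\<lambda>k. V k \<noteq> {}"] by (simp flip: k_def add: k)
  ultimately have "y = 0\<^sub>v n"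
    using yX by (auto simp: V_def)
  hence "T *\<^sub>v x = a \<cdot>\<^sub>v x"
  proof -
    assume y0: "y = 0\<^sub>v n"
    show ?thesis
    proof (rule eq_vecI)
      fix i assume "i < dim_vec (a \<cdot>\<^sub>v x)"
      hence "i < n" using xn by auto
      hence "(T *\<^sub>v x - a \<cdot>\<^sub>v x) $ i = 0"
        using y0 unfolding y_def by simp
      thus "(T *\<^sub>v x) $ i = (a \<cdot>\<^sub>v x) $ i"
        using \<open>i < n\<close> xn T by simp
    qed (use xn T in auto)
  qed
  with x that show thesis by blast
qed

text \<open>Interface through which the real and the complex case are handled at once. In substance
  they differ only in the last assumption: an operator that is self-adjoint for a positive definite
  form with matrix \<open>H\<close> must have all its eigenvalues in the field. Over the complex
  numbers every characteristic polynomial splits; over the reals this needs an argument.\<close>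

locale real_or_complex =
  fixes field_type :: "'a :: {conjugatable_ordered_field, real_field} itself"
  assumes conjugate_of_real [simp]: "conjugate (of_real r :: 'a) = of_real r"
    and conjugate_eq_self: "conjugate (z :: 'a) = z \<Longrightarrow> z \<in> \<real>"
    and of_real_nonneg [simp]: "(0 :: 'a) \<le> of_real r \<longleftrightarrow> 0 \<le> r"
    and self_adjoint_splits:
      "\<And>(T :: 'a mat) H m. T \<in> carrier_mat m m \<Longrightarrow> H \<in> carrier_mat m m \<Longrightarrow>
         (\<And>x y. x \<in> carrier_vec m \<Longrightarrow> y \<in> carrier_vec m \<Longrightarrow>
            conjugate x \<bullet> (H *\<^sub>v (T *\<^sub>v y)) = conjugate (T *\<^sub>v x) \<bullet> (H *\<^sub>v y)) \<Longrightarrow>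
         (\<And>x. x \<in> carrier_vec m \<Longrightarrow> x \<noteq> 0\<^sub>v m \<Longrightarrow> 0 < conjugate x \<bullet> (H *\<^sub>v x)) \<Longrightarrow>
         \<exists>es. char_poly T = (\<Prod>a\<leftarrow>es. [:- a, 1:])"


lemma real_or_complex_complex: "real_or_complex TYPE(complex)"
proof
  fix z :: complex
  assume "conjugate z = z"
  thus "z \<in> \<real>"
    by (simp add: Reals_cnj_iff)
next
  fix T H :: "complex mat" and m
  assume "T \<in> carrier_mat m m"
  thus "\<exists>es. char_poly T = (\<Prod>a\<leftarrow>es. [:- a, 1:])"
    using char_poly_factorized by blast
qed (auto simp: less_eq_complex_def)

lemma map_vec_Re_mult:
  assumes "T \<in> carrier_mat m m" "v \<in> carrier_vec m"
  shows "map_vec Re (map_mat complex_of_real T *\<^sub>v v) = T *\<^sub>v map_vec Re v"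
    and "map_vec Im (map_mat complex_of_real T *\<^sub>v v) = T *\<^sub>v map_vec Im v"
  using assms by (auto intro!: eq_vecI simp: scalar_prod_def)

text \<open>Split a complex eigenvector into real and imaginary parts a and b. Comparing h(a, T b)
  with h(T a, b) cancels the terms in the real part of \<open>e\<close> and leaves Im e * (h(a,a) +
  h(b,b)) = 0, where the second factor is positive.\<close>

lemma self_adjoint_complex_eigenvalue_real:
  fixes T H :: "real mat"
  assumes T: "T \<in> carrier_mat m m" and H: "H \<in> carrier_mat m m"
    and adj: "\<And>x y. x \<in> carrier_vec m \<Longrightarrow> y \<in> carrier_vec m \<Longrightarrow>
      x \<bullet> (H *\<^sub>v (T *\<^sub>v y)) = (T *\<^sub>v x) \<bullet> (H *\<^sub>v y)"
    and pos: "\<And>x. x \<in> carrier_vec m \<Longrightarrow> x \<noteq> 0\<^sub>v m \<Longrightarrow> 0 < x \<bullet> (H *\<^sub>v x)"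
    and ev: "eigenvalue (map_mat complex_of_real T) e"
  shows "Im e = 0"
proof -
  obtain v where v: "v \<in> carrier_vec m" "v \<noteq> 0\<^sub>v m" "map_mat complex_of_real T *\<^sub>v v = e \<cdot>\<^sub>v v"
    using ev T by (auto simp: eigenvalue_def eigenvector_def)
  define a b where "a = map_vec Re v" and "b = map_vec Im v"
  have ab: "a \<in> carrier_vec m" "b \<in> carrier_vec m"
    using v by (auto simp: a_def b_def)
  have Ta: "T *\<^sub>v a = Re e \<cdot>\<^sub>v a - Im e \<cdot>\<^sub>v b"
    unfolding a_def b_def map_vec_Re_mult(1)[OF T v(1), symmetric] v(3) using v(1) by (intro eq_vecI) auto
  have Tb: "T *\<^sub>v b = Re e \<cdot>\<^sub>v b + Im e \<cdot>\<^sub>v a"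
    unfolding a_def b_def map_vec_Re_mult(2)[OF T v(1), symmetric] v(3) using v(1) by (intro eq_vecI) auto
  define h where "h x y = x \<bullet> (H *\<^sub>v y)" for x y
  have "h a (T *\<^sub>v b) = h (T *\<^sub>v a) b"
    using adj ab by (simp add: h_def)
  hence "Im e * (h a a + h b b) = 0"
    using ab H unfolding Ta Tb h_def
    by (simp add: mult_add_distrib_mat_vec[of _ m m] mult_mat_vec[of _ m m] minus_scalar_prod_distrib[of _ m]
        scalar_prod_add_distrib[of _ m] algebra_simps)
  moreover have "h a a + h b b > 0"
  proof -
    have "a \<noteq> 0\<^sub>v m \<or> b \<noteq> 0\<^sub>v m"
    proof (rule ccontr)
      assume c: "\<not> ?thesis"
      have "v = 0\<^sub>v m"
      proof (rule eq_vecI)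
        fix i assume "i < dim_vec (0\<^sub>v m :: complex vec)"
        hence "i < m" by simp
        moreover have "a $ i = 0" "b $ i = 0"
          using c \<open>i < m\<close> by auto
        ultimately show "v $ i = 0\<^sub>v m $ i"
          using v by (simp add: a_def b_def complex_eq_iff)
      qed (use v in auto)
      with v show False by blast
    qed
    moreover have "h x x \<ge> 0" if "x \<in> carrier_vec m" for x
      using pos[OF that] H by (cases "x = 0\<^sub>v m") (auto simp: h_def intro: less_imp_le)
    ultimately show ?thesis
      using pos[of a] pos[of b] ab by (fastforce simp: h_def intro: add_pos_nonneg add_nonneg_pos)
  qed
  ultimately show ?thesis
    by simp
qed

text \<open>The complexified characteristic polynomial splits and all its roots are real, so its
  factorization is the image of a real one; the embedding of the coefficients is injective.\<close>

lemma real_or_complex_real: "real_or_complex TYPE(real)"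
proof
  fix T H :: "real mat" and m
  assume T: "T \<in> carrier_mat m m" and H: "H \<in> carrier_mat m m"
    and adj: "\<And>x y. x \<in> carrier_vec m \<Longrightarrow> y \<in> carrier_vec m \<Longrightarrow>
      conjugate x \<bullet> (H *\<^sub>v (T *\<^sub>v y)) = conjugate (T *\<^sub>v x) \<bullet> (H *\<^sub>v y)"
    and pos: "\<And>x. x \<in> carrier_vec m \<Longrightarrow> x \<noteq> 0\<^sub>v m \<Longrightarrow> 0 < conjugate x \<bullet> (H *\<^sub>v x)"
  interpret P: map_poly_inj_idom_hom complex_of_real ..
  let ?T = "map_mat complex_of_real T"
  have TC: "?T \<in> carrier_mat m m"
    using T by simp
  obtain es where es: "char_poly ?T = (\<Prod>a\<leftarrow>es. [:- a, 1:])"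
    using char_poly_factorized[OF TC] by blast
  have real: "complex_of_real (Re e) = e" if "e \<in> set es" for e
  proof -
    have "poly (char_poly ?T) e = 0"
      using that by (auto simp: es poly_prod_list prod_list_zero_iff intro!: bexI[of _ e])
    hence "eigenvalue ?T e"
      using eigenvalue_root_char_poly[OF TC] by simp
    hence "Im e = 0"
      using self_adjoint_complex_eigenvalue_real[OF T H] adj pos by simp
    thus ?thesis
      by (simp add: complex_eq_iff)
  qed
  have "map_poly complex_of_real (char_poly T) = char_poly ?T"
    by (rule of_real_hom.char_poly_hom[OF T, symmetric])
  also have "\<dots> = (\<Prod>a\<leftarrow>map Re es. map_poly complex_of_real [:- a, 1:])"
    unfolding es by (intro arg_cong[of _ _ prod_list]) (simp add: real)
  also have "\<dots> = map_poly complex_of_real (\<Prod>a\<leftarrow>map Re es. [:- a, 1:])"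
    by (simp only: P.hom_prod_list map_map o_def)
  finally have "char_poly T = (\<Prod>a\<leftarrow>map Re es. [:- a, 1:])"
    by simp
  thus "\<exists>es. char_poly T = (\<Prod>a\<leftarrow>es. [:- a, 1:])"
    by blast
qed (auto simp: Reals_def)

section \<open>The symplectic form and a symplectic Hermitian matrix\<close>

lemma symplectic_form_carrier [simp]: "symplectic_form n \<in> carrier_mat (2 * n) (2 * n)"
  by (auto simp: symplectic_form_def mult_2)

lemma symplectic_form_dim [simp]:
  "dim_row (symplectic_form n) = 2 * n" "dim_col (symplectic_form n) = 2 * n"
  by (auto simp: symplectic_form_def)

lemma symplectic_form_index:
  "i < 2 * n \<Longrightarrow> j < 2 * n \<Longrightarrow> symplectic_form n $$ (i, j) =
     (if j = i + n then 1 else if i = j + n then -1 else 0)"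
  by (auto simp: symplectic_form_def)

lemma transpose_symplectic_form: "(symplectic_form n)\<^sup>T = - symplectic_form n"
  by (rule eq_matI) (auto simp: symplectic_form_index)

lemma conj_symplectic_form [simp]:
  "conj_mat (symplectic_form n) = (symplectic_form n :: 'a :: conjugatable_field mat)"
  by (rule eq_matI) (auto simp: symplectic_form_index conjugate_neg)

lemma symplectic_form_mult_vec_index:
  assumes "x \<in> carrier_vec (2 * n)" "i < 2 * n"
  shows "(symplectic_form n *\<^sub>v x) $ i = (if i < n then x $ (i + n) else - x $ (i - n))"
proof -
  have "(symplectic_form n *\<^sub>v x) $ i =
      (\<Sum>j<2*n. (if j = i + n then 1 else if i = j + n then -1 else 0) * x $ j)"
    using assms by (simp add: scalar_prod_def atLeast0LessThan symplectic_form_index)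
  also have "\<dots> = (\<Sum>j\<in>{if i < n then i + n else i - n}.
      (if j = i + n then 1 else if i = j + n then -1 else 0) * x $ j)"
    using assms by (intro sum.mono_neutral_right) (auto split: if_splits)
  finally show ?thesis
    using assms by (auto split: if_splits)
qed

lemma symplectic_form_mult_mult_vec:
  assumes "x \<in> carrier_vec (2 * n)"
  shows "symplectic_form n *\<^sub>v (symplectic_form n *\<^sub>v x) = - x"
  using assms
  by (intro eq_vecI) (auto simp: symplectic_form_mult_vec_index mult_mat_vec_carrier[OF symplectic_form_carrier] simp del: index_mult_mat_vec)

lemma mat_eq_of_mult_vec:
  fixes A :: "'a :: semiring_1 mat"
  assumes "A \<in> carrier_mat n m" "B \<in> carrier_mat n m"
    and "\<And>x. x \<in> carrier_vec m \<Longrightarrow> A *\<^sub>v x = B *\<^sub>v x"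
  shows "A = B"
proof (rule eq_matI)
  fix i j assume ij: "i < dim_row B" "j < dim_col B"
  have "(A *\<^sub>v unit_vec m j) $ i = (B *\<^sub>v unit_vec m j) $ i"
    using assms by simp
  thus "A $$ (i, j) = B $$ (i, j)"
    using assms(1,2) ij by simp
qed (use assms in auto)

lemma symplectic_form_square: "symplectic_form n * symplectic_form n = - (1\<^sub>m (2 * n) :: 'a :: comm_ring_1 mat)"
proof (rule mat_eq_of_mult_vec)
  fix x :: "'a vec" assume "x \<in> carrier_vec (2 * n)"
  thus "symplectic_form n * symplectic_form n *\<^sub>v x = - 1\<^sub>m (2 * n) *\<^sub>v x"
    by (simp add: assoc_mult_mat_vec[of _ "2*n" "2*n" _ "2*n"] symplectic_form_mult_mult_vec)
qed (auto intro!: mult_carrier_mat[of _ _ "2*n"])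

text \<open>\<open>M\<close> will be the Gram matrix of \<open>S\<close>, and \<open>p\<close> fixes
  the splitting into two parts. The symplectic condition uses the plain transpose, which by
  \<open>M_hermitian\<close> is the conjugate of \<open>M\<close>; this combination is what turns
  the antilinear map \<open>tau\<close> into a square root of -1.\<close>

locale symplectic_pair = real_or_complex field_type
  for field_type :: "'a :: {conjugatable_ordered_field, real_field} itself" +
  fixes N n p :: nat and M :: "'a mat"
  assumes N_eq: "N = 2 * n"
    and p_le: "p \<le> n"
    and M_carrier [simp]: "M \<in> carrier_mat N N"
    and M_hermitian: "conj_mat M = M\<^sup>T"
    and M_symplectic: "M\<^sup>T * symplectic_form n * M = symplectic_form n"
    and M_pos: "x \<in> carrier_vec N \<Longrightarrow> x \<noteq> 0\<^sub>v N \<Longrightarrow> 0 < conjugate x \<bullet> (M *\<^sub>v x)"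
begin

abbreviation "V \<equiv> carrier_vec N :: 'a vec set"
abbreviation "J \<equiv> symplectic_form n :: 'a mat"

lemmas J_mult_mult_vec = symplectic_form_mult_mult_vec[of _ n, folded N_eq]

lemma J_carrier [simp]: "J \<in> carrier_mat N N"
  by (simp add: N_eq)

lemma M_dim [simp]: "dim_row M = N" "dim_col M = N"
  by (rule carrier_matD[OF M_carrier])+

lemma index_less [simp]: "i < n \<Longrightarrow> i < N" "i < n \<Longrightarrow> i + n < N"
  by (auto simp: N_eq)

text \<open>Diagonal of the reflection Sigma. The coordinates \<open>k\<close> and
  \<open>k + n\<close>, which the symplectic form pairs, always receive the same sign.\<close>

definition sg :: "nat \<Rightarrow> 'a" where
  "sg k = (if k < p \<or> n \<le> k \<and> k < n + p then 1 else - 1)"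

definition reflect :: "'a vec \<Rightarrow> 'a vec" where
  "reflect x = mat_diag N sg *\<^sub>v x"

definition om :: "'a vec \<Rightarrow> 'a vec \<Rightarrow> 'a" where
  "om x y = x \<bullet> (J *\<^sub>v y)"

text \<open>An antilinear map, written as a matrix applied to the conjugated vector;
  \<open>M\<^sup>T\<close> is the conjugate of \<open>M\<close>.\<close>

definition tau :: "'a vec \<Rightarrow> 'a vec" where
  "tau x = - (J * M\<^sup>T) *\<^sub>v conjugate x"

text \<open>The mean of the matrix of \<open>tau\<close> and its conjugate under Sigma, hence the
  part commuting with Sigma. An explicit matrix is kept for \<open>K\<close>, unlike for
  \<open>B\<close>, because the square of \<open>K\<close> has to be presented as a matrix with a
  characteristic polynomial.\<close>

definition Kmat :: "'a mat" where
  "Kmat = (1/2) \<cdot>\<^sub>m (- (J * M\<^sup>T) + mat_diag N sg * - (J * M\<^sup>T) * mat_diag N sg)"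

definition K :: "'a vec \<Rightarrow> 'a vec" where
  "K x = Kmat *\<^sub>v conjugate x"

definition B :: "'a vec \<Rightarrow> 'a vec" where
  "B x = (1/2) \<cdot>\<^sub>v (tau x - reflect (tau (reflect x)))"

section \<open>Algebra of the reflection, the symplectic form and the antilinear operators\<close>

lemma conjugate_half [simp]: "conjugate (1/2 :: 'a) = 1/2"
proof -
  have "(1/2 :: 'a) = of_real (1/2)"
    by simp
  thus ?thesis
    using conjugate_of_real by metis
qed

lemma conjugate_divide_two [simp]: "conjugate (x / 2 :: 'a) = conjugate x / 2"
  using conjugate_dist_mul[of "1/2" x] by simp

lemma conj_sg [simp]: "conjugate (sg k) = sg k"
  by (auto simp: sg_def conjugate_neg)

lemma sg_sq [simp]: "sg k * sg k = 1"
  by (auto simp: sg_def)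

lemma sg_shift: "k < n \<Longrightarrow> sg (k + n) = sg k"
  by (auto simp: sg_def)

lemma reflect_eq: "x \<in> V \<Longrightarrow> reflect x = vec N (\<lambda>i. sg i * x $ i)"
  by (rule eq_vecI)
    (auto simp: reflect_def mat_diag_def scalar_prod_def if_distribR if_distrib[of "\<lambda>a. a * _"] cong: if_cong)

lemma reflect_closed [simp]: "x \<in> V \<Longrightarrow> reflect x \<in> V"
  by (simp add: reflect_eq)

lemma reflect_reflect [simp]: "x \<in> V \<Longrightarrow> reflect (reflect x) = x"
  by (rule eq_vecI) (auto simp: reflect_eq simp flip: mult.assoc)

lemma dim_reflect [simp]: "dim_vec (reflect x) = N"
  by (simp add: reflect_def mat_diag_def)

lemma reflect_smult: "x \<in> V \<Longrightarrow> reflect (a \<cdot>\<^sub>v x) = a \<cdot>\<^sub>v reflect x"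
  by (rule eq_vecI) (auto simp: reflect_eq)

lemma reflect_add: "x \<in> V \<Longrightarrow> y \<in> V \<Longrightarrow> reflect (x + y) = reflect x + reflect y"
  by (rule eq_vecI) (auto simp: reflect_eq algebra_simps)

lemma reflect_minus: "x \<in> V \<Longrightarrow> y \<in> V \<Longrightarrow> reflect (x - y) = reflect x - reflect y"
  by (rule eq_vecI) (auto simp: reflect_eq algebra_simps)

lemma reflect_uminus: "x \<in> V \<Longrightarrow> reflect (- x) = - reflect x"
  by (rule eq_vecI) (auto simp: reflect_eq)

lemma conj_reflect: "x \<in> V \<Longrightarrow> conjugate (reflect x) = reflect (conjugate x)"
  by (rule eq_vecI) (auto simp: reflect_eq conjugate_dist_mul)

lemma om_eq: 
  assumes "x \<in> V" "y \<in> V"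
  shows "om x y = (\<Sum>i<n. x $ i * y $ (i + n) - x $ (i + n) * y $ i)"
proof -
  have "om x y = (\<Sum>i<N. x $ i * (if i < n then y $ (i + n) else - y $ (i - n)))"
    using assms mult_mat_vec_carrier[OF J_carrier assms(2)]
    by (auto simp: om_def scalar_prod_def symplectic_form_mult_vec_index N_eq atLeast0LessThan
        simp del: index_mult_mat_vec intro!: sum.cong)
  also have "{..<N} = {..<n} \<union> {n..<n+n}"
    by (auto simp: N_eq)
  also have "(\<Sum>i\<in>\<dots>. x $ i * (if i < n then y $ (i + n) else - y $ (i - n))) =
      (\<Sum>i<n. x $ i * y $ (i + n)) + (\<Sum>i=n..<n+n. - (x $ i * y $ (i - n)))"
    by (subst sum.union_disjoint) auto
  also have "(\<Sum>i=n..<n+n. - (x $ i * y $ (i - n))) = (\<Sum>i<n. - (x $ (i + n) * y $ i))"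
    by (rule sum.reindex_bij_witness[of _ "\<lambda>i. i + n" "\<lambda>i. i - n"]) auto
  finally show ?thesis
    by (simp add: sum_subtractf sum_negf)
qed

lemma om_antisym: "x \<in> V \<Longrightarrow> y \<in> V \<Longrightarrow> om x y = - om y x"
  by (simp add: om_eq algebra_simps flip: sum_negf)

lemma om_self [simp]: "x \<in> V \<Longrightarrow> om x x = 0"
  by (simp add: om_eq mult.commute)

lemma J_mult_vec_closed [simp]: "x \<in> V \<Longrightarrow> J *\<^sub>v x \<in> V"
  by (rule mult_mat_vec_carrier[OF J_carrier])

lemma om_smult_left [simp]: "x \<in> V \<Longrightarrow> y \<in> V \<Longrightarrow> om (a \<cdot>\<^sub>v x) y = a * om x y"
  unfolding om_def by (rule smult_scalar_prod_distrib) auto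

lemma om_smult_right [simp]: "x \<in> V \<Longrightarrow> y \<in> V \<Longrightarrow> om x (a \<cdot>\<^sub>v y) = a * om x y"
  unfolding om_def by (subst mult_mat_vec[OF J_carrier]) (auto intro: scalar_prod_smult_distrib)

lemma om_add_left: "x \<in> V \<Longrightarrow> y \<in> V \<Longrightarrow> z \<in> V \<Longrightarrow> om (x + y) z = om x z + om y z"
  unfolding om_def by (rule add_scalar_prod_distrib) auto

lemma om_minus_left: "x \<in> V \<Longrightarrow> y \<in> V \<Longrightarrow> z \<in> V \<Longrightarrow> om (x - y) z = om x z - om y z"
  unfolding om_def by (rule minus_scalar_prod_distrib) auto

text \<open>Sigma is symplectic because the two coordinates of each conjugate pair carry the same
  sign, whose square is 1.\<close>

lemma om_reflect: "x \<in> V \<Longrightarrow> y \<in> V \<Longrightarrow> om (reflect x) (reflect y) = om x y"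
proof -
  assume xy: "x \<in> V" "y \<in> V"
  have h: "(sg i * a) * (sg (i + n) * b) = a * b" "(sg (i + n) * a) * (sg i * b) = a * b" if "i < n" for i a b
    using sg_sq[of i] that by (auto simp: sg_def)
  hence "(\<Sum>i<n. sg i * x $ i * (sg (i + n) * y $ (i + n)) - sg (i + n) * x $ (i + n) * (sg i * y $ i)) =
      (\<Sum>i<n. x $ i * y $ (i + n) - x $ (i + n) * y $ i)"
    by (intro sum.cong refl) (simp only: h lessThan_iff)
  thus ?thesis
    using xy by (simp add: om_eq reflect_eq cong: sum.cong_simp)
qed

lemma JM_carrier [simp]: "- (J * M\<^sup>T) \<in> carrier_mat N N"
  by (auto intro!: mult_carrier_mat[of _ _ N])

lemma dim_tau [simp]: "dim_vec (tau x) = N"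
  by (simp add: tau_def N_eq)

lemma tau_closed [simp]: "x \<in> V \<Longrightarrow> tau x \<in> V"
  unfolding tau_def by (intro mult_mat_vec_carrier[OF JM_carrier]) auto

lemma tau_eq: 
  assumes "x \<in> V"
  shows "tau x = - (J *\<^sub>v conjugate (M *\<^sub>v x))"
proof -
  have "J * M\<^sup>T \<in> carrier_mat N N"
    by (auto intro!: mult_carrier_mat[of _ _ N])
  thus ?thesis
    using assms by (simp add: tau_def conj_mat_mult_vec[of _ N N] M_hermitian carrier_vecD N_eq[symmetric]
        assoc_mult_mat_vec[of _ N N _ N])
qed

lemma tau_smult: "x \<in> V \<Longrightarrow> tau (a \<cdot>\<^sub>v x) = conjugate a \<cdot>\<^sub>v tau x"
  unfolding tau_def conjugate_smult_vec by (rule mult_mat_vec[OF JM_carrier]) auto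

lemma tau_add: "x \<in> V \<Longrightarrow> y \<in> V \<Longrightarrow> tau (x + y) = tau x + tau y"
  unfolding tau_def by (subst conjugate_add_vec) (auto intro!: mult_add_distrib_mat_vec[OF JM_carrier] simp del: uminus_mult_mat_vec)

lemma conjugate_uminus_vec: "conjugate (- x :: 'a vec) = - conjugate x"
  by (rule eq_vecI) (auto simp: conjugate_neg)

lemma tau_minus: "x \<in> V \<Longrightarrow> y \<in> V \<Longrightarrow> tau (x - y) = tau x - tau y"
proof -
  assume xy: "x \<in> V" "y \<in> V"
  have "conjugate (x - y) = conjugate x - conjugate y"
    using xy by (intro eq_vecI) (auto simp: conjugate_dist_add conjugate_neg diff_conv_add_uminus simp del: add_uminus_conv_diff)
  thus ?thesis
    using xy unfolding tau_def by (simp add: mult_minus_distrib_mat_vec[OF JM_carrier] del: uminus_mult_mat_vec)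
qed

text \<open>Applying the map twice conjugates twice, and the result collapses to J (M^T J M) x = J
  (J x).\<close>

lemma tau_tau:
  assumes "x \<in> V"
  shows "tau (tau x) = - x"
proof -
  have c: "J * M\<^sup>T \<in> carrier_mat N N"
    by (auto intro!: mult_carrier_mat[of _ _ N])
  have Mx: "M *\<^sub>v x \<in> V"
    using assms by (auto intro!: mult_mat_vec_carrier[OF M_carrier] carrier_vec_conjugate)
  have "conjugate (tau x) = - (J *\<^sub>v (M *\<^sub>v x))"
    using Mx by (simp add: tau_eq[OF assms] conjugate_uminus_vec conj_mat_mult_vec[OF J_carrier])
  hence "tau (tau x) = (J * M\<^sup>T) *\<^sub>v (J *\<^sub>v (M *\<^sub>v x))"
    using Mx unfolding tau_def[of "tau x"]
    by (intro eq_vecI) (simp_all add: \<open>conjugate (tau x) = _\<close> N_eq[symmetric])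
  also have "\<dots> = J *\<^sub>v ((M\<^sup>T * J * M) *\<^sub>v x)"
    using assms Mx mult_mat_vec_carrier[OF J_carrier Mx]
    by (simp add: assoc_mult_mat_vec[of _ N N _ N] mult_carrier_mat[of _ N N _ N])
  also have "\<dots> = - x"
    unfolding M_symplectic using assms by (rule J_mult_mult_vec)
  finally show ?thesis .
qed

text \<open>The defining purpose of \<open>tau\<close>: positivity and Hermitian symmetry of
  \<open>M\<close> become statements about \<open>om\<close>.\<close>

lemma om_tau:
  assumes "x \<in> V" "y \<in> V"
  shows "om (tau x) y = - (conjugate x \<bullet> (M *\<^sub>v y))"
proof -
  have Mx: "conjugate (M *\<^sub>v x) \<in> V"
    using assms by (auto intro!: mult_mat_vec_carrier[OF M_carrier] carrier_vec_conjugate)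
  have JMx: "J *\<^sub>v conjugate (M *\<^sub>v x) \<in> V"
    by (rule mult_mat_vec_carrier[OF J_carrier Mx])
  have "om (tau x) y = - om y (tau x)"
    using assms by (intro om_antisym) auto
  also have "\<dots> = om y (J *\<^sub>v conjugate (M *\<^sub>v x))"
    using assms JMx by (simp add: tau_eq om_eq flip: sum_negf)
  also have "\<dots> = - (y \<bullet> conjugate (M *\<^sub>v x))"
    using assms Mx by (simp add: om_def J_mult_mult_vec carrier_vecD)
  also have "y \<bullet> conjugate (M *\<^sub>v x) = y \<bullet> (M\<^sup>T *\<^sub>v conjugate x)"
    using assms by (simp add: conj_mat_mult_vec[of _ N N] M_hermitian)
  also have "\<dots> = (M\<^sup>T *\<^sub>v conjugate x) \<bullet> y"
    using assms by (intro comm_scalar_prod[of _ N]) (auto intro!: mult_mat_vec_carrier[of _ N N])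
  also have "\<dots> = conjugate x \<bullet> (M *\<^sub>v y)"
    using assms by (intro transpose_vec_mult_scalar[OF M_carrier]) auto
  finally show ?thesis .
qed

lemma M_form_conj:
  assumes "x \<in> V" "y \<in> V"
  shows "conjugate (conjugate x \<bullet> (M *\<^sub>v y)) = conjugate y \<bullet> (M *\<^sub>v x)"
proof -
  have My: "M *\<^sub>v y \<in> V"
    using assms by (auto intro!: mult_mat_vec_carrier[OF M_carrier] carrier_vec_conjugate)
  have "conjugate (conjugate x \<bullet> (M *\<^sub>v y)) = x \<bullet> conjugate (M *\<^sub>v y)"
    using assms My by (simp add: conjugate_sprod_vec)
  also have "\<dots> = x \<bullet> (M\<^sup>T *\<^sub>v conjugate y)"
    using assms by (simp add: conj_mat_mult_vec[of _ N N] M_hermitian)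
  also have "\<dots> = (M\<^sup>T *\<^sub>v conjugate y) \<bullet> x"
    using assms by (intro comm_scalar_prod[of _ N]) (auto intro!: mult_mat_vec_carrier[of _ N N])
  also have "\<dots> = conjugate y \<bullet> (M *\<^sub>v x)"
    using assms by (intro transpose_vec_mult_scalar[OF M_carrier]) auto
  finally show ?thesis .
qed

lemma om_tau_conj: "x \<in> V \<Longrightarrow> y \<in> V \<Longrightarrow> conjugate (om (tau x) y) = om (tau y) x"
  by (simp add: om_tau conjugate_neg M_form_conj)

lemma Kmat_carrier [simp]: "Kmat \<in> carrier_mat N N"
  unfolding Kmat_def by (auto intro!: mult_carrier_mat[of _ N N] simp: mat_diag_def)

lemma K_eq: 
  assumes "x \<in> V"
  shows "K x = (1/2) \<cdot>\<^sub>v (tau x + reflect (tau (reflect x)))"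
proof -
  define D where "D = mat_diag N sg"
  define T where "T = - (J * M\<^sup>T)"
  have D: "D \<in> carrier_mat N N" and T: "T \<in> carrier_mat N N"
    by (auto simp: D_def T_def intro!: mult_carrier_mat[of _ _ N])
  have TD: "T *\<^sub>v (D *\<^sub>v conjugate x) = tau (reflect x)"
    using assms by (simp only: tau_def T_def[symmetric] conj_reflect) (simp add: reflect_def D_def)
  have "K x = (1/2) \<cdot>\<^sub>v ((T + D * T * D) *\<^sub>v conjugate x)"
    using assms D T unfolding K_def Kmat_def D_def[symmetric] T_def[symmetric]
    by (auto intro!: eq_vecI simp: scalar_prod_def sum_distrib_left algebra_simps)
  also have "(T + D * T * D) *\<^sub>v conjugate x = T *\<^sub>v conjugate x + D *\<^sub>v (T *\<^sub>v (D *\<^sub>v conjugate x))"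
    using assms D T by (simp add: add_mult_distrib_mat_vec[of _ N N] assoc_mult_mat_vec[of _ N N _ N]
        mult_carrier_mat[of _ N N _ N])
  finally show ?thesis
    unfolding TD by (simp add: tau_def reflect_def D_def T_def)
qed

lemma dim_K [simp]: "dim_vec (K x) = N"
  using Kmat_carrier by (simp add: K_def del: Kmat_carrier)

lemma dim_B [simp]: "dim_vec (B x) = N"
  by (simp add: B_def)

lemma K_closed [simp]: "x \<in> V \<Longrightarrow> K x \<in> V"
  by (simp add: K_eq)

lemma B_closed [simp]: "x \<in> V \<Longrightarrow> B x \<in> V"
  by (simp add: B_def)

lemma K_smult: "x \<in> V \<Longrightarrow> K (a \<cdot>\<^sub>v x) = conjugate a \<cdot>\<^sub>v K x"
  by (rule eq_vecI) (auto simp: K_eq reflect_smult tau_smult algebra_simps)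

lemma B_smult: "x \<in> V \<Longrightarrow> B (a \<cdot>\<^sub>v x) = conjugate a \<cdot>\<^sub>v B x"
  by (rule eq_vecI) (auto simp: B_def reflect_smult tau_smult algebra_simps)

lemma K_reflect: "x \<in> V \<Longrightarrow> K (reflect x) = reflect (K x)"
  by (rule eq_vecI) (auto simp: K_eq reflect_smult reflect_add algebra_simps)

lemma B_reflect: "x \<in> V \<Longrightarrow> B (reflect x) = - reflect (B x)"
  by (rule eq_vecI) (auto simp: B_def reflect_smult reflect_minus algebra_simps)

lemma om_K_conj: 
  assumes "x \<in> V" "y \<in> V"
  shows "conjugate (om (K x) y) = om (K y) x"
proof -
  have "om (reflect (tau (reflect x))) y = om (tau (reflect x)) (reflect y)" if "x \<in> V" "y \<in> V" for x y
    using om_reflect[of "tau (reflect x)" "reflect y"] that by simp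
  thus ?thesis
    using assms by (simp add: K_eq om_add_left conjugate_dist_mul conjugate_dist_add om_tau_conj)
qed

lemma om_B_conj: 
  assumes "x \<in> V" "y \<in> V"
  shows "conjugate (om (B x) y) = om (B y) x"
proof -
  have "om (reflect (tau (reflect x))) y = om (tau (reflect x)) (reflect y)" if "x \<in> V" "y \<in> V" for x y
    using om_reflect[of "tau (reflect x)" "reflect y"] that by simp
  thus ?thesis
    using assms by (simp add: B_def om_minus_left conjugate_dist_mul conjugate_dist_add conjugate_neg 
        om_tau_conj diff_conv_add_uminus del: add_uminus_conv_diff)
qed

text \<open>The two mixed terms occur here and in \<open>B_B\<close> with opposite signs, so the
  squares of \<open>K\<close> and \<open>B\<close> add up to -1.\<close>

lemma K_K: "x \<in> V \<Longrightarrow> K (K x) = (1/4) \<cdot>\<^sub>v (- (2 \<cdot>\<^sub>v x) + tau (reflect (tau (reflect x))) + reflect (tau (reflect (tau x))))"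
  by (rule eq_vecI) (auto simp: K_eq reflect_smult tau_smult reflect_add tau_add tau_tau reflect_uminus algebra_simps)

lemma B_B: "x \<in> V \<Longrightarrow> B (B x) = (1/4) \<cdot>\<^sub>v (- (2 \<cdot>\<^sub>v x) - tau (reflect (tau (reflect x))) - reflect (tau (reflect (tau x))))"
  by (rule eq_vecI) (auto simp: B_def reflect_smult tau_smult reflect_minus tau_minus tau_tau reflect_uminus algebra_simps)

lemma B_B_eigen:
  assumes "x \<in> V" "K (K x) = a \<cdot>\<^sub>v x"
  shows "B (B x) = (- 1 - a) \<cdot>\<^sub>v x"
proof (rule eq_vecI)
  fix i assume "i < dim_vec ((- 1 - a) \<cdot>\<^sub>v x)"
  hence i: "i < N"
    using assms by simp
  have "K (K x) $ i = a * x $ i" "dim_vec x = N"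
    using assms i by simp_all
  thus "B (B x) $ i = ((- 1 - a) \<cdot>\<^sub>v x) $ i"
    using assms(1) i unfolding K_K[OF assms(1)] B_B[OF assms(1)] by (simp add: field_simps)
qed (use assms in simp)

text \<open>Both \<open>tau\<close> and its conjugate under Sigma square to -1. In the product of
  their sum and their difference these squares cancel, and the mixed terms that remain change sign
  with the order of the factors.\<close>

lemma K_B: "x \<in> V \<Longrightarrow> K (B x) = - B (K x)"
  by (rule eq_vecI)
    (auto simp: K_eq B_def reflect_smult tau_smult reflect_add tau_add reflect_minus tau_minus tau_tau reflect_uminus field_simps)

end

section \<open>Frames\<close>

context symplectic_pair
begin

section \<open>Positivity of the form defined by K and self-adjointness of the square of K\<close>

lemma M_form_real_pos:
  assumes "x \<in> V" "x \<noteq> 0\<^sub>v N"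
  obtains r where "conjugate x \<bullet> (M *\<^sub>v x) = of_real r" "r > 0"
proof -
  have "conjugate x \<bullet> (M *\<^sub>v x) \<in> \<real>"
    using assms by (intro conjugate_eq_self M_form_conj)
  then obtain r where r: "conjugate x \<bullet> (M *\<^sub>v x) = of_real r"
    by (auto elim: Reals_cases)
  have "(0 :: 'a) \<le> of_real r" "(0 :: 'a) \<noteq> of_real r"
    using M_pos[OF assms] unfolding r less_le by blast+
  hence "r > 0"
    by (auto simp: less_le)
  with r that show thesis by blast
qed

lemma reflect_eq_0: "x \<in> V \<Longrightarrow> x \<noteq> 0\<^sub>v N \<Longrightarrow> reflect x \<noteq> 0\<^sub>v N"
proof
  assume x: "x \<in> V" "x \<noteq> 0\<^sub>v N" and "reflect x = 0\<^sub>v N"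
  hence "x = reflect (0\<^sub>v N)"
    using reflect_reflect[of x] by simp
  also have "\<dots> = 0\<^sub>v N"
    by (rule eq_vecI) (auto simp: reflect_eq)
  finally show False
    using x by blast
qed

text \<open>Since Sigma preserves \<open>om\<close>, the value \<open>- om (K x) x\<close> is the
  mean of the \<open>M\<close>-form at \<open>x\<close> and at its reflection, so it inherits
  positivity.\<close>

lemma om_K_pos:
  assumes "x \<in> V" "x \<noteq> 0\<^sub>v N"
  obtains r where "om (K x) x = - of_real r" "r > 0"
proof -
  obtain r where r: "conjugate x \<bullet> (M *\<^sub>v x) = of_real r" "r > 0"
    by (rule M_form_real_pos[OF assms])
  obtain s where s: "conjugate (reflect x) \<bullet> (M *\<^sub>v reflect x) = of_real s" "s > 0"
    by (rule M_form_real_pos[OF reflect_closed[OF assms(1)] reflect_eq_0[OF assms]])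
  have "om (reflect (tau (reflect x))) x = om (tau (reflect x)) (reflect x)"
    using om_reflect[of "tau (reflect x)" "reflect x"] assms by simp
  hence "om (K x) x = - of_real ((r + s) / 2)"
    using assms by (simp add: K_eq om_add_left om_tau r s field_simps)
  moreover have "(r + s) / 2 > 0"
    using r s by simp
  ultimately show thesis
    using that by blast
qed

lemma K_eq_0: "x \<in> V \<Longrightarrow> x \<noteq> 0\<^sub>v N \<Longrightarrow> K x \<noteq> 0\<^sub>v N"
proof
  assume x: "x \<in> V" "x \<noteq> 0\<^sub>v N" and "K x = 0\<^sub>v N"
  hence "om (K x) x = 0"
    by (simp add: om_def)
  moreover obtain r where "om (K x) x = - of_real r" "r > 0"
    by (rule om_K_pos[OF x])
  ultimately show False by simp
qed

text \<open>Self-adjointness of the square of \<open>K\<close> for the form that sends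
  \<open>x\<close>, \<open>y\<close> to \<open>- om (K x) y\<close>. Moving one \<open>K\<close>
  across costs a conjugation, which the second one undoes.\<close>

lemma om_K_K_left:
  assumes "x \<in> V" "y \<in> V"
  shows "om (K (K (K x))) y = om (K x) (K (K y))"
proof -
  have "om (K (K (K x))) y = conjugate (om (K y) (K (K x)))"
    using assms by (simp add: om_K_conj)
  also have "\<dots> = - conjugate (om (K (K x)) (K y))"
    using om_antisym[of "K y" "K (K x)"] assms by (simp add: conjugate_neg)
  also have "\<dots> = - om (K (K y)) (K x)"
    using assms by (simp add: om_K_conj)
  also have "\<dots> = om (K x) (K (K y))"
    using om_antisym[of "K x" "K (K y)"] assms by simp
  finally show ?thesis .
qed

lemma K_K_eq_mult_vec:
  assumes "x \<in> V"
  shows "K (K x) = (Kmat * conj_mat Kmat) *\<^sub>v x"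
  using assms by (simp add: K_def conj_mat_mult_vec[of _ N N] assoc_mult_mat_vec[of _ N N _ N])

text \<open>Exhibits the matrix of that form, in the shape demanded by
  \<open>self_adjoint_splits\<close>.\<close>

lemma om_K_eq_form:
  assumes "x \<in> V" "y \<in> V"
  shows "conjugate x \<bullet> (- (Kmat\<^sup>T * J) *\<^sub>v y) = - om (K x) y"
proof -
  have "om (K x) y = (J *\<^sub>v y) \<bullet> (Kmat *\<^sub>v conjugate x)"
    unfolding om_def K_def using assms by (intro comm_scalar_prod[of _ N]) (auto intro!: mult_mat_vec_carrier[of _ N N])
  also have "\<dots> = (Kmat\<^sup>T *\<^sub>v (J *\<^sub>v y)) \<bullet> conjugate x"
    using assms by (intro transpose_vec_mult_scalar[OF Kmat_carrier, symmetric]) auto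
  also have "\<dots> = conjugate x \<bullet> (Kmat\<^sup>T *\<^sub>v (J *\<^sub>v y))"
    using assms by (intro comm_scalar_prod[of _ N]) (auto intro!: mult_mat_vec_carrier[of _ N N])
  also have "Kmat\<^sup>T *\<^sub>v (J *\<^sub>v y) = Kmat\<^sup>T * J *\<^sub>v y"
    using assms by (intro assoc_mult_mat_vec[of _ N N _ N, symmetric]) auto
  finally show ?thesis
    using assms by (simp add: N_eq[symmetric] carrier_vecD carrier_matD[OF Kmat_carrier])
qed

lemma K_K_splits: "\<exists>es. char_poly (- (Kmat * conj_mat Kmat)) = (\<Prod>a\<leftarrow>es. [:- a, 1:])"
proof (rule self_adjoint_splits)
  have c: "Kmat * conj_mat Kmat \<in> carrier_mat N N"
    by (auto intro!: mult_carrier_mat[of _ N N])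
  show "- (Kmat * conj_mat Kmat) \<in> carrier_mat N N" 
    using c by auto
  show "- (Kmat\<^sup>T * J) \<in> carrier_mat N N"
    by (auto intro!: mult_carrier_mat[of _ N N])
  have T: "- (Kmat * conj_mat Kmat) *\<^sub>v x = (- 1) \<cdot>\<^sub>v K (K x)" if "x \<in> V" for x
    using that c by (auto intro!: eq_vecI simp: K_K_eq_mult_vec)
  fix x assume x: "x \<in> V"
  show "conjugate x \<bullet> (- (Kmat\<^sup>T * J) *\<^sub>v (- (Kmat * conj_mat Kmat) *\<^sub>v y)) =
      conjugate (- (Kmat * conj_mat Kmat) *\<^sub>v x) \<bullet> (- (Kmat\<^sup>T * J) *\<^sub>v y)" if y: "y \<in> V" for y
    using x y by (simp only: T) (simp add: om_K_eq_form K_smult conjugate_neg om_K_K_left del: uminus_mult_mat_vec)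
  assume "x \<noteq> 0\<^sub>v N"
  then obtain r where r: "om (K x) x = - of_real r" "r > 0"
    using om_K_pos x by blast
  hence "(0 :: 'a) \<le> of_real r" "(0 :: 'a) \<noteq> of_real r"
    by auto
  with r x show "0 < conjugate x \<bullet> (- (Kmat\<^sup>T * J) *\<^sub>v x)"
    by (simp only: om_K_eq_form minus_minus less_le) auto
qed

text \<open>A partial symplectic basis adapted to \<open>K\<close> and to the parts: the index
  \<open>i\<close> itself decides, through \<open>sg i\<close>, in which part the pair lies.
  Allowing an arbitrary index set makes it possible to begin with the q-part and to fill in the rest
  later.\<close>

definition frame :: "nat set \<Rightarrow> (nat \<Rightarrow> 'a vec) \<Rightarrow> (nat \<Rightarrow> 'a vec) \<Rightarrow> (nat \<Rightarrow> real) \<Rightarrow> bool" where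
  "frame I e f c \<longleftrightarrow>
     (\<forall>i\<in>I. 0 < c i \<and> e i \<in> V \<and> f i \<in> V \<and>
        K (e i) = of_real (c i) \<cdot>\<^sub>v f i \<and> K (f i) = - of_real (c i) \<cdot>\<^sub>v e i \<and>
        reflect (e i) = sg i \<cdot>\<^sub>v e i \<and> reflect (f i) = sg i \<cdot>\<^sub>v f i) \<and>
     (\<forall>i\<in>I. \<forall>j\<in>I. om (e i) (f j) = (if i = j then 1 else 0) \<and> om (e i) (e j) = 0 \<and> om (f i) (f j) = 0)"

lemma frameD:
  assumes "frame I e f c" "i \<in> I"
  shows "0 < c i" "e i \<in> V" "f i \<in> V" "K (e i) = of_real (c i) \<cdot>\<^sub>v f i" "K (f i) = - of_real (c i) \<cdot>\<^sub>v e i"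
    "reflect (e i) = sg i \<cdot>\<^sub>v e i" "reflect (f i) = sg i \<cdot>\<^sub>v f i"
  using assms unfolding frame_def by blast+

lemma frame_omD:
  assumes "frame I e f c" "i \<in> I" "j \<in> I"
  shows "om (e i) (f j) = (if i = j then 1 else 0)" "om (e i) (e j) = 0" "om (f i) (f j) = 0"
  using assms unfolding frame_def by blast+

text \<open>Eigenspaces of the isometry Sigma for different eigenvalues are orthogonal:
  \<open>om x y\<close> equals its own negative.\<close>

lemma om_opposite_sign:
  assumes "x \<in> V" "y \<in> V" "reflect x = sg i \<cdot>\<^sub>v x" "reflect y = sg j \<cdot>\<^sub>v y" "sg i \<noteq> sg j"
  shows "om x y = 0"
proof -
  have "om x y = sg i * (sg j * om x y)"
    using om_reflect[OF assms(1,2), symmetric] unfolding assms(3,4) using assms(1,2) by (simp add: mult.left_commute)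
  moreover have "sg i * (sg j * om x y) = - om x y"
    using assms(5) by (auto simp: sg_def split: if_splits)
  ultimately have "om x y = - om x y"
    by simp
  thus ?thesis by simp
qed

text \<open>The symplectic complement of the frame inside the one part to which the new index
  \<open>j\<close> belongs.\<close>

definition frame_complement :: "nat \<Rightarrow> nat set \<Rightarrow> (nat \<Rightarrow> 'a vec) \<Rightarrow> (nat \<Rightarrow> 'a vec) \<Rightarrow> 'a vec set" where
  "frame_complement j I e f =
     {x \<in> V. reflect x = sg j \<cdot>\<^sub>v x \<and> (\<forall>i\<in>I. om (e i) x = 0 \<and> om (f i) x = 0)}"

text \<open>Up to sign and conjugation \<open>K\<close> can be moved to the other argument of
  \<open>om\<close>, and it exchanges \<open>e i\<close> and \<open>f i\<close> up to
  scalars.\<close>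

lemma K_frame_complement:
  assumes "frame I e f c" "x \<in> frame_complement j I e f"
  shows "K x \<in> frame_complement j I e f"
proof -
  have x: "x \<in> V" "reflect x = sg j \<cdot>\<^sub>v x" "\<And>i. i \<in> I \<Longrightarrow> om (e i) x = 0" "\<And>i. i \<in> I \<Longrightarrow> om (f i) x = 0"
    using assms(2) by (auto simp: frame_complement_def)
  have "om y (K x) = 0" if "y \<in> V" "om (K y) x = 0" for y
    using that x(1) om_antisym[of y "K x"] om_K_conj[of y x] by simp
  thus ?thesis
    using x frameD(2-5)[OF assms(1)] K_reflect[of x, symmetric] by (auto simp: frame_complement_def K_smult)
qed

lemma frame_complement_nonzero:
  assumes fr: "frame I e f c" and I: "I \<subseteq> {..<n}" and j: "j < n" "j \<notin> I"
  obtains x where "x \<in> frame_complement j I e f" "x \<noteq> 0\<^sub>v N"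
proof -
  define u where "u k = (if k < n then e k else f (k - n))" for k
  define R where "R = mat N N (\<lambda>(k, l).
    if sg k \<noteq> sg j then (if k = l then 1 else 0)
    else if (if k < n then k else k - n) \<in> I then - (J *\<^sub>v u k) $ l else 0)"
  have R: "R \<in> carrier_mat N N"
    by (simp add: R_def)
  \<comment> \<open>Row \<open>j\<close> is zero because \<open>j\<close> has its own sign and is
    not in \<open>I\<close>; so the transpose has a kernel, and therefore \<open>R\<close> has
    one.\<close>
  have "R\<^sup>T *\<^sub>v unit_vec N j = 0\<^sub>v N"
    using j by (intro eq_vecI) (auto simp: R_def)
  moreover have "unit_vec N j \<noteq> (0\<^sub>v N :: 'a vec)"
    using j by (intro unit_vec_nonzero) auto
  ultimately have "det R\<^sup>T = 0"
    using det_0_iff_vec_prod_zero[OF transpose_carrier_mat[THEN iffD2, OF R]] unit_vec_carrier[of N j] by blast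
  hence "det R = 0"
    using R by (simp add: det_transpose)
  then obtain x where x: "x \<in> V" "x \<noteq> 0\<^sub>v N" "R *\<^sub>v x = 0\<^sub>v N"
    using det_0_iff_vec_prod_zero[OF R] by auto
  have row: "(\<Sum>l<N. R $$ (k, l) * x $ l) = 0" if "k < N" for k
    using arg_cong[OF x(3), of "\<lambda>v. v $ k"] that x(1) R
    by (simp add: scalar_prod_def atLeast0LessThan)
  have zero: "x $ k = 0" if "k < N" "sg k \<noteq> sg j" for k
  proof -
    have "(\<Sum>l<N. R $$ (k, l) * x $ l) = (\<Sum>l<N. if l = k then x $ k else 0)"
      using that by (intro sum.cong) (auto simp: R_def)
    thus ?thesis
      using row[OF that(1)] that(1) by simp
  qed
  have xr: "reflect x = sg j \<cdot>\<^sub>v x"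
  proof (rule eq_vecI)
    fix i assume "i < dim_vec (sg j \<cdot>\<^sub>v x)"
    hence "i < N" "dim_vec x = N"
      using x(1) by auto
    thus "reflect x $ i = (sg j \<cdot>\<^sub>v x) $ i"
      using x(1) zero[of i] by (cases "sg i = sg j") (auto simp: reflect_eq)
  qed (use x(1) in auto)
  have om0: "om (u k) x = 0" if k: "k < N" "(if k < n then k else k - n) \<in> I" "sg k = sg j" "u k \<in> V" for k
  proof -
    have "0 = (\<Sum>l<N. - (J *\<^sub>v u k) $ l * x $ l)"
      unfolding row[OF k(1), symmetric] using k by (intro sum.cong) (auto simp: R_def)
    also have "\<dots> = - om x (u k)"
      using x(1) by (simp add: om_def scalar_prod_def atLeast0LessThan N_eq sum_negf mult.commute)
    also have "\<dots> = om (u k) x"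
      using om_antisym[of x "u k"] x(1) k by simp
    finally show ?thesis by simp
  qed
  have "om (e i) x = 0 \<and> om (f i) x = 0" if i: "i \<in> I" for i
  proof (cases "sg i = sg j")
    case True
    have "i < n" using i I by auto
    thus ?thesis
      using om0[of i] om0[of "i + n"] frameD[OF fr i] True i by (auto simp: u_def sg_shift)
  next
    case False
    thus ?thesis
      using om_opposite_sign[of _ x i j] x xr frameD[OF fr i] by auto
  qed
  with x xr have "x \<in> frame_complement j I e f"
    by (auto simp: frame_complement_def)
  with x that show thesis by blast
qed

lemma frame_insert:
  assumes fr: "frame I e f c" and I: "I \<subseteq> {..<n}" and j: "j < n" "j \<notin> I"
  shows "\<exists>x y d. frame (insert j I) (e(j := x)) (f(j := y)) (c(j := d))"
proof -
  let ?X = "frame_complement j I e f"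
  define T where "T = - (Kmat * conj_mat Kmat)"
  have KK: "Kmat * conj_mat Kmat \<in> carrier_mat N N"
    by (auto intro!: mult_carrier_mat[of _ N N])
  hence T: "T \<in> carrier_mat N N"
    by (simp add: T_def)
  have Tx: "T *\<^sub>v x = - K (K x)" if "x \<in> V" for x
    using that KK by (simp add: T_def K_K_eq_mult_vec[OF that] carrier_vecD[OF that] carrier_matD[OF Kmat_carrier])
  obtain es where es: "char_poly T = (\<Prod>a\<leftarrow>es. [:- a, 1:])"
    using K_K_splits unfolding T_def by blast
  obtain x0 where x0: "x0 \<in> ?X" "x0 \<noteq> 0\<^sub>v N"
    using frame_complement_nonzero[OF assms] .
  have XV: "?X \<subseteq> V"
    by (auto simp: frame_complement_def)
  have smult: "a \<cdot>\<^sub>v x \<in> ?X" if "x \<in> ?X" for a x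
    using that frameD(2,3)[OF fr] by (auto simp: frame_complement_def reflect_smult smult_smult_assoc mult.commute)
  have diff: "x - y \<in> ?X" if "x \<in> ?X" "y \<in> ?X" for x y
  proof -
    have "om u (x - y) = 0" if "u \<in> V" "om u x = 0" "om u y = 0" for u
      using om_antisym[of u "x - y"] om_antisym[of u x] om_antisym[of u y] that \<open>x \<in> ?X\<close> \<open>y \<in> ?X\<close>
      by (simp add: om_minus_left frame_complement_def)
    moreover have "reflect (x - y) = sg j \<cdot>\<^sub>v (x - y)"
      using that by (auto simp: frame_complement_def reflect_minus algebra_simps intro!: eq_vecI)
    ultimately show ?thesis
      using that frameD(2,3)[OF fr] by (auto simp: frame_complement_def)
  qed
  have step: "T *\<^sub>v x - a \<cdot>\<^sub>v x \<in> ?X" if "x \<in> ?X" for x a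
  proof -
    have "x \<in> V" using that XV by blast
    have "T *\<^sub>v x - a \<cdot>\<^sub>v x = (- 1) \<cdot>\<^sub>v K (K x) - a \<cdot>\<^sub>v x"
      unfolding Tx[OF \<open>x \<in> V\<close>] using \<open>x \<in> V\<close> by (intro eq_vecI) (simp_all add: carrier_vecD)
    thus ?thesis
      using that by (auto intro!: diff smult K_frame_complement[OF fr])
  qed
  obtain x a where xX: "x \<in> ?X" and x0: "x \<noteq> 0\<^sub>v N" and Txa: "T *\<^sub>v x = a \<cdot>\<^sub>v x"
    by (rule invariant_subspace_eigenvector[OF T es XV step x0])
  have xV: "x \<in> V"
    using xX XV by blast
  have KKx: "K (K x) = - a \<cdot>\<^sub>v x"
  proof -
    have "K (K x) = - (T *\<^sub>v x)"
      unfolding Tx[OF xV] by simp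
    also have "\<dots> = - a \<cdot>\<^sub>v x"
      unfolding Txa by (rule eq_vecI) auto
    finally show ?thesis .
  qed
  obtain r where r: "om (K x) x = - of_real r" "r > 0"
    using om_K_pos[OF xV x0] .
  obtain s where s: "om (K (K x)) (K x) = - of_real s" "s > 0"
    by (rule om_K_pos[OF K_closed[OF xV] K_eq_0[OF xV x0]])
  \<comment> \<open>Positivity at \<open>x\<close> and at \<open>K x\<close> shows that the
    eigenvalue is a positive real number.\<close>
  have "a * of_real r = of_real s"
    using s(1) r(1) om_antisym[of x "K x"] xV unfolding KKx by simp
  hence a: "a = of_real (s / r)"
    using r(2) by (simp add: field_simps)
  \<comment> \<open>\<open>d\<close> is the root of the eigenvalue, so that \<open>K f'\<close>
    returns to a multiple \<open>- d\<close> of \<open>e'\<close>. The scaling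
    \<open>\<alpha>\<close> is then forced by \<open>om e' f' = 1\<close>, because
    \<open>om x (K x) = r\<close>.\<close>
  define d where "d = sqrt (s / r)"
  define \<alpha> where "\<alpha> = sqrt (d / r)"
  have d: "d > 0" "d * d = s / r" and \<alpha>: "\<alpha> * \<alpha> * r = d"
    using r s by (auto simp: d_def \<alpha>_def)
  define e' where "e' = (of_real \<alpha> :: 'a) \<cdot>\<^sub>v x"
  define f' where "f' = (of_real (1 / d) :: 'a) \<cdot>\<^sub>v K e'"
  have e'X: "e' \<in> ?X" and f'X: "f' \<in> ?X"
    using xX by (auto simp: e'_def f'_def intro!: smult K_frame_complement[OF fr])
  have e'V: "e' \<in> V" and f'V: "f' \<in> V"
    using e'X f'X XV by auto
  have Ke': "K e' = of_real d \<cdot>\<^sub>v f'"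
    using d(1) by (simp add: f'_def smult_smult_assoc flip: of_real_mult)
  have "K (K e') = - of_real (d * d) \<cdot>\<^sub>v e'"
    using xV by (simp add: e'_def K_smult KKx a d smult_smult_assoc mult.commute)
  hence Kf': "K f' = - of_real d \<cdot>\<^sub>v e'"
    using d(1) e'V unfolding f'_def K_smult[OF K_closed[OF e'V]] conjugate_of_real
    by (simp add: smult_smult_assoc)
  have "om e' f' = of_real (\<alpha> * \<alpha> * r / d)"
    using xV r(1) om_antisym[of x "K x"] by (simp add: e'_def f'_def K_smult)
  hence e'f': "om e' f' = 1"
    using \<alpha> d(1) by simp
  have e': "reflect e' = sg j \<cdot>\<^sub>v e'" "\<And>i. i \<in> I \<Longrightarrow> om (e i) e' = 0" "\<And>i. i \<in> I \<Longrightarrow> om (f i) e' = 0"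
    and f': "reflect f' = sg j \<cdot>\<^sub>v f'" "\<And>i. i \<in> I \<Longrightarrow> om (e i) f' = 0" "\<And>i. i \<in> I \<Longrightarrow> om (f i) f' = 0"
    using e'X f'X by (auto simp: frame_complement_def)
  have swapped: "om e' (e i) = 0" "om e' (f i) = 0" "om f' (e i) = 0" "om f' (f i) = 0" if "i \<in> I" for i
    using e'(2,3)[OF that] f'(2,3)[OF that] frameD(2,3)[OF fr that]
    by (simp_all add: om_antisym[OF e'V] om_antisym[OF f'V])
  have "i \<noteq> j" if "i \<in> I" for i
    using that j by auto
  hence "frame (insert j I) (e(j := e')) (f(j := f')) (c(j := d))"
    using frameD[OF fr] frame_omD[OF fr] d(1) e'V f'V Ke' Kf' e'f' e' f' swapped j(2)
    unfolding frame_def ball_simps fun_upd_same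
    by (intro conjI ballI) (simp_all add: fun_upd_def om_self, auto)
  thus ?thesis by blast
qed

text \<open>The existing pairs must survive unchanged: in the construction below, the last extension
  has to respect the pairs transported from the q-part.\<close>

lemma frame_extend:
  assumes "frame I e f c" "I \<subseteq> I'" "I' \<subseteq> {..<n}"
  shows "\<exists>e' f' c'. frame I' e' f' c' \<and> (\<forall>i\<in>I. e' i = e i \<and> f' i = f i \<and> c' i = c i)"
proof -
  have "\<exists>e' f' c'. frame (I \<union> A) e' f' c' \<and> (\<forall>i\<in>I. e' i = e i \<and> f' i = f i \<and> c' i = c i)"
    if "finite A" "A \<subseteq> {..<n}" "A \<inter> I = {}" for A
    using that
  proof (induction A rule: finite_induct)
    case empty
    thus ?case using assms by auto
  next
    case (insert j A)
    then obtain e' f' c' where *: "frame (I \<union> A) e' f' c'" "\<forall>i\<in>I. e' i = e i \<and> f' i = f i \<and> c' i = c i"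
      by auto
    obtain x y d where "frame (insert j (I \<union> A)) (e'(j := x)) (f'(j := y)) (c'(j := d))"
      using frame_insert[OF *(1), of j] insert.hyps insert.prems subset_trans[OF assms(2,3)] by auto
    moreover have "\<forall>i\<in>I. (e'(j := x)) i = e i \<and> (f'(j := y)) i = f i \<and> (c'(j := d)) i = c i"
      using * insert by auto
    ultimately show ?case
      by (metis Un_insert_right)
  qed
  moreover have "finite (I' - I)" "I' - I \<subseteq> {..<n}" "(I' - I) \<inter> I = {}" "I \<union> (I' - I) = I'"
    using assms finite_subset[OF assms(3)] by auto
  ultimately show ?thesis
    by metis
qed

end

section \<open>Normal form of the Hermitian matrix\<close>

text \<open>The involution of the row indices of H, with q = n - p: it exchanges i and p + i for i <
  q and fixes the middle block. It locates the sinh entry of each row.\<close>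

definition swap_index :: "nat \<Rightarrow> nat \<Rightarrow> nat \<Rightarrow> nat" where
  "swap_index n p k = (if k < n - p then p + k else if k < p then k else k - p)"

lemma swap_index_less: "p \<le> n \<Longrightarrow> k < n \<Longrightarrow> swap_index n p k < n"
  by (auto simp: swap_index_def)

text \<open>The angle belonging to row \<open>k\<close> of H. The value 0 in the middle makes cosh 1
  and sinh 0, so the identity block follows the same formula as the others.\<close>

definition angle :: "nat \<Rightarrow> nat \<Rightarrow> (nat \<Rightarrow> real) \<Rightarrow> nat \<Rightarrow> real" where
  "angle n p \<theta> k = (if k < n - p then \<theta> k else if k < p then 0 else \<theta> (k - p))"

definition flip_index :: "nat \<Rightarrow> nat \<Rightarrow> nat \<Rightarrow> nat" where
  "flip_index n p i = (if i < n then swap_index n p i else swap_index n p (i - n) + n)"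

definition signed_angle :: "nat \<Rightarrow> nat \<Rightarrow> (nat \<Rightarrow> real) \<Rightarrow> nat \<Rightarrow> real" where
  "signed_angle n p \<theta> i = (if i < n then angle n p \<theta> i else - angle n p \<theta> (i - n))"

text \<open>Entrywise description of diag(H, H^(-1)); the sign in \<open>signed_angle\<close>
  produces the inverse in the second half. In middle rows both conditions hold at the same column,
  but the sinh term is zero there.\<close>

definition hyp_rot :: "nat \<Rightarrow> nat \<Rightarrow> (nat \<Rightarrow> real) \<Rightarrow> 'a :: real_field mat" where
  "hyp_rot n p \<theta> = mat (2 * n) (2 * n) (\<lambda>(i, j).
     (if j = i then of_real (cosh (signed_angle n p \<theta> i)) else 0) +
     (if j = flip_index n p i then of_real (sinh (signed_angle n p \<theta> i)) else 0))"

context symplectic_pair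
begin

lemma index_sub [simp]: "k < N \<Longrightarrow> \<not> k < n \<Longrightarrow> k - n < n"
  by (auto simp: N_eq)

section \<open>The action of B on a frame\<close>

lemma zero_smult_vec: "x \<in> V \<Longrightarrow> 0 \<cdot>\<^sub>v x = 0\<^sub>v N"
  by (rule eq_vecI) auto

lemma B_zero: "B (0\<^sub>v N) = 0\<^sub>v N"
  using B_smult[of "0\<^sub>v N" 0] by (simp add: zero_smult_vec)

lemma K_zero: "K (0\<^sub>v N) = 0\<^sub>v N"
  using K_smult[of "0\<^sub>v N" 0] by (simp add: zero_smult_vec)

lemma frame_B_B:
  assumes "frame I e f c" "i \<in> I"
  shows "B (B (e i)) = of_real ((c i)\<^sup>2 - 1) \<cdot>\<^sub>v e i" "B (B (f i)) = of_real ((c i)\<^sup>2 - 1) \<cdot>\<^sub>v f i"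
proof -
  note * = frameD[OF assms]
  have "K (K (e i)) = - of_real ((c i)\<^sup>2) \<cdot>\<^sub>v e i" "K (K (f i)) = - of_real ((c i)\<^sup>2) \<cdot>\<^sub>v f i"
    using * by (simp_all add: K_smult conjugate_neg smult_smult_assoc power2_eq_square)
  from this[THEN B_B_eigen[rotated]] *(2,3)
  show "B (B (e i)) = of_real ((c i)\<^sup>2 - 1) \<cdot>\<^sub>v e i" "B (B (f i)) = of_real ((c i)\<^sup>2 - 1) \<cdot>\<^sub>v f i"
    by simp_all
qed

text \<open>The symmetry of \<open>om\<close> with respect to \<open>B\<close> reduces everything to
  the square of \<open>B\<close>, but interchanges the arguments. This is why the transported pair
  is (B f, B e) in that order.\<close>

lemma frame_om_B_B:
  assumes "frame I e f c" "i \<in> I" "j \<in> I"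
  shows "om (B (f i)) (B (e j)) = (if i = j then of_real ((c j)\<^sup>2 - 1) else 0)"
    "om (B (e i)) (B (e j)) = 0" "om (B (f i)) (B (f j)) = 0"
proof -
  note i = frameD[OF assms(1,2)] and j = frameD[OF assms(1,3)]
  have "om (B x) (B y) = conjugate (om (B (B y)) x)" if "x \<in> V" "y \<in> V" for x y
    using om_B_conj[of "B y" x] that by simp
  thus "om (B (f i)) (B (e j)) = (if i = j then of_real ((c j)\<^sup>2 - 1) else 0)"
    "om (B (e i)) (B (e j)) = 0" "om (B (f i)) (B (f j)) = 0"
    using i(2,3) j(2,3) frame_omD[OF assms(1,3,2)] frame_B_B[OF assms(1,3)]
    by (auto simp: conjugate_dist_mul simp del: of_real_diff of_real_power)
qed

text \<open>If \<open>B (e i)\<close> is nonzero, positivity of the \<open>K\<close>-form at this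
  vector reads c (c^2 - 1) > 0. If it is zero, the square of \<open>B\<close> gives c^2 = 1. The
  second vector of the pair follows, since \<open>K\<close> maps \<open>B (e i)\<close> to a nonzero
  multiple of \<open>B (f i)\<close>.\<close>

lemma frame_B_eq_0:
  assumes "frame I e f c" "i \<in> I"
  shows "c i \<ge> 1" "B (e i) = 0\<^sub>v N \<longleftrightarrow> c i = 1" "c i = 1 \<Longrightarrow> B (f i) = 0\<^sub>v N"
proof -
  note * = frameD[OF assms]
  have KB: "K (B (e i)) = - of_real (c i) \<cdot>\<^sub>v B (f i)"
    using * by (auto simp: K_B B_smult intro!: eq_vecI)
  have zero: "c i = 1" if "B (e i) = 0\<^sub>v N"
  proof -
    have "of_real ((c i)\<^sup>2 - 1) \<cdot>\<^sub>v e i = 0\<^sub>v N"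
      using frame_B_B(1)[OF assms] by (simp add: that B_zero)
    hence "of_real ((c i)\<^sup>2 - 1) * om (e i) (f i) = 0"
      using om_smult_left[OF *(2,3), of "of_real ((c i)\<^sup>2 - 1)"] *(3) by (simp add: om_def)
    hence "(c i)\<^sup>2 = 1"
      using frame_omD(1)[OF assms assms(2)] by (simp del: of_real_diff)
    thus ?thesis
      using *(1) by (auto simp: power2_eq_1_iff)
  qed
  have nonzero: "c i > 1" if nz: "B (e i) \<noteq> 0\<^sub>v N"
  proof -
    have "om (K (B (e i))) (B (e i)) = - of_real (c i * ((c i)\<^sup>2 - 1))"
      unfolding KB using frame_om_B_B(1)[OF assms assms(2)] *
      by simp
    moreover obtain r where "om (K (B (e i))) (B (e i)) = - of_real r" "r > 0"
      by (rule om_K_pos[OF B_closed[OF *(2)] nz])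
    ultimately have "c i * ((c i)\<^sup>2 - 1) > 0"
      by (metis neg_equal_iff_equal of_real_eq_iff)
    hence "1 < (c i)\<^sup>2"
      using *(1) by (simp add: zero_less_mult_iff)
    thus ?thesis
      using power_less_imp_less_base[of 1 2 "c i"] *(1) by simp
  qed
  show "c i \<ge> 1" "B (e i) = 0\<^sub>v N \<longleftrightarrow> c i = 1"
    using zero nonzero by force+
  show "B (f i) = 0\<^sub>v N" if "c i = 1"
  proof -
    have "B (e i) = 0\<^sub>v N"
      using nonzero that by auto
    hence "- 1 \<cdot>\<^sub>v B (f i) = 0\<^sub>v N"
      using KB that by (simp add: K_zero)
    hence "- 1 \<cdot>\<^sub>v (- 1 \<cdot>\<^sub>v B (f i)) = 0\<^sub>v N"
      by auto
    thus ?thesis by (simp add: smult_smult_assoc)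
  qed
qed

lemma reflect_B: "x \<in> V \<Longrightarrow> reflect x = a \<cdot>\<^sub>v x \<Longrightarrow> conjugate a = a \<Longrightarrow> reflect (B x) = - a \<cdot>\<^sub>v B x"
proof -
  assume x: "x \<in> V" "reflect x = a \<cdot>\<^sub>v x" "conjugate a = a"
  have "- reflect (B x) = a \<cdot>\<^sub>v B x"
    using B_reflect[OF x(1)] x by (simp add: B_smult)
  hence "- (- reflect (B x)) = - (a \<cdot>\<^sub>v B x)"
    by simp
  thus ?thesis
    by (auto intro!: eq_vecI)
qed

definition frame_mat :: "(nat \<Rightarrow> 'a vec) \<Rightarrow> (nat \<Rightarrow> 'a vec) \<Rightarrow> 'a mat" where
  "frame_mat e f = mat N N (\<lambda>(i, k). (if k < n then e k else f (k - n)) $ i)"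

lemma frame_mat_carrier [simp]: "frame_mat e f \<in> carrier_mat N N"
  by (simp add: frame_mat_def)

lemma frame_mat_dim [simp]: "dim_row (frame_mat e f) = N" "dim_col (frame_mat e f) = N"
  by (simp_all add: frame_mat_def)

lemma col_frame_mat:
  assumes "frame {..<n} e f c" "k < N"
  shows "col (frame_mat e f) k = (if k < n then e k else f (k - n))"
  using assms frameD(2,3)[OF assms(1), THEN carrier_vecD] by (intro eq_vecI) (auto simp: frame_mat_def)

lemma transpose_mult_mult_index:
  assumes "A \<in> carrier_mat N N" "L \<in> carrier_mat N N" "L' \<in> carrier_mat N N" "k < N" "l < N"
  shows "(L'\<^sup>T * A * L) $$ (k, l) = col L' k \<bullet> (A *\<^sub>v col L l)"
proof -
  have "L'\<^sup>T * A * L = L'\<^sup>T * (A * L)"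
    using assms by (intro assoc_mult_mat[of _ N N _ N _ N]) auto
  moreover have "(L'\<^sup>T * (A * L)) $$ (k, l) = row L'\<^sup>T k \<bullet> col (A * L) l"
    using assms by (intro index_mult_mat(1)) auto
  moreover have "row L'\<^sup>T k = col L' k"
    using assms by (intro row_transpose) auto
  ultimately show ?thesis
    using col_mult2[OF assms(1,2,5)] by (simp only:)
qed

lemma frame_mat_symplectic:
  assumes "frame {..<n} e f c"
  shows "(frame_mat e f)\<^sup>T * J * frame_mat e f = J"
proof (rule eq_matI)
  fix k l assume "k < dim_row J" "l < dim_col J"
  hence kl: "k < N" "l < N"
    by (auto simp: N_eq)
  have "((frame_mat e f)\<^sup>T * J * frame_mat e f) $$ (k, l) =
      om (if k < n then e k else f (k - n)) (if l < n then e l else f (l - n))"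
    unfolding transpose_mult_mult_index[OF J_carrier frame_mat_carrier frame_mat_carrier kl] om_def
    using kl by (simp add: col_frame_mat[OF assms])
  also have "\<dots> = J $$ (k, l)"
    using kl frame_omD[OF assms] frameD(2,3)[OF assms] om_antisym[of "f (k - n)" "e l"]
    by (auto simp: N_eq symplectic_form_index)
  finally show "((frame_mat e f)\<^sup>T * J * frame_mat e f) $$ (k, l) = J $$ (k, l)" .
qed (auto simp: N_eq[symmetric])

text \<open>A full frame is a symplectic matrix L with inverse - J L^T J, so the orthogonality
  conditions L^T J x = 0 leave only the zero vector.\<close>

lemma frame_spans:
  assumes fr: "frame {..<n} e f c" and x: "x \<in> V" and "\<And>k. k < n \<Longrightarrow> om (e k) x = 0 \<and> om (f k) x = 0"
  shows "x = 0\<^sub>v N"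
proof -
  let ?L = "frame_mat e f"
  have c: "- (J * ?L\<^sup>T * J) \<in> carrier_mat N N"
    by (auto intro!: mult_carrier_mat[of _ N N])
  have "J * ?L\<^sup>T * J * ?L = J * (?L\<^sup>T * J * ?L)"
    by (simp add: assoc_mult_mat[of _ N N _ N _ N] mult_carrier_mat[of _ N N])
  hence "- (J * ?L\<^sup>T * J) * ?L = 1\<^sub>m N"
    using symplectic_form_square[of n, where ?'a = 'a, folded N_eq] by (simp add: frame_mat_symplectic[OF fr] N_eq[symmetric])
  from mat_mult_left_right_inverse[OF c frame_mat_carrier this]
  have inv: "?L * - (J * ?L\<^sup>T * J) = 1\<^sub>m N" .
  have "?L\<^sup>T *\<^sub>v (J *\<^sub>v x) = 0\<^sub>v N"
    using assms(3) x by (intro eq_vecI) (auto simp: col_frame_mat[OF fr] om_def)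
  hence "(J * ?L\<^sup>T * J) *\<^sub>v x = 0\<^sub>v N"
    using x by (simp add: assoc_mult_mat_vec[of _ N N _ N] mult_carrier_mat[of _ N N])
       (auto intro!: eq_vecI simp: N_eq)
  hence "- (J * ?L\<^sup>T * J) *\<^sub>v x = 0\<^sub>v N"
    using x c by (simp add: carrier_vecD N_eq[symmetric])
  moreover have "x = ?L *\<^sub>v (- (J * ?L\<^sup>T * J) *\<^sub>v x)"
    unfolding assoc_mult_mat_vec[OF frame_mat_carrier c x, symmetric] inv using x by simp
  ultimately have "x = ?L *\<^sub>v 0\<^sub>v N"
    by simp
  thus ?thesis
    by (auto intro!: eq_vecI)
qed


lemma om_eq_0_opposite:
  assumes "x \<in> V" "y \<in> V" "reflect x = a \<cdot>\<^sub>v x" "reflect y = - a \<cdot>\<^sub>v y" "a * a = 1"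
  shows "om x y = 0"
proof -
  have "om x y = - (a * a) * om x y"
    using om_reflect[OF assms(1,2), symmetric] unfolding assms(3,4) using assms(1,2) by (simp add: mult.assoc)
  thus ?thesis
    by (simp add: assms(5))
qed

text \<open>Here \<open>c\<close> and \<open>s\<close> become the cosh and sinh of the doubled
  angles. The assumption provides, for each q-part index p + i, a slot i in the p-part.\<close>

lemma exists_adapted_frame:
  assumes "n - p \<le> p"
  shows "\<exists>e f c s. frame {..<n} e f c \<and>
    (\<forall>i<n. (c i)\<^sup>2 = (s i)\<^sup>2 + 1 \<and> s (swap_index n p i) = s i \<and>
      B (e i) = of_real (s i) \<cdot>\<^sub>v f (swap_index n p i) \<and>
      B (f i) = of_real (s i) \<cdot>\<^sub>v e (swap_index n p i)) \<and>
    (\<forall>i. n - p \<le> i \<longrightarrow> i < p \<longrightarrow> s i = 0)"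
proof -
  define q where "q = n - p"
  have q: "q \<le> p" "n = p + q"
    using assms p_le by (auto simp: q_def)
  have fr_empty: "frame {} (\<lambda>_. 0\<^sub>v N) (\<lambda>_. 0\<^sub>v N) (\<lambda>_. 1)"
    by (simp add: frame_def)
  obtain e0 f0 c0 where fr0: "frame {p..<n} e0 f0 c0"
    using frame_extend[OF fr_empty empty_subsetI, of "{p..<n}"] atLeastLessThan_subset_iff by fastforce
  define s0 where "s0 i = sqrt ((c0 (p + i))\<^sup>2 - 1)" for i
  \<comment> \<open>Slots whose partner has c = 1 are left open: there \<open>B\<close> vanishes and
    nothing can be transported.\<close>
  define I where "I = {p..<n} \<union> {i. i < q \<and> c0 (p + i) \<noteq> 1}"
  define e1 where "e1 i = (if i < p then of_real (1 / s0 i) \<cdot>\<^sub>v B (f0 (p + i)) else e0 i)" for i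
  define f1 where "f1 i = (if i < p then of_real (1 / s0 i) \<cdot>\<^sub>v B (e0 (p + i)) else f0 i)" for i
  define c1 where "c1 i = (if i < p then c0 (p + i) else c0 i)" for i
  have pi: "p + i \<in> {p..<n}" if "i < q" for i
    using that q by auto
  have sgp: "sg i = 1" if "i < p" for i
    using that by (simp add: sg_def)
  have sgq: "sg i = - 1" if "p \<le> i" "i < n" for i
    using that by (simp add: sg_def)
  have s0_sq: "(s0 i)\<^sup>2 = (c0 (p + i))\<^sup>2 - 1" if "i < q" for i
  proof -
    have "1 \<le> c0 (p + i)"
      by (rule frame_B_eq_0(1)[OF fr0 pi[OF that]])
    hence "1 \<le> (c0 (p + i))\<^sup>2"
      by simp
    thus ?thesis
      by (simp add: s0_def)
  qed
  have s0_nz: "s0 i \<noteq> 0" if "i < q" "c0 (p + i) \<noteq> 1" for i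
    using s0_sq[OF that(1)] that(2) frameD(1)[OF fr0 pi[OF that(1)]] by (auto simp: power2_eq_1_iff)
  have fr1: "frame I e1 f1 c1"
  proof -
    have new: "0 < c1 i \<and> e1 i \<in> V \<and> f1 i \<in> V \<and>
        K (e1 i) = of_real (c1 i) \<cdot>\<^sub>v f1 i \<and> K (f1 i) = - of_real (c1 i) \<cdot>\<^sub>v e1 i \<and>
        reflect (e1 i) = sg i \<cdot>\<^sub>v e1 i \<and> reflect (f1 i) = sg i \<cdot>\<^sub>v f1 i" if i: "i < q" "c0 (p + i) \<noteq> 1" for i
    proof -
      have ip: "i < p" using i q by simp
      note d = frameD[OF fr0 pi[OF i(1)]]
      have sgpi: "sg (p + i) = - 1"
        using i q by (intro sgq) auto
      have "reflect (B (e0 (p + i))) = B (e0 (p + i))" "reflect (B (f0 (p + i))) = B (f0 (p + i))"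
        using reflect_B[OF d(2) d(6) conj_sg] reflect_B[OF d(3) d(7) conj_sg] by (simp_all add: sgpi)
      moreover have "K (B (f0 (p + i))) = of_real (c0 (p + i)) \<cdot>\<^sub>v B (e0 (p + i))"
        "K (B (e0 (p + i))) = - of_real (c0 (p + i)) \<cdot>\<^sub>v B (f0 (p + i))"
        using d by (auto intro!: eq_vecI simp: K_B B_smult conjugate_neg)
      ultimately show ?thesis
        using ip d(1-3) unfolding e1_def f1_def c1_def
        by (simp only: if_True sgp reflect_smult K_smult B_closed conjugate_of_real smult_smult_assoc)
          (auto simp: smult_smult_assoc mult.commute)
    qed
    have old: "e1 i = e0 i" "f1 i = f0 i" "c1 i = c0 i" if "i \<in> {p..<n}" for i
      using that by (auto simp: e1_def f1_def c1_def)
    have props: "0 < c1 i \<and> e1 i \<in> V \<and> f1 i \<in> V \<and>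
        K (e1 i) = of_real (c1 i) \<cdot>\<^sub>v f1 i \<and> K (f1 i) = - of_real (c1 i) \<cdot>\<^sub>v e1 i \<and>
        reflect (e1 i) = sg i \<cdot>\<^sub>v e1 i \<and> reflect (f1 i) = sg i \<cdot>\<^sub>v f1 i" if "i \<in> I" for i
    proof (cases "i \<in> {p..<n}")
      case True
      thus ?thesis
        using frameD[OF fr0 True] by (simp add: old)
    next
      case False
      with that show ?thesis
        using new by (auto simp: I_def)
    qed
    have "om (e1 i) (f1 j) = (if i = j then 1 else 0) \<and> om (e1 i) (e1 j) = 0 \<and> om (f1 i) (f1 j) = 0"
      if ij: "i \<in> I" "j \<in> I" for i j
    proof -
      have "i < n" "j < n"
        using ij q by (auto simp: I_def)
      then consider "i \<in> {p..<n}" "j \<in> {p..<n}" | "i < p" "j < p" | "sg i \<noteq> sg j"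
        using sgp[of i] sgp[of j] sgq[of i] sgq[of j] by (cases "i < p"; cases "j < p") auto
      thus ?thesis
      proof cases
        case 1
        thus ?thesis
          using frame_omD[OF fr0] by (simp add: old)
      next
        case 2
        hence i: "i < q" "c0 (p + i) \<noteq> 1" and j: "j < q" "c0 (p + j) \<noteq> 1"
          using ij by (auto simp: I_def)
        note di = frameD(2,3)[OF fr0 pi[OF i(1)]] and dj = frameD(2,3)[OF fr0 pi[OF j(1)]]
        have "of_real (1 / s0 j) * (of_real (1 / s0 j) * (of_real ((c0 (p + j))\<^sup>2 - 1) :: 'a)) = 1"
          using s0_sq[OF j(1), symmetric] s0_nz[OF j]
          by (simp only: flip: of_real_mult) (simp add: power2_eq_square)
        thus ?thesis
          using 2 frame_om_B_B[OF fr0 pi[OF i(1)] pi[OF j(1)]] di dj by (auto simp: e1_def f1_def)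
      next
        case 3
        have "i \<noteq> j"
          using 3 by auto
        thus ?thesis
          using om_opposite_sign[OF _ _ _ _ 3] props[OF ij(1)] props[OF ij(2)] by simp
      qed
    qed
    with props show ?thesis
      by (simp add: frame_def)
  qed
  have I_sub: "I \<subseteq> {..<n}"
    using q by (auto simp: I_def)
  obtain e f c where fr: "frame {..<n} e f c" and "\<forall>i\<in>I. e i = e1 i \<and> f i = f1 i \<and> c i = c1 i"
    using frame_extend[OF fr1 I_sub order_refl] by blast
  hence eq: "e i = e1 i" "f i = f1 i" "c i = c1 i" if "i \<in> I" for i
    using that by auto
  have eqq: "e (p + i) = e0 (p + i)" "f (p + i) = f0 (p + i)" "c (p + i) = c0 (p + i)" if "i < q" for i
    using eq[of "p + i"] that q by (auto simp: I_def e1_def f1_def c1_def)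
  have Bq: "B (e (p + i)) = of_real (s0 i) \<cdot>\<^sub>v f i \<and> B (f (p + i)) = of_real (s0 i) \<cdot>\<^sub>v e i" if i: "i < q" for i
  proof (cases "c0 (p + i) = 1")
    case True
    have "i < n" using i q by simp
    moreover have "s0 i = 0"
      using True by (simp add: s0_def)
    moreover have "B (e (p + i)) = 0\<^sub>v N" "B (f (p + i)) = 0\<^sub>v N"
      using frame_B_eq_0(2,3)[OF fr0 pi[OF i]] True by (simp_all add: eqq i)
    ultimately show ?thesis
      using frameD(2,3)[OF fr, of i] by (simp add: zero_smult_vec)
  next
    case False
    hence "i \<in> I" "i < p"
      using i q by (auto simp: I_def)
    thus ?thesis
      using s0_nz[OF i False] by (simp add: eq eqq i e1_def f1_def smult_smult_assoc)
  qed
  \<comment> \<open>\<open>B (e i)\<close> is shown orthogonal to the whole frame by moving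
    \<open>B\<close> to the frame vector. For a p-part vector the image lies in the opposite part;
    for a q-part vector it is a multiple of a pair in a slot \<open>j\<close>, and either
    \<open>j\<close> differs from \<open>i\<close> or the factor \<open>s0 j\<close> is
    zero.\<close>
  have rest: "B (e i) = 0\<^sub>v N" if i: "i < p" "i \<notin> I" for i
  proof (rule frame_spans[OF fr])
    have "i < n" using i q by simp
    note d = frameD[OF fr, of i, simplified, OF this]
    show "B (e i) \<in> V"
      using d by simp
    fix k assume k: "k < n"
    note dk = frameD[OF fr, of k, simplified, OF k]
    have *: "om y (B (e i)) = - conjugate (om (B y) (e i))" if "y \<in> V" for y
      using that om_antisym[of y "B (e i)"] om_B_conj[of y "e i"] d(2) by simp
    have "om (B (e k)) (e i) = 0 \<and> om (B (f k)) (e i) = 0"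
    proof (cases "k < p")
      case True
      have "reflect (B (e k)) = - 1 \<cdot>\<^sub>v B (e k)" "reflect (B (f k)) = - 1 \<cdot>\<^sub>v B (f k)"
        using reflect_B[OF dk(2) dk(6) conj_sg] reflect_B[OF dk(3) dk(7) conj_sg] sgp[OF True] by simp_all
      moreover have "reflect (e i) = - (- 1) \<cdot>\<^sub>v e i"
        using d(6) sgp[OF i(1)] by simp
      ultimately show ?thesis
        using om_eq_0_opposite[of _ "e i" "- 1"] dk(2,3) d(2) by simp
    next
      case False
      then obtain j where j: "k = p + j" "j < q"
        using k q by (metis add_less_cancel_left le_add_diff_inverse not_less)
      have "s0 j = 0 \<or> j \<noteq> i"
        using i j by (auto simp: I_def s0_def)
      moreover have "j < n"
        using j q by simp
      ultimately show ?thesis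
        using Bq[OF j(2)] frame_omD[OF fr, of i j] frame_omD[OF fr, of j i] om_antisym[of "f j" "e i"]
          frameD(2,3)[OF fr, of j] d(2) \<open>i < n\<close> j(1) by auto
    qed
    thus "om (e k) (B (e i)) = 0 \<and> om (f k) (B (e i)) = 0"
      using * dk(2,3) by simp
  qed
  define s where "s i = (if i < q then s0 i else if i < p then 0 else s0 (i - p))" for i
  \<comment> \<open>The way back from the p-part: \<open>e i\<close> is B (f (p + i)) / s, so
    applying \<open>B\<close> once more gives (c^2 - 1) / s = s times the original vector.\<close>
  have Bp: "B (e i) = of_real (s0 i) \<cdot>\<^sub>v f (p + i) \<and> B (f i) = of_real (s0 i) \<cdot>\<^sub>v e (p + i) \<and>
      c i = c0 (p + i)" if i: "i < q" for i
  proof (cases "c0 (p + i) = 1")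
    case True
    have "i \<notin> I" "i < p" "i < n" "p + i < n"
      using True i q by (auto simp: I_def)
    moreover from this have "c i = 1" "B (f i) = 0\<^sub>v N"
      using rest frame_B_eq_0[OF fr, of i] by auto
    moreover have "s0 i = 0"
      using True by (simp add: s0_def)
    ultimately show ?thesis
      using rest frameD(2,3)[OF fr, of "p + i"] True by (simp add: zero_smult_vec)
  next
    case False
    hence I: "i \<in> I" "i < p"
      using i q by (auto simp: I_def)
    note d = frameD(2,3)[OF fr0 pi[OF i]]
    have "1 / s0 i * ((c0 (p + i))\<^sup>2 - 1) = s0 i"
      using s0_sq[OF i, symmetric] s0_nz[OF i False] by (simp add: power2_eq_square)
    hence "of_real (1 / s0 i) * of_real ((c0 (p + i))\<^sup>2 - 1) = (of_real (s0 i) :: 'a)"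
      by (simp only: flip: of_real_mult)
    thus ?thesis
      using I d frame_B_B[OF fr0 pi[OF i]]
      by (simp add: eq eqq i e1_def f1_def c1_def B_smult conjugate_of_real smult_smult_assoc
          del: of_real_divide of_real_diff of_real_power)
  qed
  have mid: "c i = 1 \<and> B (e i) = 0\<^sub>v N \<and> B (f i) = 0\<^sub>v N" if "q \<le> i" "i < p" for i
    using that rest[of i] frame_B_eq_0[OF fr, of i] q by (auto simp: I_def)
  have cases: "i < q \<or> (q \<le> i \<and> i < p) \<or> (\<exists>j<q. i = p + j)" if "i < n" for i
    using that q by (metis add_less_cancel_left le_add_diff_inverse not_less)
  have "(c i)\<^sup>2 = (s i)\<^sup>2 + 1 \<and> s (swap_index n p i) = s i \<and>
      B (e i) = of_real (s i) \<cdot>\<^sub>v f (swap_index n p i) \<and>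
      B (f i) = of_real (s i) \<cdot>\<^sub>v e (swap_index n p i)" if i: "i < n" for i
  proof (intro conjI)
    note frV = frameD(2,3)[OF fr, of i, simplified, OF i]
    show "(c i)\<^sup>2 = (s i)\<^sup>2 + 1"
      using cases[OF i] Bp mid s0_sq q eqq by (auto simp: s_def)
    show "s (swap_index n p i) = s i"
      using cases[OF i] q by (auto simp: s_def swap_index_def)
    show "B (e i) = of_real (s i) \<cdot>\<^sub>v f (swap_index n p i)"
      using cases[OF i] Bp Bq mid q frV by (auto simp: s_def swap_index_def zero_smult_vec)
    show "B (f i) = of_real (s i) \<cdot>\<^sub>v e (swap_index n p i)"
      using cases[OF i] Bp Bq mid q frV by (auto simp: s_def swap_index_def zero_smult_vec)
  qed
  moreover have "\<forall>i. n - p \<le> i \<longrightarrow> i < p \<longrightarrow> s i = 0"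
    by (simp add: s_def q_def)
  ultimately show ?thesis
    using fr by blast
qed

lemma hyp_rot_index:
  "i < N \<Longrightarrow> j < N \<Longrightarrow> hyp_rot n p \<theta> $$ (i, j) =
     (if i < n then (if j = i then of_real (cosh (angle n p \<theta> i)) else 0) +
       (if j = swap_index n p i then of_real (sinh (angle n p \<theta> i)) else 0)
     else (if j = i then of_real (cosh (angle n p \<theta> (i - n))) else 0) -
       (if j = swap_index n p (i - n) + n then of_real (sinh (angle n p \<theta> (i - n))) else 0))"
  by (simp add: hyp_rot_def N_eq flip_index_def signed_angle_def)

lemma exists_normal_form:
  assumes "n - p \<le> p"
  obtains L \<theta> where "L \<in> carrier_mat N N" "L\<^sup>T * J * L = J"
    "mat_diag N sg * L = L * mat_diag N sg"
    "conj_mat L\<^sup>T * M * L = hyp_rot n p (\<lambda>i. 2 * \<theta> i)"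
proof -
  obtain e f c s where fr: "frame {..<n} e f c"
    and all: "\<forall>i<n. (c i)\<^sup>2 = (s i)\<^sup>2 + 1 \<and> s (swap_index n p i) = s i \<and>
      B (e i) = of_real (s i) \<cdot>\<^sub>v f (swap_index n p i) \<and>
      B (f i) = of_real (s i) \<cdot>\<^sub>v e (swap_index n p i)"
    and s_mid: "\<forall>i. n - p \<le> i \<longrightarrow> i < p \<longrightarrow> s i = 0"
    using exists_adapted_frame[OF assms] by blast
  have cs: "(c i)\<^sup>2 = (s i)\<^sup>2 + 1"
    and s_swap: "s (swap_index n p i) = s i"
    and Be: "B (e i) = of_real (s i) \<cdot>\<^sub>v f (swap_index n p i)"
    and Bf: "B (f i) = of_real (s i) \<cdot>\<^sub>v e (swap_index n p i)" if "i < n" for i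
    using all that by auto
  let ?L = "frame_mat e f"
  \<comment> \<open>Halved because the Gram matrix carries the square of the hyperbolic factor,
    hence the doubled angles.\<close>
  define \<theta> where "\<theta> i = arsinh (s i) / 2" for i
  have ang: "angle n p (\<lambda>i. 2 * \<theta> i) i = arsinh (s i)" if "i < n" for i
    using s_swap[OF that] s_mid[rule_format, of i] by (auto simp: angle_def swap_index_def \<theta>_def)
  have sinh: "sinh (angle n p (\<lambda>i. 2 * \<theta> i) i) = s i" if "i < n" for i
    using that by (simp add: ang)
  have cosh: "cosh (angle n p (\<lambda>i. 2 * \<theta> i) i) = c i" if "i < n" for i
    using that frameD(1)[OF fr, of i] by (simp add: ang cosh_arsinh_real cs[symmetric])
  have V: "e i \<in> V" "f i \<in> V" if "i < n" for i
    using frameD(2,3)[OF fr, of i] that by auto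
  have "?L\<^sup>T * J * ?L = J"
    by (rule frame_mat_symplectic[OF fr])
  moreover have "mat_diag N sg * ?L = ?L * mat_diag N sg"
  proof (rule eq_matI)
    fix r k assume "r < dim_row (?L * mat_diag N sg)" "k < dim_col (?L * mat_diag N sg)"
    hence rk: "r < N" "k < N"
      by (auto simp: mat_diag_def)
    have "sg r * ?L $$ (r, k) = sg k * ?L $$ (r, k)"
    proof (cases "k < n")
      case True
      thus ?thesis
        using arg_cong[OF frameD(6)[OF fr, of k], of "\<lambda>v. v $ r"] V[OF True] rk
        by (simp add: reflect_eq frame_mat_def)
    next
      case False
      hence kn: "k - n < n" using rk by simp
      have "sg k = sg (k - n)"
        using sg_shift[OF kn] False by simp
      thus ?thesis
        using arg_cong[OF frameD(7)[OF fr, of "k - n"], of "\<lambda>v. v $ r"] V[OF kn] rk False kn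
        by (simp add: reflect_eq frame_mat_def)
    qed
    thus "(mat_diag N sg * ?L) $$ (r, k) = (?L * mat_diag N sg) $$ (r, k)"
      using rk by (simp add: mat_diag_mult_left[OF frame_mat_carrier] mat_diag_mult_right[OF frame_mat_carrier])
  qed (auto simp: mat_diag_def)
  moreover have "conj_mat ?L\<^sup>T * M * ?L = hyp_rot n p (\<lambda>i. 2 * \<theta> i)"
  proof (rule eq_matI)
    fix k l assume "k < dim_row (hyp_rot n p (\<lambda>i. 2 * \<theta> i) :: 'a mat)" "l < dim_col (hyp_rot n p (\<lambda>i. 2 * \<theta> i) :: 'a mat)"
    hence kl: "k < N" "l < N"
      by (auto simp: hyp_rot_def N_eq)
    define v where "v k = (if k < n then e k else f (k - n))" for k
    have vV: "v k \<in> V" if "k < N" for k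
      using that V by (simp add: v_def)
    have "(conj_mat ?L\<^sup>T * M * ?L) $$ (k, l) = conjugate (v k) \<bullet> (M *\<^sub>v v l)"
    proof -
      have "col (conj_mat ?L) k = conjugate (v k)"
        using kl carrier_vecD[OF vV[OF kl(1)]] by (intro eq_vecI) (simp_all add: v_def frame_mat_def)
      moreover have "col ?L l = v l"
        using col_frame_mat[OF fr kl(2)] by (simp add: v_def)
      ultimately show ?thesis
        using transpose_mult_mult_index[OF M_carrier frame_mat_carrier _ kl, of "conj_mat ?L"]
        by (simp add: transpose_conj_mat)
    qed
    also have "\<dots> = - om (tau (v k)) (v l)"
      using vV kl by (simp add: om_tau)
    also have "tau (v k) = K (v k) + B (v k)"
      using vV[OF kl(1)] by (intro eq_vecI) (auto simp: K_eq B_def field_simps)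
    \<comment> \<open>The \<open>K\<close> term contributes the diagonal cosh, the \<open>B\<close>
      term the sinh at the swapped index. Since om (f, e) = -1 but om (e, f) = 1, the sinh term
      changes sign on the \<open>f\<close> half; this is the origin of H^(-1) in the second
      block.\<close>
    also have "- om (K (v k) + B (v k)) (v l) = - om (K (v k)) (v l) - om (B (v k)) (v l)"
      using vV kl by (simp add: om_add_left)
    also have "\<dots> = hyp_rot n p (\<lambda>i. 2 * \<theta> i) $$ (k, l)"
    proof (cases "k < n")
      case True
      note d = frameD[OF fr, of k, simplified, OF True]
      show ?thesis
      proof (cases "l < n")
        case l: True
        have "om (f i) (e l) = - (if l = i then 1 else 0)" if "i < n" for i
          using om_antisym[of "f i" "e l"] V that l frame_omD(1)[OF fr, of l i] by simp
        thus ?thesis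
          using True l V d kl swap_index_less[OF p_le True]
          by (auto simp: v_def Be hyp_rot_index sinh cosh)
      next
        case False
        thus ?thesis
          using True V d kl swap_index_less[OF p_le True] frame_omD[OF fr]
          by (auto simp: v_def Be hyp_rot_index)
      qed
    next
      case False
      hence kn: "k - n < n" using kl by simp
      note d = frameD[OF fr, of "k - n", simplified, OF kn]
      show ?thesis
      proof (cases "l < n")
        case True
        thus ?thesis
          using False V d kl kn swap_index_less[OF p_le kn] frame_omD[OF fr]
          by (auto simp: v_def Bf hyp_rot_index)
      next
        case l: False
        hence ln: "l - n < n" using kl by simp
        define k' where "k' = k - n"
        define l' where "l' = l - n"
        have k': "k = k' + n" "k' < n" and l': "l = l' + n" "l' < n"
          using False l kn ln by (auto simp: k'_def l'_def)
        have "om (e i) (f l') = (if l' = i then 1 else 0)" if "i < n" for i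
          using frame_omD(1)[OF fr, of i l'] that l' by auto
        moreover have "v k = f k'" "v l = f l'"
          by (simp_all add: v_def k' l')
        ultimately show ?thesis
          using V[OF k'(2)] V[OF l'(2)] V[OF swap_index_less[OF p_le k'(2)]] frameD(5)[OF fr, of k']
            swap_index_less[OF p_le k'(2)] kl k'(2)
          unfolding hyp_rot_index[OF kl] by (simp add: Bf k'(1) l'(1) sinh cosh)
      qed
    qed
    finally show "(conj_mat ?L\<^sup>T * M * ?L) $$ (k, l) = hyp_rot n p (\<lambda>i. 2 * \<theta> i) $$ (k, l)" .
  qed (auto simp: hyp_rot_def N_eq[symmetric])
  ultimately show thesis
    using that[OF frame_mat_carrier] by blast
qed

end

section \<open>Hyperbolic rotations\<close>

lemma hyp_rot_carrier [simp]: "hyp_rot n p \<theta> \<in> carrier_mat (2 * n) (2 * n)"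
  "dim_row (hyp_rot n p \<theta>) = 2 * n" "dim_col (hyp_rot n p \<theta>) = 2 * n"
  by (auto simp: hyp_rot_def)

lemma signed_angle_add:
  "signed_angle n p (\<lambda>i. \<theta> i + \<phi> i) i = signed_angle n p \<theta> i + signed_angle n p \<phi> i"
  unfolding signed_angle_def angle_def by (cases "i < n") (simp_all split: if_split)

lemma signed_angle_uminus: "signed_angle n p (\<lambda>i. - \<theta> i) i = - signed_angle n p \<theta> i"
  unfolding signed_angle_def angle_def by (cases "i < n") simp_all

lemma hyp_rot_zero: "hyp_rot n p (\<lambda>_. 0) = 1\<^sub>m (2 * n)"
  by (rule eq_matI) (auto simp: hyp_rot_def signed_angle_def angle_def)

context
  fixes n p :: nat
  assumes np: "p \<le> n" "n - p \<le> p"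
begin

lemma swap_swap_index: "k < n \<Longrightarrow> swap_index n p (swap_index n p k) = k"
  using np by (auto simp: swap_index_def)

lemma angle_swap_index: "k < n \<Longrightarrow> angle n p \<theta> (swap_index n p k) = angle n p \<theta> k"
  using np by (auto simp: swap_index_def angle_def)

lemma flip_index_less: "i < 2 * n \<Longrightarrow> flip_index n p i < 2 * n"
  using swap_index_less[OF np(1), of i] swap_index_less[OF np(1), of "i - n"] by (auto simp: flip_index_def)

lemma flip_flip_index [simp]: "i < 2 * n \<Longrightarrow> flip_index n p (flip_index n p i) = i"
  using swap_index_less[OF np(1), of i] swap_index_less[OF np(1), of "i - n"] swap_swap_index[of i] swap_swap_index[of "i - n"]
  by (auto simp: flip_index_def)

lemma signed_angle_flip [simp]: "i < 2 * n \<Longrightarrow> signed_angle n p \<theta> (flip_index n p i) = signed_angle n p \<theta> i"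
  using swap_index_less[OF np(1), of i] swap_index_less[OF np(1), of "i - n"] angle_swap_index[of i] angle_swap_index[of "i - n"]
  by (auto simp: flip_index_def signed_angle_def)

lemma hyp_rot_mult_index:
  assumes X: "X \<in> carrier_mat (2 * n) m" and ij: "i < 2 * n" "j < m"
  shows "(hyp_rot n p \<theta> * X) $$ (i, j) =
    of_real (cosh (signed_angle n p \<theta> i)) * X $$ (i, j) +
    of_real (sinh (signed_angle n p \<theta> i)) * X $$ (flip_index n p i, j)"
proof -
  let ?F = "flip_index n p i" and ?a = "signed_angle n p \<theta> i"
  have F: "?F < 2 * n"
    using ij by (intro flip_index_less)
  have "(hyp_rot n p \<theta> * X) $$ (i, j) =
      (\<Sum>k<2*n. ((if k = i then of_real (cosh ?a) else 0) + (if k = ?F then of_real (sinh ?a) else 0)) * X $$ (k, j))"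
    using X ij by (simp add: scalar_prod_def hyp_rot_def atLeast0LessThan)
  also have "\<dots> = (\<Sum>k<2*n. if k = i then of_real (cosh ?a) * X $$ (i, j) else 0) +
      (\<Sum>k<2*n. if k = ?F then of_real (sinh ?a) * X $$ (?F, j) else 0)"
    unfolding sum.distrib[symmetric] by (intro sum.cong) (auto simp: algebra_simps)
  finally show ?thesis
    using ij F by simp
qed

text \<open>\<open>flip_index\<close> is an involution preserving \<open>signed_angle\<close>, so
  each pair of flipped coordinates carries a planar hyperbolic rotation, and the addition formulas
  apply.\<close>

lemma hyp_rot_mult:
  "hyp_rot n p \<theta> * hyp_rot n p \<phi> = (hyp_rot n p (\<lambda>i. \<theta> i + \<phi> i) :: 'a :: real_field mat)"
proof (rule eq_matI)
  fix i j assume "i < dim_row (hyp_rot n p (\<lambda>i. \<theta> i + \<phi> i) :: 'a mat)" "j < dim_col (hyp_rot n p (\<lambda>i. \<theta> i + \<phi> i) :: 'a mat)"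
  hence ij: "i < 2 * n" "j < 2 * n"
    by auto
  show "(hyp_rot n p \<theta> * hyp_rot n p \<phi>) $$ (i, j) = (hyp_rot n p (\<lambda>i. \<theta> i + \<phi> i) :: 'a mat) $$ (i, j)"
    unfolding hyp_rot_mult_index[OF hyp_rot_carrier(1) ij]
    using ij flip_index_less[OF ij(1)]
    by (simp add: hyp_rot_def signed_angle_add cosh_add sinh_add algebra_simps)
qed auto

lemma hyp_rot_inverse: "hyp_rot n p \<theta> * hyp_rot n p (\<lambda>i. - \<theta> i) = 1\<^sub>m (2 * n)"
  "hyp_rot n p (\<lambda>i. - \<theta> i) * hyp_rot n p \<theta> = 1\<^sub>m (2 * n)"
  by (simp_all add: hyp_rot_mult hyp_rot_zero)

lemma transpose_hyp_rot: "(hyp_rot n p \<theta>)\<^sup>T = (hyp_rot n p \<theta> :: 'a :: real_field mat)"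
proof (rule eq_matI)
  fix i j assume "i < dim_row (hyp_rot n p \<theta> :: 'a mat)" "j < dim_col (hyp_rot n p \<theta> :: 'a mat)"
  hence ij: "i < 2 * n" "j < 2 * n"
    by auto
  have "i = flip_index n p j \<longleftrightarrow> j = flip_index n p i"
    using ij flip_flip_index by metis
  thus "(hyp_rot n p \<theta>)\<^sup>T $$ (i, j) = (hyp_rot n p \<theta> :: 'a mat) $$ (i, j)"
    using ij by (auto simp: hyp_rot_def)
qed auto

text \<open>J exchanges the two halves, on which the flips agree and the angles are
  opposite.\<close>

lemma hyp_rot_mult_symplectic_form:
  "hyp_rot n p \<theta> * symplectic_form n =
    (symplectic_form n * hyp_rot n p (\<lambda>i. - \<theta> i) :: 'a :: real_field mat)"
proof (rule eq_matI)
  let ?J = "symplectic_form n :: 'a mat" and ?D = "hyp_rot n p (\<lambda>i. - \<theta> i) :: 'a mat"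
  fix i j assume "i < dim_row (?J * ?D)" "j < dim_col (?J * ?D)"
  hence ij: "i < 2 * n" "j < 2 * n"
    by auto
  \<comment> \<open>Transposing brings the hyperbolic factor to the left, where the row formula for
    its products applies.\<close>
  have "(?J * ?D) $$ (i, j) = ((?D\<^sup>T * ?J\<^sup>T)\<^sup>T) $$ (i, j)"
    by (subst transpose_mult[of _ "2*n" "2*n" _ "2*n"]) auto
  also have "\<dots> = (?D * - ?J) $$ (j, i)"
    using ij by (simp add: transpose_hyp_rot transpose_symplectic_form)
  also have "\<dots> = (hyp_rot n p \<theta> * ?J) $$ (i, j)"
  proof -
    have ang: "angle n p (\<lambda>i. - \<theta> i) k = - angle n p \<theta> k" for k
      by (simp add: angle_def)
    have "(?D * - ?J) $$ (j, i) = - (of_real (cosh (signed_angle n p (\<lambda>i. - \<theta> i) j)) * ?J $$ (j, i) +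
        of_real (sinh (signed_angle n p (\<lambda>i. - \<theta> i) j)) * ?J $$ (flip_index n p j, i))"
      using ij flip_index_less[OF ij(2)] by (subst hyp_rot_mult_index[of _ "2*n"]) auto
    also have "\<dots> = of_real (cosh (signed_angle n p \<theta> i)) * ?J $$ (i, j) +
        of_real (sinh (signed_angle n p \<theta> i)) * ?J $$ (flip_index n p i, j)"
    proof -
      consider "i < n" "j < n" | "i < n" "\<not> j < n" | "\<not> i < n" "j < n" | "\<not> i < n" "\<not> j < n"
        by blast
      thus ?thesis
      proof cases
        case 1
        thus ?thesis
          using ij swap_index_less[OF np(1), of i] swap_index_less[OF np(1), of j]
          by (simp add: symplectic_form_index flip_index_def)
      next
        case 2
        define j' where "j' = j - n"
        have j': "j = j' + n" "j' < n"
          using 2 ij by (auto simp: j'_def)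
        have "swap_index n p j' = i \<longleftrightarrow> j' = swap_index n p i" "swap_index n p j' = i \<Longrightarrow> angle n p \<theta> j' = angle n p \<theta> i"
          using swap_swap_index[of i] swap_swap_index[of j'] angle_swap_index[of j' \<theta>] 2 j' by auto
        thus ?thesis
          using 2 j' swap_index_less[OF np(1), of i] swap_index_less[OF np(1), of j']
          by (auto simp: symplectic_form_index flip_index_def signed_angle_def ang)
      next
        case 3
        define i' where "i' = i - n"
        have i': "i = i' + n" "i' < n"
          using 3 ij by (auto simp: i'_def)
        have "swap_index n p i' = j \<longleftrightarrow> i' = swap_index n p j" "swap_index n p i' = j \<Longrightarrow> angle n p \<theta> i' = angle n p \<theta> j"
          using swap_swap_index[of j] swap_swap_index[of i'] angle_swap_index[of i' \<theta>] 3 i' by auto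
        thus ?thesis
          using 3 i' swap_index_less[OF np(1), of j] swap_index_less[OF np(1), of i']
          by (auto simp: symplectic_form_index flip_index_def signed_angle_def ang)
      next
        case 4
        thus ?thesis
          using ij swap_index_less[OF np(1), of "i - n", OF less_diff_conv2[THEN iffD2]]
            swap_index_less[OF np(1), of "j - n", OF less_diff_conv2[THEN iffD2]]
          by (simp add: symplectic_form_index flip_index_def)
      qed
    qed
    also have "\<dots> = (hyp_rot n p \<theta> * ?J) $$ (i, j)"
      by (rule hyp_rot_mult_index[OF symplectic_form_carrier ij, symmetric])
    finally show ?thesis .
  qed
  finally show "(hyp_rot n p \<theta> * ?J) $$ (i, j) = (?J * ?D) $$ (i, j)"
    by simp
qed auto

lemma hyp_rot_symplectic: "hyp_rot n p \<theta> \<in> (symplectic_group n :: 'a :: real_field mat set)"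
proof -
  let ?D = "hyp_rot n p \<theta> :: 'a mat"
  have "?D\<^sup>T * symplectic_form n * ?D = symplectic_form n * hyp_rot n p (\<lambda>i. - \<theta> i) * ?D"
    by (simp only: transpose_hyp_rot hyp_rot_mult_symplectic_form)
  also have "\<dots> = symplectic_form n * (hyp_rot n p (\<lambda>i. - \<theta> i) * ?D)"
    by (rule assoc_mult_mat) auto
  finally show ?thesis
    by (simp add: symplectic_group_def hyp_rot_inverse)
qed

end

section \<open>The block matrices H and H^(-1) in coordinates\<close>

lemma append_cols_dim [simp]:
  "dim_row (A @\<^sub>c B) = dim_row A" "dim_col (A @\<^sub>c B) = dim_col A + dim_col B"
  by (simp_all add: append_cols_def)

lemma append_rows_dim [simp]:
  "dim_row (A @\<^sub>r B) = dim_row A + dim_row B" "dim_col (A @\<^sub>r B) = dim_col A"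
  by (simp_all add: append_rows_def)

lemma append_cols_index:
  "i < dim_row A \<Longrightarrow> j < dim_col A + dim_col B \<Longrightarrow>
     (A @\<^sub>c B) $$ (i, j) = (if j < dim_col A then A $$ (i, j) else B $$ (i, j - dim_col A))"
  by (simp add: append_cols_def)

lemma append_rows_index:
  "i < dim_row A + dim_row B \<Longrightarrow> j < dim_col A \<Longrightarrow>
     (A @\<^sub>r B) $$ (i, j) = (if i < dim_row A then A $$ (i, j) else B $$ (i - dim_row A, j))"
  by (simp add: append_rows_def)

lemma hyp_mat_carrier [simp]: "q \<le> p \<Longrightarrow> hyp_mat p q \<theta> \<in> carrier_mat (p + q) (p + q)"
  "q \<le> p \<Longrightarrow> hyp_mat_inv p q \<theta> \<in> carrier_mat (p + q) (p + q)"
  by (auto simp: hyp_mat_def hyp_mat_inv_def Ch_def Sh_def mat_diag_def)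

lemma hyp_mat_dim [simp]:
  assumes "q \<le> p"
  shows "dim_row (hyp_mat p q \<theta>) = p + q" "dim_col (hyp_mat p q \<theta>) = p + q"
    "dim_row (hyp_mat_inv p q \<theta>) = p + q" "dim_col (hyp_mat_inv p q \<theta>) = p + q"
  using hyp_mat_carrier[OF assms] by (blast dest: carrier_matD)+

lemma hyp_mat_index:
  assumes "q \<le> p" "i < p + q" "j < p + q"
  shows "hyp_mat p q \<theta> $$ (i, j) =
     (if j = i then of_real (cosh (angle (p + q) p \<theta> i)) else 0) +
     (if j = swap_index (p + q) p i then of_real (sinh (angle (p + q) p \<theta> i)) else 0)"
proof -
  \<comment> \<open>Replaces the truncated difference p - q by a number, so that rows and columns
    split into three explicit ranges of lengths q, d, q.\<close>
  obtain d where p: "p = q + d"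
    using assms(1) le_Suc_ex by blast
  have split: "k < q \<or> (\<exists>a<d. k = q + a) \<or> (\<exists>b<q. k = q + d + b)" if "k < p + q" for k
    using that p by (metis add.commute add_less_cancel_left le_add_diff_inverse not_less)
  from split[OF assms(2)] split[OF assms(3)] show ?thesis
    unfolding p
    by (elim disjE exE conjE)
      (simp_all add: hyp_mat_def Ch_def Sh_def mat_diag_def append_rows_index append_cols_index
        angle_def swap_index_def)
qed

lemma hyp_mat_inv_index:
  assumes "q \<le> p" "i < p + q" "j < p + q"
  shows "hyp_mat_inv p q \<theta> $$ (i, j) =
     (if j = i then of_real (cosh (angle (p + q) p \<theta> i)) else 0) -
     (if j = swap_index (p + q) p i then of_real (sinh (angle (p + q) p \<theta> i)) else 0)"
proof -
  obtain d where p: "p = q + d"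
    using assms(1) le_Suc_ex by blast
  have split: "k < q \<or> (\<exists>a<d. k = q + a) \<or> (\<exists>b<q. k = q + d + b)" if "k < p + q" for k
    using that p by (metis add.commute add_less_cancel_left le_add_diff_inverse not_less)
  from split[OF assms(2)] split[OF assms(3)] show ?thesis
    unfolding p
    by (elim disjE exE conjE)
      (simp_all add: hyp_mat_inv_def Ch_def Sh_def mat_diag_def append_rows_index append_cols_index
        angle_def swap_index_def)
qed

lemma hyp_mat_uminus: "q \<le> p \<Longrightarrow> hyp_mat p q (\<lambda>i. - \<theta> i) = hyp_mat_inv p q \<theta>"
proof -
  assume q: "q \<le> p"
  have "angle n p (\<lambda>i. - \<theta> i) i = - angle n p \<theta> i" for i n
    by (simp add: angle_def)
  thus ?thesis
    using q
    by (intro eq_matI) (auto simp: hyp_mat_index hyp_mat_inv_index)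
qed

text \<open>Passage from the block form of the statement to the entrywise form in which all
  computations are done.\<close>

lemma hyp_rot_four_block:
  assumes "q \<le> p"
  shows "four_block_mat (hyp_mat p q \<theta>) (0\<^sub>m (p + q) (p + q)) (0\<^sub>m (p + q) (p + q)) (hyp_mat_inv p q \<theta>) =
    (hyp_rot (p + q) p \<theta> :: 'a :: real_field mat)" (is "?F = ?R")
proof (rule eq_matI)
  fix i j assume "i < dim_row ?R" "j < dim_col ?R"
  hence ij: "i < 2 * (p + q)" "j < 2 * (p + q)"
    by auto
  consider "i < p + q" "j < p + q" | "i < p + q" "\<not> j < p + q" | "\<not> i < p + q" "j < p + q"
    | "\<not> i < p + q" "\<not> j < p + q"
    by blast
  thus "?F $$ (i, j) = ?R $$ (i, j)"
  proof cases
    case 1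
    thus ?thesis
      using ij assms by (simp add: assms hyp_rot_def hyp_mat_index flip_index_def signed_angle_def)
  next
    case 2
    hence "j \<noteq> i" "j \<noteq> swap_index (p + q) p i"
      using assms by (auto simp: swap_index_def)
    with 2 show ?thesis
      using ij by (simp add: assms hyp_rot_def flip_index_def)
  next
    case 3
    hence "j \<noteq> i" "j \<noteq> swap_index (p + q) p (i - (p + q)) + (p + q)"
      by auto
    with 3 show ?thesis
      using ij by (simp add: assms hyp_rot_def flip_index_def)
  next
    case 4
    define i' j' where "i' = i - (p + q)" and "j' = j - (p + q)"
    have "i = i' + (p + q)" "i' < p + q" "j = j' + (p + q)" "j' < p + q"
      using 4 ij by (auto simp: i'_def j'_def)
    thus ?thesis
      using assms by (simp add: hyp_rot_def hyp_mat_inv_index flip_index_def signed_angle_def)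
  qed
qed (use assms in auto)

text \<open>Read off the upper left block of the product of the hyperbolic rotations by opposite
  angles; the other order is the same fact for the negated angles.\<close>

lemma hyp_mat_inverts:
  assumes "q \<le> p"
  shows "inverts_mat (hyp_mat p q \<theta> :: 'a :: real_field mat) (hyp_mat_inv p q \<theta>)"
    "inverts_mat (hyp_mat_inv p q \<theta> :: 'a mat) (hyp_mat p q \<theta>)"
proof -
  have "hyp_mat p q \<theta> * hyp_mat_inv p q \<theta> = (1\<^sub>m (p + q) :: 'a mat)" for \<theta>
  proof (rule eq_matI)
    let ?H = "hyp_mat p q \<theta> :: 'a mat" and ?I = "hyp_mat_inv p q \<theta> :: 'a mat"
    let ?Z = "0\<^sub>m (p + q) (p + q) :: 'a mat"
    have *: "four_block_mat (?H * ?I) ?Z ?Z (?I * ?H) = 1\<^sub>m (2 * (p + q))"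
    proof -
      have "(hyp_rot (p + q) p \<theta> :: 'a mat) * hyp_rot (p + q) p (\<lambda>i. - \<theta> i) = 1\<^sub>m (2 * (p + q))"
        using assms by (intro hyp_rot_inverse) auto
      moreover have "hyp_mat_inv p q (\<lambda>i. - \<theta> i) = ?H"
        using hyp_mat_uminus[OF assms, of "\<lambda>i. - \<theta> i", symmetric] by simp
      ultimately show ?thesis
        unfolding hyp_rot_four_block[OF assms, symmetric] hyp_mat_uminus[OF assms]
        by (subst (asm) mult_four_block_mat[of _ "p+q" "p+q" _ "p+q" _ "p+q" _ _ "p+q" _ "p+q"])
          (use assms in \<open>auto simp: mult_carrier_mat[of _ _ "p+q"]\<close>)
    qed
    fix i j assume "i < dim_row (1\<^sub>m (p + q) :: 'a mat)" "j < dim_col (1\<^sub>m (p + q) :: 'a mat)"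
    thus "(?H * ?I) $$ (i, j) = (1\<^sub>m (p + q) :: 'a mat) $$ (i, j)"
      using arg_cong[OF *, of "\<lambda>A. A $$ (i, j)"] assms by simp
  qed (use assms in auto)
  from this[of \<theta>] this[of "\<lambda>i. - \<theta> i"] show "inverts_mat (hyp_mat p q \<theta> :: 'a mat) (hyp_mat_inv p q \<theta>)"
    "inverts_mat (hyp_mat_inv p q \<theta> :: 'a mat) (hyp_mat p q \<theta>)"
    using assms hyp_mat_uminus[OF assms, of "\<lambda>i. - \<theta> i", where ?'a = 'a]
    by (auto simp: inverts_mat_def hyp_mat_uminus[OF assms])
qed

section \<open>Symplectic direct sums\<close>

text \<open>\<open>left_index\<close> and \<open>right_index\<close> place the coordinates of the
  two summands in the interleaved block order p, q, p, q.\<close>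

definition left_index :: "nat \<Rightarrow> nat \<Rightarrow> nat \<Rightarrow> nat" where
  "left_index p q a = (if a < p then a else a + q)"

definition right_index :: "nat \<Rightarrow> nat \<Rightarrow> nat \<Rightarrow> nat" where
  "right_index p q b = (if b < q then b + p else b + 2 * p)"

definition reflection :: "nat \<Rightarrow> nat \<Rightarrow> 'a :: comm_ring_1 mat" where
  "reflection n p = mat_diag (2 * n) (\<lambda>k. if k < p \<or> n \<le> k \<and> k < n + p then 1 else - 1)"

lemma reflection_carrier [simp]: "reflection n p \<in> carrier_mat (2 * n) (2 * n)"
  by (simp add: reflection_def)

context
  notes distrib_left_numeral [simp del]
begin

lemma left_right_index_simps [simp]:
  "a < 2 * p \<Longrightarrow> left_index p q a < 2 * (p + q)"
  "b < 2 * q \<Longrightarrow> right_index p q b < 2 * (p + q)"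
  "left_index p q a = left_index p q a' \<longleftrightarrow> a = a'"
  "right_index p q b = right_index p q b' \<longleftrightarrow> b = b'"
  "a < 2 * p \<Longrightarrow> b < 2 * q \<Longrightarrow> left_index p q a \<noteq> right_index p q b"
  "a < 2 * p \<Longrightarrow> b < 2 * q \<Longrightarrow> right_index p q b \<noteq> left_index p q a"
  by (auto simp: left_index_def right_index_def distrib_left split: if_splits)

lemma left_right_index_cases:
  assumes "i < 2 * (p + q)"
  obtains (left) a where "a < 2 * p" "i = left_index p q a"
  | (right) b where "b < 2 * q" "i = right_index p q b"
proof -
  consider "i < p" | "p \<le> i" "i < p + q" | "p + q \<le> i" "i < 2 * p + q" | "2 * p + q \<le> i"
    by linarith
  thus thesis
  proof cases
    case 1
    thus ?thesis using left[of i] by (simp add: left_index_def)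
  next
    case 2
    hence "i - p < q" by linarith
    with 2 show ?thesis using right[of "i - p"] by (simp add: right_index_def)
  next
    case 3
    thus ?thesis using left[of "i - q"] by (simp add: left_index_def)
  next
    case 4
    hence "i - 2 * p < 2 * q" "\<not> i - 2 * p < q" "i - 2 * p + 2 * p = i"
      using assms unfolding distrib_left by auto
    thus ?thesis using right[of "i - 2 * p"] by (simp add: right_index_def)
  qed
qed

lemma sum_left_right_index:
  fixes g :: "nat \<Rightarrow> 'a :: comm_monoid_add"
  shows "(\<Sum>k<2*(p+q). g k) = (\<Sum>a<2*p. g (left_index p q a)) + (\<Sum>b<2*q. g (right_index p q b))"
proof -
  have "{..<2*(p+q)} = left_index p q ` {..<2*p} \<union> right_index p q ` {..<2*q}"
    by (auto elim!: left_right_index_cases[of _ p q])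
  hence "(\<Sum>k<2*(p+q). g k) = (\<Sum>k\<in>left_index p q ` {..<2*p} \<union> right_index p q ` {..<2*q}. g k)"
    by simp
  also have "\<dots> = sum g (left_index p q ` {..<2*p}) + sum g (right_index p q ` {..<2*q})"
    by (rule sum.union_disjoint) auto
  also have "sum g (left_index p q ` {..<2*p}) = (\<Sum>a<2*p. g (left_index p q a))"
    by (subst sum.reindex) (auto intro: inj_onI)
  also have "sum g (right_index p q ` {..<2*q}) = (\<Sum>b<2*q. g (right_index p q b))"
    by (subst sum.reindex) (auto intro: inj_onI)
  finally show ?thesis .
qed

lemma symplectic_direct_sum_carrier [simp]:
  "A \<in> carrier_mat (2 * p) (2 * p) \<Longrightarrow> B \<in> carrier_mat (2 * q) (2 * q) \<Longrightarrow>
     symplectic_direct_sum p q A B \<in> carrier_mat (2 * (p + q)) (2 * (p + q))"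
  by (intro carrier_matI) (simp_all add: symplectic_direct_sum_def split_block_def Let_def mult_2)

lemma symplectic_direct_sum_dim [simp]:
  assumes "A \<in> carrier_mat (2 * p) (2 * p)" "B \<in> carrier_mat (2 * q) (2 * q)"
  shows "dim_row (symplectic_direct_sum p q A B) = 2 * (p + q)"
    "dim_col (symplectic_direct_sum p q A B) = 2 * (p + q)"
  using symplectic_direct_sum_carrier[OF assms] by (blast dest: carrier_matD)+

lemma symplectic_direct_sum_index:
  fixes A B :: "'a :: zero mat"
  assumes A: "A \<in> carrier_mat (2 * p) (2 * p)" and B: "B \<in> carrier_mat (2 * q) (2 * q)"
  shows "a < 2 * p \<Longrightarrow> a' < 2 * p \<Longrightarrow>
      symplectic_direct_sum p q A B $$ (left_index p q a, left_index p q a') = A $$ (a, a')"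
    and "a < 2 * p \<Longrightarrow> b' < 2 * q \<Longrightarrow>
      symplectic_direct_sum p q A B $$ (left_index p q a, right_index p q b') = 0"
    and "b < 2 * q \<Longrightarrow> a' < 2 * p \<Longrightarrow>
      symplectic_direct_sum p q A B $$ (right_index p q b, left_index p q a') = 0"
    and "b < 2 * q \<Longrightarrow> b' < 2 * q \<Longrightarrow>
      symplectic_direct_sum p q A B $$ (right_index p q b, right_index p q b') = B $$ (b, b')"
proof -
  have form: "(k < 2 * m) = (k < m \<or> (\<exists>l<m. k = l + m))" for k m :: nat
    by presburger
  note simps = symplectic_direct_sum_def split_block_def Let_def append_rows_index append_cols_index
    left_index_def right_index_def
  have dims: "dim_row A = p + p" "dim_col A = p + p" "dim_row B = q + q" "dim_col B = q + q"
    using A B by auto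
  show "a < 2 * p \<Longrightarrow> a' < 2 * p \<Longrightarrow>
      symplectic_direct_sum p q A B $$ (left_index p q a, left_index p q a') = A $$ (a, a')"
    unfolding form by (elim disjE exE conjE) (simp_all add: simps dims)
  show "a < 2 * p \<Longrightarrow> b' < 2 * q \<Longrightarrow>
      symplectic_direct_sum p q A B $$ (left_index p q a, right_index p q b') = 0"
    unfolding form by (elim disjE exE conjE) (simp_all add: simps dims)
  show "b < 2 * q \<Longrightarrow> a' < 2 * p \<Longrightarrow>
      symplectic_direct_sum p q A B $$ (right_index p q b, left_index p q a') = 0"
    unfolding form by (elim disjE exE conjE) (simp_all add: simps dims)
  show "b < 2 * q \<Longrightarrow> b' < 2 * q \<Longrightarrow>
      symplectic_direct_sum p q A B $$ (right_index p q b, right_index p q b') = B $$ (b, b')"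
    unfolding form by (elim disjE exE conjE) (simp_all add: simps dims)
qed

lemma eq_symplectic_direct_sumI:
  assumes "X \<in> carrier_mat (2 * (p + q)) (2 * (p + q))"
    and A: "A \<in> carrier_mat (2 * p) (2 * p)" and B: "B \<in> carrier_mat (2 * q) (2 * q)"
    and "\<And>a a'. a < 2 * p \<Longrightarrow> a' < 2 * p \<Longrightarrow> X $$ (left_index p q a, left_index p q a') = A $$ (a, a')"
    and "\<And>a b'. a < 2 * p \<Longrightarrow> b' < 2 * q \<Longrightarrow> X $$ (left_index p q a, right_index p q b') = 0"
    and "\<And>b a'. b < 2 * q \<Longrightarrow> a' < 2 * p \<Longrightarrow> X $$ (right_index p q b, left_index p q a') = 0"
    and "\<And>b b'. b < 2 * q \<Longrightarrow> b' < 2 * q \<Longrightarrow> X $$ (right_index p q b, right_index p q b') = B $$ (b, b')"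
  shows "X = symplectic_direct_sum p q A B"
proof (rule eq_matI)
  fix i j assume "i < dim_row (symplectic_direct_sum p q A B)" "j < dim_col (symplectic_direct_sum p q A B)"
  hence "i < 2 * (p + q)" "j < 2 * (p + q)"
    by (simp_all only: symplectic_direct_sum_dim[OF A B])
  thus "X $$ (i, j) = symplectic_direct_sum p q A B $$ (i, j)"
    by (elim left_right_index_cases) (simp_all add: assms symplectic_direct_sum_index)
qed (use assms(1) A B in auto)

lemma symplectic_direct_sum_inject:
  assumes "A \<in> carrier_mat (2 * p) (2 * p)" "B \<in> carrier_mat (2 * q) (2 * q)"
    and "A' \<in> carrier_mat (2 * p) (2 * p)" "B' \<in> carrier_mat (2 * q) (2 * q)"
    and eq: "symplectic_direct_sum p q A B = symplectic_direct_sum p q A' B'"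
  shows "A = A'" "B = B'"
proof -
  show "A = A'"
  proof (rule eq_matI)
    fix a a' assume "a < dim_row A'" "a' < dim_col A'"
    thus "A $$ (a, a') = A' $$ (a, a')"
      using arg_cong[OF eq, of "\<lambda>X. X $$ (left_index p q a, left_index p q a')"] assms(1-4)
      by (simp add: symplectic_direct_sum_index)
  qed (use assms in auto)
  show "B = B'"
  proof (rule eq_matI)
    fix b b' assume "b < dim_row B'" "b' < dim_col B'"
    thus "B $$ (b, b') = B' $$ (b, b')"
      using arg_cong[OF eq, of "\<lambda>X. X $$ (right_index p q b, right_index p q b')"] assms(1-4)
      by (simp add: symplectic_direct_sum_index)
  qed (use assms in auto)
qed

lemma mat_mult_index_sum:
  "X \<in> carrier_mat n m \<Longrightarrow> Y \<in> carrier_mat m l \<Longrightarrow> i < n \<Longrightarrow> j < l \<Longrightarrow>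
     (X * Y) $$ (i, j) = (\<Sum>k<m. X $$ (i, k) * Y $$ (k, j))"
  by (auto simp: scalar_prod_def atLeast0LessThan)

lemma symplectic_direct_sum_mult:
  fixes A :: "'a :: semiring_0 mat"
  assumes "A \<in> carrier_mat (2 * p) (2 * p)" "B \<in> carrier_mat (2 * q) (2 * q)"
    and "A' \<in> carrier_mat (2 * p) (2 * p)" "B' \<in> carrier_mat (2 * q) (2 * q)"
  shows "symplectic_direct_sum p q A B * symplectic_direct_sum p q A' B' =
    symplectic_direct_sum p q (A * A') (B * B')"
proof (rule eq_symplectic_direct_sumI)
  have AA: "A * A' \<in> carrier_mat (2 * p) (2 * p)" and BB: "B * B' \<in> carrier_mat (2 * q) (2 * q)"
    using assms by auto
  show "A * A' \<in> carrier_mat (2 * p) (2 * p)" "B * B' \<in> carrier_mat (2 * q) (2 * q)"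
    by (fact AA, fact BB)
  have c: "symplectic_direct_sum p q A B \<in> carrier_mat (2 * (p + q)) (2 * (p + q))"
    "symplectic_direct_sum p q A' B' \<in> carrier_mat (2 * (p + q)) (2 * (p + q))"
    using assms by simp_all
  show "symplectic_direct_sum p q A B * symplectic_direct_sum p q A' B' \<in> carrier_mat (2 * (p + q)) (2 * (p + q))"
    using c by (rule mult_carrier_mat)
qed (simp_all del: index_mult_mat add: assms mat_mult_index_sum[of _ "2*p" "2*p" _ "2*p"]
    mat_mult_index_sum[of _ "2*q" "2*q" _ "2*q"] mat_mult_index_sum[of _ "2*(p+q)" "2*(p+q)" _ "2*(p+q)"]
    symplectic_direct_sum_index sum_left_right_index)

lemma transpose_symplectic_direct_sum:
  assumes "A \<in> carrier_mat (2 * p) (2 * p)" "B \<in> carrier_mat (2 * q) (2 * q)"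
  shows "(symplectic_direct_sum p q A B)\<^sup>T = symplectic_direct_sum p q A\<^sup>T B\<^sup>T"
  using assms by (intro eq_symplectic_direct_sumI) (auto simp: symplectic_direct_sum_index)

text \<open>The purpose of the interleaving: conjugate coordinates of either summand remain
  conjugate in the large space.\<close>

lemma symplectic_form_direct_sum:
  "symplectic_form (p + q) = symplectic_direct_sum p q (symplectic_form p) (symplectic_form q)"
  by (rule eq_symplectic_direct_sumI)
    (auto simp: symplectic_form_index, auto simp: left_index_def right_index_def split: if_splits)

lemma reflection_direct_sum:
  "reflection (p + q) p = symplectic_direct_sum p q (1\<^sub>m (2 * p)) (- 1\<^sub>m (2 * q))"
  by (rule eq_symplectic_direct_sumI)
    (auto simp: reflection_def mat_diag_def, auto simp: left_index_def right_index_def split: if_splits)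

lemma reflection_commute_direct_sum:
  fixes A :: "'a :: comm_ring_1 mat"
  assumes "A \<in> carrier_mat (2 * p) (2 * p)" "B \<in> carrier_mat (2 * q) (2 * q)"
  shows "reflection (p + q) p * symplectic_direct_sum p q A B =
    symplectic_direct_sum p q A B * reflection (p + q) p"
  using assms by (simp add: reflection_direct_sum symplectic_direct_sum_mult)

lemma symplectic_direct_sum_symplectic_iff:
  fixes A :: "'a :: comm_ring_1 mat"
  assumes "A \<in> carrier_mat (2 * p) (2 * p)" "B \<in> carrier_mat (2 * q) (2 * q)"
  shows "symplectic_direct_sum p q A B \<in> symplectic_group (p + q) \<longleftrightarrow>
    A \<in> symplectic_group p \<and> B \<in> symplectic_group q"
proof -
  have "(symplectic_direct_sum p q A B)\<^sup>T * symplectic_form (p + q) * symplectic_direct_sum p q A B =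
      symplectic_direct_sum p q (A\<^sup>T * symplectic_form p * A) (B\<^sup>T * symplectic_form q * B)"
    using assms by (simp add: symplectic_form_direct_sum transpose_symplectic_direct_sum
        symplectic_direct_sum_mult mult_carrier_mat[of _ _ "2*p"] mult_carrier_mat[of _ _ "2*q"])
  moreover have "symplectic_direct_sum p q (A\<^sup>T * symplectic_form p * A) (B\<^sup>T * symplectic_form q * B) =
      symplectic_direct_sum p q (symplectic_form p) (symplectic_form q) \<longleftrightarrow>
    A\<^sup>T * symplectic_form p * A = symplectic_form p \<and> B\<^sup>T * symplectic_form q * B = symplectic_form q"
    using assms symplectic_direct_sum_inject[of "A\<^sup>T * symplectic_form p * A" p "B\<^sup>T * symplectic_form q * B" q
        "symplectic_form p" "symplectic_form q"]
    by (auto simp: mult_carrier_mat[of _ _ "2*p"] mult_carrier_mat[of _ _ "2*q"])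
  ultimately show ?thesis
    using assms by (simp add: symplectic_group_def symplectic_form_direct_sum)
qed

text \<open>An entry joining the two parts is multiplied by opposite signs on the two sides of the
  commutation relation, so it equals its negative and vanishes.\<close>

lemma commute_reflection_imp_direct_sum:
  fixes L :: "'a :: field_char_0 mat"
  assumes L: "L \<in> carrier_mat (2 * (p + q)) (2 * (p + q))"
    and comm: "reflection (p + q) p * L = L * reflection (p + q) p"
  obtains A B where "A \<in> carrier_mat (2 * p) (2 * p)" "B \<in> carrier_mat (2 * q) (2 * q)"
    "L = symplectic_direct_sum p q A B"
proof
  let ?A = "mat (2 * p) (2 * p) (\<lambda>(a, a'). L $$ (left_index p q a, left_index p q a'))"
  let ?B = "mat (2 * q) (2 * q) (\<lambda>(b, b'). L $$ (right_index p q b, right_index p q b'))"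
  let ?s = "\<lambda>k. if k < p \<or> p + q \<le> k \<and> k < p + q + p then 1 else - 1 :: 'a"
  have *: "?s i * L $$ (i, j) = L $$ (i, j) * ?s j" if "i < 2 * (p + q)" "j < 2 * (p + q)" for i j
    using arg_cong[OF comm, of "\<lambda>X. X $$ (i, j)"] that
    by (simp add: reflection_def mat_diag_mult_left[OF L] mat_diag_mult_right[OF L])
  have left: "?s (left_index p q a) = 1" if "a < 2 * p" for a
    using that by (auto simp: left_index_def)
  have right: "?s (right_index p q b) = - 1" if "b < 2 * q" for b
    using that by (auto simp: right_index_def)
  show "?A \<in> carrier_mat (2 * p) (2 * p)" "?B \<in> carrier_mat (2 * q) (2 * q)"
    by auto
  show "L = symplectic_direct_sum p q ?A ?B"
  proof (rule eq_symplectic_direct_sumI)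
    show "L $$ (left_index p q a, right_index p q b) = 0" if "a < 2 * p" "b < 2 * q" for a b
      using *[of "left_index p q a" "right_index p q b"] that unfolding left[OF that(1)] right[OF that(2)] by simp
    show "L $$ (right_index p q b, left_index p q a) = 0" if "b < 2 * q" "a < 2 * p" for a b
      using *[of "right_index p q b" "left_index p q a"] that unfolding left[OF that(2)] right[OF that(1)] by simp
  qed (use L in auto)
qed

end

section \<open>The factorization and the uniqueness of its angles\<close>

lemma symplectic_groupD:
  assumes "A \<in> symplectic_group n"
  shows "A \<in> carrier_mat (2 * n) (2 * n)" "A\<^sup>T * symplectic_form n * A = symplectic_form n"
  using assms by (auto simp: symplectic_group_def)

lemma symplectic_group_mult:
  assumes "A \<in> symplectic_group n" "B \<in> symplectic_group n"
  shows "A * B \<in> symplectic_group n"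
proof -
  note A = symplectic_groupD[OF assms(1)] and B = symplectic_groupD[OF assms(2)]
  have "(A * B)\<^sup>T * symplectic_form n * (A * B) = B\<^sup>T * (A\<^sup>T * symplectic_form n * A) * B"
    using A(1) B(1) by (simp add: transpose_mult[of _ "2*n" "2*n"] assoc_mult_mat[of _ "2*n" "2*n" _ "2*n" _ "2*n"]
        mult_carrier_mat[of _ "2*n" "2*n"])
  thus ?thesis
    using A B by (simp add: symplectic_group_def mult_carrier_mat[of _ "2*n" "2*n"])
qed

lemma symplectic_group_inverse:
  fixes A :: "'a :: field mat"
  assumes "A \<in> symplectic_group n"
  shows "- (symplectic_form n * A\<^sup>T * symplectic_form n) * A = 1\<^sub>m (2 * n)"
    "A * - (symplectic_form n * A\<^sup>T * symplectic_form n) = 1\<^sub>m (2 * n)"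
proof -
  let ?J = "symplectic_form n :: 'a mat"
  note A = symplectic_groupD[OF assms]
  have c: "?J * A\<^sup>T * ?J \<in> carrier_mat (2 * n) (2 * n)"
    using A(1) by (auto intro!: mult_carrier_mat[of _ "2*n" "2*n"])
  have "?J * A\<^sup>T * ?J * A = ?J * (A\<^sup>T * ?J * A)"
    using A(1) by (simp add: assoc_mult_mat[of _ "2*n" "2*n" _ "2*n" _ "2*n"] mult_carrier_mat[of _ "2*n" "2*n"])
  also have "\<dots> = - 1\<^sub>m (2 * n)"
    unfolding A(2) by (rule symplectic_form_square)
  finally show *: "- (?J * A\<^sup>T * ?J) * A = 1\<^sub>m (2 * n)"
    using A(1) c by simp
  show "A * - (?J * A\<^sup>T * ?J) = 1\<^sub>m (2 * n)"
    by (rule mat_mult_left_right_inverse[OF _ A(1) *]) (use c in simp)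
qed

text \<open>The inverse - J A^T J also works on the right, which gives A J A^T J = -1; multiplying
  by J removes the last factor.\<close>

lemma symplectic_group_transpose:
  fixes A :: "'a :: field mat"
  assumes "A \<in> symplectic_group n"
  shows "A\<^sup>T \<in> symplectic_group n"
proof -
  let ?J = "symplectic_form n :: 'a mat"
  note A = symplectic_groupD[OF assms]
  have c: "A * ?J * A\<^sup>T \<in> carrier_mat (2 * n) (2 * n)" "?J * A\<^sup>T * ?J \<in> carrier_mat (2 * n) (2 * n)"
    using A(1) by (auto intro!: mult_carrier_mat[of _ "2*n" "2*n"])
  have "A * ?J * A\<^sup>T * ?J = A * (?J * A\<^sup>T * ?J)"
    using A(1) by (simp add: assoc_mult_mat[of _ "2*n" "2*n" _ "2*n" _ "2*n"] mult_carrier_mat[of _ "2*n" "2*n"])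
  also have "\<dots> = - (A * - (?J * A\<^sup>T * ?J))"
    using A(1) c(2) by simp
  also have "\<dots> = - 1\<^sub>m (2 * n)"
    by (simp only: symplectic_group_inverse(2)[OF assms])
  finally have *: "A * ?J * A\<^sup>T * ?J = - 1\<^sub>m (2 * n)" .
  have "A * ?J * A\<^sup>T = - (A * ?J * A\<^sup>T * (?J * ?J))"
    unfolding symplectic_form_square using c(1) by (simp add: carrier_matD[OF A(1)])
  also have "A * ?J * A\<^sup>T * (?J * ?J) = A * ?J * A\<^sup>T * ?J * ?J"
    by (rule assoc_mult_mat[symmetric, OF c(1)]) auto
  also have "- \<dots> = ?J"
    unfolding * by simp
  finally show ?thesis
    using A(1) by (simp add: symplectic_group_def)
qed

lemma symplectic_group_conj_mat:
  fixes A :: "'a :: conjugatable_field mat"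
  assumes "A \<in> symplectic_group n"
  shows "conj_mat A \<in> symplectic_group n"
proof -
  note A = symplectic_groupD[OF assms]
  have "(conj_mat A)\<^sup>T * symplectic_form n * conj_mat A = conj_mat (A\<^sup>T * symplectic_form n * A)"
    using A(1) by (simp add: conj_mat_mult[of _ "2*n" "2*n" _ "2*n"] mult_carrier_mat[of _ "2*n" "2*n"] transpose_conj_mat)
  thus ?thesis
    using A by (simp add: symplectic_group_def)
qed

lemma symplectic_group_inverse_closed:
  fixes A :: "'a :: field mat"
  assumes "A \<in> symplectic_group n"
  obtains B where "B \<in> symplectic_group n" "A * B = 1\<^sub>m (2 * n)" "B * A = 1\<^sub>m (2 * n)"
proof
  let ?J = "symplectic_form n :: 'a mat"
  define B where "B = - (?J * A\<^sup>T * ?J)"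
  note A = symplectic_groupD[OF assms]
  show inv: "A * B = 1\<^sub>m (2 * n)" "B * A = 1\<^sub>m (2 * n)"
    using symplectic_group_inverse[OF assms] by (auto simp: B_def)
  have B: "B \<in> carrier_mat (2 * n) (2 * n)"
    using A(1) by (auto simp: B_def intro!: mult_carrier_mat[of _ "2*n" "2*n"])
  have "B\<^sup>T * ?J * B = B\<^sup>T * (A\<^sup>T * ?J * A) * B"
    by (simp only: A(2))
  also have "\<dots> = (A * B)\<^sup>T * ?J * (A * B)"
    using A(1) B by (simp only: transpose_mult[OF A(1) B] assoc_mult_mat[of _ "2*n" "2*n" _ "2*n" _ "2*n"]
        mult_carrier_mat[of _ "2*n" "2*n"] transpose_carrier_mat symplectic_form_carrier)
  also have "\<dots> = ?J"
    unfolding inv by simp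
  finally show "B \<in> symplectic_group n"
    using B by (simp add: symplectic_group_def)
qed

lemma reflection_square: "reflection n p * reflection n p = 1\<^sub>m (2 * n)"
  unfolding reflection_def by (subst mat_diag_diag) (auto simp: mat_diag_def intro!: eq_matI)

lemma conj_reflection [simp]: "conj_mat (reflection n p) = (reflection n p :: 'a :: conjugatable_field mat)"
  by (rule eq_matI) (auto simp: reflection_def mat_diag_def conjugate_neg)

lemma transpose_reflection [simp]: "(reflection n p)\<^sup>T = reflection n p"
  by (rule eq_matI) (auto simp: reflection_def mat_diag_def)

text \<open>Conjugation by Sigma inverts the hyperbolic factor: a flip that moves an index changes
  its part and hence its sign, and an index fixed by the flip has angle 0.\<close>

lemma reflection_hyp_rot:
  assumes "p \<le> n" "n - p \<le> p"
  shows "reflection n p * hyp_rot n p \<theta> = (hyp_rot n p (\<lambda>i. - \<theta> i) * reflection n p :: 'a :: real_field mat)"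
    (is "?L = ?R")
proof (rule eq_matI)
  define s where "s k = (if k < p \<or> n \<le> k \<and> k < n + p then 1 else - 1 :: 'a)" for k
  fix i j assume "i < dim_row ?R" "j < dim_col ?R"
  hence ij: "i < 2 * n" "j < 2 * n"
    by (auto simp: reflection_def mat_diag_def)
  have "flip_index n p i \<noteq> i \<and> s (flip_index n p i) = - s i \<or> flip_index n p i = i \<and> signed_angle n p \<theta> i = 0"
    using ij assms unfolding s_def flip_index_def swap_index_def signed_angle_def angle_def by auto
  thus "?L $$ (i, j) = ?R $$ (i, j)"
    using ij unfolding reflection_def s_def[symmetric]
      mat_diag_mult_left[OF hyp_rot_carrier(1)] mat_diag_mult_right[OF hyp_rot_carrier(1)]
    by (cases "j = i"; cases "j = flip_index n p i") (auto simp: hyp_rot_def signed_angle_uminus)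
qed (auto simp: reflection_def mat_diag_def)

text \<open>The off-diagonal sinh terms are odd in the angle and cancel. This is the reason for
  symmetrizing in the uniqueness argument: the eigenvalues can be read off.\<close>

lemma hyp_rot_add_inverse:
  "hyp_rot n p \<theta> + hyp_rot n p (\<lambda>i. - \<theta> i) =
    (mat_diag (2 * n) (\<lambda>i. of_real (2 * cosh (signed_angle n p \<theta> i))) :: 'a :: real_field mat)"
proof (rule eq_matI)
  fix i j
  assume "i < dim_row (mat_diag (2 * n) (\<lambda>i. of_real (2 * cosh (signed_angle n p \<theta> i))) :: 'a mat)"
    "j < dim_col (mat_diag (2 * n) (\<lambda>i. of_real (2 * cosh (signed_angle n p \<theta> i))) :: 'a mat)"
  thus "(hyp_rot n p \<theta> + hyp_rot n p (\<lambda>i. - \<theta> i)) $$ (i, j) =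
    (mat_diag (2 * n) (\<lambda>i. of_real (2 * cosh (signed_angle n p \<theta> i))) :: 'a mat) $$ (i, j)"
    by (auto simp: hyp_rot_def mat_diag_def signed_angle_uminus)
qed (auto simp: mat_diag_def)

section \<open>Angles recovered from the spectrum\<close>

lemma proots_linear: "proots [:- a, 1:] = {#a :: 'a :: idom#}"
proof (rule multiset_eqI)
  fix x
  have "order x [:- a, 1:] = (if x = a then 1 else 0)"
    using order_power_n_n[of a 1] by (auto intro!: order_0I)
  thus "count (proots [:- a, 1:]) x = count {#a#} x"
    by simp
qed

lemma proots_prod_linear: "proots (\<Prod>a\<leftarrow>as. [:- a, 1:]) = mset (as :: 'a :: idom list)"
proof (induction as)
  case (Cons a as)
  have "(\<Prod>a\<leftarrow>as. [:- a, 1:]) \<noteq> 0"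
    by (auto simp: prod_list_zero_iff)
  with Cons show ?case
    by (simp add: proots_mult proots_linear del: mult_pCons_left)
qed simp

lemma similar_mat_diag_imp_mset_eq:
  fixes f g :: "nat \<Rightarrow> 'a :: field"
  assumes "similar_mat (mat_diag m f) (mat_diag m g)"
  shows "image_mset f (mset_set {..<m}) = image_mset g (mset_set {..<m})"
proof -
  have "proots (char_poly (mat_diag m h)) = image_mset h (mset_set {..<m})" for h :: "nat \<Rightarrow> 'a"
  proof -
    have "upper_triangular (mat_diag m h)"
      by (auto simp: mat_diag_def)
    hence "char_poly (mat_diag m h) = (\<Prod>a\<leftarrow>diag_mat (mat_diag m h). [:- a, 1:])"
      by (rule char_poly_upper_triangular[OF mat_diag_dim])
    moreover have "diag_mat (mat_diag m h) = map h [0..<m]"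
      by (auto simp: diag_mat_def mat_diag_def)
    ultimately have "proots (char_poly (mat_diag m h)) = mset (map h [0..<m])"
      by (simp only: proots_prod_linear)
    thus ?thesis
      by (simp add: lessThan_atLeast0)
  qed
  with char_poly_similar[OF assms] show ?thesis
    by metis
qed

text \<open>Each angle occurs at i and at p + i, once with each sign in the two halves, hence four
  times for an even function; the p - q middle rows of each half contribute the angle 0.\<close>

lemma signed_angle_image_mset:
  assumes "q \<le> p" and even: "\<And>x. h (- x) = (h x :: 'b)"
  shows "image_mset (\<lambda>i. h (signed_angle (p + q) p \<theta> i)) (mset_set {..<2 * (p + q)}) =
    repeat_mset 4 (image_mset (\<lambda>i. h (\<theta> i)) (mset_set {..<q})) + replicate_mset (2 * (p - q)) (h 0)"
proof -
  define Y where "Y = image_mset (\<lambda>i. h (\<theta> i)) (mset_set {..<q})"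
  have shift: "image_mset g (mset_set {a..<a + m}) = image_mset (\<lambda>i. g (i + a)) (mset_set {..<m})"
    for g :: "nat \<Rightarrow> 'b" and a m
  proof -
    have "{a..<a + m} = (\<lambda>i. i + a) ` {..<m}"
      using image_add_atLeastLessThan'[of a 0 m] by (simp add: lessThan_atLeast0 add.commute)
    hence "mset_set {a..<a + m} = image_mset (\<lambda>i. i + a) (mset_set {..<m})"
      by (simp add: image_mset_mset_set)
    thus ?thesis
      by (simp add: multiset.map_comp o_def)
  qed
  have split: "image_mset g (mset_set {..<a + m}) =
      image_mset g (mset_set {..<a}) + image_mset (\<lambda>i. g (i + a)) (mset_set {..<m})"
    for g :: "nat \<Rightarrow> 'b" and a m
  proof -
    have "mset_set ({..<a} \<union> {a..<a + m}) = mset_set {..<a} + mset_set {a..<a + m}"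
      by (rule mset_set_Union) auto
    also have "{..<a} \<union> {a..<a + m} = {..<a + m}"
      by auto
    finally have "mset_set {..<a + m} = mset_set {..<a} + mset_set {a..<a + m}" .
    thus ?thesis
      by (simp add: shift)
  qed
  have "image_mset (\<lambda>i. h (angle (p + q) p \<theta> (i + q))) (mset_set {..<p - q}) =
      image_mset (\<lambda>_. h 0) (mset_set {..<p - q})"
    using assms(1) by (intro image_mset_cong) (auto simp: angle_def)
  moreover have "image_mset (\<lambda>i. h (angle (p + q) p \<theta> i)) (mset_set {..<q}) = Y"
    "image_mset (\<lambda>i. h (angle (p + q) p \<theta> (i + (q + (p - q))))) (mset_set {..<q}) = Y"
    unfolding Y_def using assms(1) by (auto simp: angle_def intro!: image_mset_cong)
  ultimately have "image_mset (\<lambda>i. h (angle (p + q) p \<theta> i)) (mset_set {..<q + (p - q) + q}) =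
      Y + replicate_mset (p - q) (h 0) + Y"
    unfolding split[of _ "q + (p - q)"] split[of _ q] by (simp add: image_mset_const_eq)
  hence *: "image_mset (\<lambda>i. h (angle (p + q) p \<theta> i)) (mset_set {..<p + q}) =
      Y + replicate_mset (p - q) (h 0) + Y"
    using assms(1) by simp
  have "image_mset (\<lambda>i. h (signed_angle (p + q) p \<theta> i)) (mset_set {..<(p + q) + (p + q)}) =
      image_mset (\<lambda>i. h (angle (p + q) p \<theta> i)) (mset_set {..<p + q}) +
      image_mset (\<lambda>i. h (angle (p + q) p \<theta> i)) (mset_set {..<p + q})"
    unfolding split[of _ "p + q" "p + q"]
    by (intro arg_cong2[of _ _ _ _ "(+)"] image_mset_cong) (auto simp: signed_angle_def even)
  also have "\<dots> = repeat_mset 4 Y + replicate_mset (2 * (p - q)) (h 0)"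
    unfolding * by (intro multiset_eqI) simp
  finally show ?thesis
    unfolding mult_2[of "p + q"] Y_def .
qed

text \<open>Similar diagonal matrices have the same multiset of entries. Cancelling the common zero
  angles and the multiplicity four leaves equal multisets of cosh values, and cosh determines its
  argument up to sign.\<close>

lemma eq_up_to_order_and_signsI:
  assumes q: "q \<le> p"
    and sim: "similar_mat
      (mat_diag (2 * (p + q)) (\<lambda>i. of_real (2 * cosh (signed_angle (p + q) p (\<lambda>i. 4 * \<theta> i) i))) :: 'a :: real_field mat)
      (mat_diag (2 * (p + q)) (\<lambda>i. of_real (2 * cosh (signed_angle (p + q) p (\<lambda>i. 4 * \<theta>' i) i))))"
  shows "eq_up_to_order_and_signs q \<theta> \<theta>'"
proof -
  define h where "h x = (of_real (2 * cosh x) :: 'a)" for x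
  have even: "h (- x) = h x" for x
    by (simp add: h_def)
  note * = signed_angle_image_mset[where h = h, OF q even]
  have "repeat_mset 4 (image_mset (\<lambda>i. h (4 * \<theta> i)) (mset_set {..<q})) =
      repeat_mset 4 (image_mset (\<lambda>i. h (4 * \<theta>' i)) (mset_set {..<q}))"
    using similar_mat_diag_imp_mset_eq[OF sim] unfolding h_def[symmetric] * by simp
  hence "image_mset (\<lambda>i. h (4 * \<theta>' i)) (mset_set {..<q}) = image_mset (\<lambda>i. h (4 * \<theta> i)) (mset_set {..<q})"
    by (simp add: multiset_eq_iff)
  then obtain \<pi> where \<pi>: "\<pi> permutes {..<q}" "\<forall>i\<in>{..<q}. h (4 * \<theta>' i) = h (4 * \<theta> (\<pi> i))"
    by (rule image_mset_eq_implies_permutes[OF finite_lessThan])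
  have "\<theta>' i = \<theta> (\<pi> i) \<or> \<theta>' i = - \<theta> (\<pi> i)" if "i < q" for i
    using \<pi>(2) that unfolding h_def of_real_eq_iff by (auto simp: abs_eq_iff)
  with \<pi>(1) show ?thesis
    by (auto simp: eq_up_to_order_and_signs_def)
qed


lemma conj_mat_hyp_rot:
  assumes "real_or_complex TYPE('a :: {conjugatable_ordered_field, real_field})"
  shows "conj_mat (hyp_rot n p \<theta>) = (hyp_rot n p \<theta> :: 'a mat)"
  using real_or_complex.conjugate_of_real[OF assms]
  by (intro eq_matI) (auto simp: hyp_rot_def conjugate_dist_add)

text \<open>Common form of \<open>orthogonal_symplectic\<close> and
  \<open>unitary_symplectic\<close>, since conjugation is trivial over the reals.\<close>

definition unitary_symplectic_group :: "nat \<Rightarrow> 'a :: conjugatable_field mat set" where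
  "unitary_symplectic_group n =
     {U \<in> symplectic_group n. inverts_mat (mat_adjoint U) U \<and> inverts_mat U (mat_adjoint U)}"

text \<open>The unitary factor cancels in the Gram matrix; of the direct sum only its commuting with
  Sigma is retained.\<close>

lemma hyp_factorizationD:
  fixes S :: "'a :: {conjugatable_ordered_field, real_field} mat"
  assumes rc: "real_or_complex TYPE('a)" and q: "q \<le> p" and n: "n = p + q"
    and hf: "hyp_factorization (unitary_symplectic_group n) p q S U Sp Sq \<theta>"
  obtains L where "L \<in> symplectic_group n" "reflection n p * L = L * reflection n p"
    "conj_mat S\<^sup>T * S = conj_mat L\<^sup>T * hyp_rot n p (\<lambda>i. 2 * \<theta> i) * L"
proof
  let ?L = "symplectic_direct_sum p q Sp Sq" and ?D = "hyp_rot n p \<theta> :: 'a mat"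
  have U: "U \<in> symplectic_group n" "conj_mat U\<^sup>T * U = 1\<^sub>m (2 * n)"
    and Sp: "Sp \<in> symplectic_group p" and Sq: "Sq \<in> symplectic_group q"
    and S: "S = U * ?D * ?L"
    using hf by (auto simp: hyp_factorization_def unitary_symplectic_group_def inverts_mat_def
        mat_adjoint_eq hyp_rot_four_block[OF q] n symplectic_group_def)
  note Spc = symplectic_groupD(1)[OF Sp] and Sqc = symplectic_groupD(1)[OF Sq]
  show L: "?L \<in> symplectic_group n"
    using Sp Sq symplectic_direct_sum_symplectic_iff[OF Spc Sqc] by (simp add: n)
  show "reflection n p * ?L = ?L * reflection n p"
    unfolding n by (rule reflection_commute_direct_sum[OF Spc Sqc])
  define L where "L = ?L"
  have np: "p \<le> n" "n - p \<le> p"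
    using q n by auto
  note Uc = symplectic_groupD(1)[OF U(1)] and Lc = symplectic_groupD(1)[OF L, folded L_def]
  have adj: "conj_mat S\<^sup>T = conj_mat L\<^sup>T * ?D * conj_mat U\<^sup>T"
    using Uc Lc unfolding S L_def[symmetric]
    by (simp add: conj_mat_mult[of _ "2*n" "2*n" _ "2*n"] transpose_mult[of _ "2*n" "2*n" _ "2*n"]
        mult_carrier_mat[of _ "2*n" "2*n" _ "2*n"] transpose_hyp_rot[OF np] conj_mat_hyp_rot[OF rc]
        assoc_mult_mat[of _ "2*n" "2*n" _ "2*n" _ "2*n"])
  have "conj_mat S\<^sup>T * S = conj_mat L\<^sup>T * ?D * conj_mat U\<^sup>T * (U * ?D * L)"
    by (simp only: adj) (simp only: S L_def)
  also have "\<dots> = conj_mat L\<^sup>T * ?D * (conj_mat U\<^sup>T * U) * ?D * L"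
    using Uc Lc
    by (simp add: mult_carrier_mat[of _ "2*n" "2*n" _ "2*n"] assoc_mult_mat[of _ "2*n" "2*n" _ "2*n" _ "2*n"])
  also have "\<dots> = conj_mat L\<^sup>T * (?D * ?D) * L"
    using Uc Lc unfolding U(2)
    by (simp add: mult_carrier_mat[of _ "2*n" "2*n" _ "2*n"] assoc_mult_mat[of _ "2*n" "2*n" _ "2*n" _ "2*n"])
  also have "?D * ?D = hyp_rot n p (\<lambda>i. 2 * \<theta> i)"
    by (simp add: hyp_rot_mult[OF np])
  finally show "conj_mat S\<^sup>T * S = conj_mat ?L\<^sup>T * hyp_rot n p (\<lambda>i. 2 * \<theta> i) * ?L"
    by (simp add: L_def)
qed

text \<open>The left-hand side depends on \<open>M\<close> only, hence so does the spectrum of the diagonal matrix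
  on the right.\<close>

lemma cosh_normal_form:
  fixes M :: "'a :: {conjugatable_ordered_field, real_field} mat"
  assumes np: "p \<le> n" "n - p \<le> p"
    and L: "L \<in> symplectic_group n" "reflection n p * L = L * reflection n p"
    and M: "M = conj_mat L\<^sup>T * hyp_rot n p (\<lambda>i. 2 * \<theta> i) * L"
    and X: "X \<in> carrier_mat (2 * n) (2 * n)" "X * M = 1\<^sub>m (2 * n)"
  shows "similar_mat (X * reflection n p * M * reflection n p + reflection n p * X * reflection n p * M)
    (mat_diag (2 * n) (\<lambda>i. of_real (2 * cosh (signed_angle n p (\<lambda>i. 4 * \<theta> i) i))))"
proof -
  let ?R = "reflection n p :: 'a mat"
  define N where "N = 2 * n"
  define D where "D t = (hyp_rot n p (\<lambda>i. t * \<theta> i) :: 'a mat)" for t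
  obtain K where K: "K \<in> symplectic_group n" "L * K = 1\<^sub>m N" "K * L = 1\<^sub>m N"
    using symplectic_group_inverse_closed[OF L(1)] unfolding N_def by blast
  define L' K' where "L' = conj_mat L\<^sup>T" and "K' = conj_mat K\<^sup>T"
  have c [simp]: "L \<in> carrier_mat N N" "K \<in> carrier_mat N N" "L' \<in> carrier_mat N N" "K' \<in> carrier_mat N N"
    "?R \<in> carrier_mat N N" "D t \<in> carrier_mat N N" "X \<in> carrier_mat N N" for t
    using symplectic_groupD(1)[OF L(1)] symplectic_groupD(1)[OF K(1)] X(1)
    by (auto simp: L'_def K'_def N_def D_def)
  have DD: "D s * D t = D (s + t)" for s t
    unfolding D_def by (subst hyp_rot_mult[OF np]) (simp add: distrib_right)
  have D0: "D 0 = 1\<^sub>m N"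
    by (simp add: D_def N_def hyp_rot_zero)
  have RD: "?R * D t = D (- t) * ?R" for t
    unfolding D_def by (subst reflection_hyp_rot[OF np]) simp
  have RR: "?R * ?R = 1\<^sub>m N"
    by (simp add: N_def reflection_square)
  have assoc: "A * B * C = A * (B * C)"
    if "A \<in> carrier_mat N N" "B \<in> carrier_mat N N" "C \<in> carrier_mat N N" for A B C :: "'a mat"
    using that by (rule assoc_mult_mat)
  have mult: "A * B \<in> carrier_mat N N" if "A \<in> carrier_mat N N" "B \<in> carrier_mat N N" for A B :: "'a mat"
    using that by (rule mult_carrier_mat)
  have one: "1\<^sub>m N * A = A" "A * 1\<^sub>m N = A" if "A \<in> carrier_mat N N" for A :: "'a mat"
    using that by auto
  have cancel: "A * (B * C) = C" if "A * B = 1\<^sub>m N" "A \<in> carrier_mat N N" "B \<in> carrier_mat N N" "C \<in> carrier_mat N N"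
    for A B C :: "'a mat"
    using assoc[OF that(2-4)] that by simp
  \<comment> \<open>\<open>cancel\<close> and \<open>swap\<close> rewrite inside right-associated
    products, so that Sigma can be carried through a long word.\<close>
  have swap: "A * (B * C) = B' * (A' * C)"
    if "A * B = B' * A'" "A \<in> carrier_mat N N" "B \<in> carrier_mat N N" "C \<in> carrier_mat N N"
      "A' \<in> carrier_mat N N" "B' \<in> carrier_mat N N" for A B C A' B' :: "'a mat"
    using assoc[OF that(2,3,4)] assoc[OF that(6,5,4)] that(1) by simp
  have "conj_mat (?R * L)\<^sup>T = conj_mat (L * ?R)\<^sup>T"
    by (simp add: L(2))
  hence RL': "?R * L' = L' * ?R"
    by (simp add: L'_def transpose_mult[of _ N N _ N] conj_mat_mult[of _ N N _ N])
  have "conj_mat (K * L)\<^sup>T = 1\<^sub>m N" "conj_mat (L * K)\<^sup>T = 1\<^sub>m N"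
    unfolding K by (auto intro!: eq_matI)
  hence L'K': "L' * K' = 1\<^sub>m N" "K' * L' = 1\<^sub>m N"
    by (simp_all add: L'_def K'_def transpose_mult[of _ N N _ N] conj_mat_mult[of _ N N _ N])
  have RK: "?R * K = K * ?R"
  proof -
    have "?R * K = K * L * (?R * K)"
      by (simp add: K mult one)
    also have "\<dots> = K * (?R * L) * K"
      unfolding L(2) by (simp add: assoc mult)
    also have "\<dots> = K * ?R"
      by (simp add: assoc mult K one)
    finally show ?thesis .
  qed
  have M': "M = L' * (D 2 * L)"
    unfolding M L'_def[symmetric] D_def[symmetric] by (simp add: assoc mult)
  \<comment> \<open>A right inverse of \<open>M\<close>, which therefore coincides with the left
    inverse \<open>X\<close>.\<close>
  have "M * (K * (D (- 2) * K')) = 1\<^sub>m N"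
    by (simp add: M' assoc mult cancel[OF K(2)] cancel[of "D 2" "D (- 2)"] DD D0 L'K')
  moreover have "X * (M * (K * (D (- 2) * K'))) = K * (D (- 2) * K')"
    using X(2) by (intro cancel) (simp_all add: N_def[symmetric] M' mult)
  ultimately have X': "X = K * (D (- 2) * K')"
    by (simp add: one)
  \<comment> \<open>Sigma passes through \<open>L\<close>, \<open>K\<close> and \<open>L'\<close>
    unchanged and turns \<open>D t\<close> into \<open>D (- t)\<close>, so the two factors of
    exponent 2 reinforce instead of cancelling.\<close>
  have "X * ?R * M * ?R + ?R * X * ?R * M = K * (D (- 4) * L) + K * (D 4 * L)"
  proof (rule arg_cong2[of _ _ _ _ "(+)"])
    have "X * ?R * M * ?R = K * (D (- 2) * (K' * (?R * (L' * (D 2 * (L * ?R))))))"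
      by (simp add: X' M' assoc mult)
    also have "\<dots> = K * (D (- 2) * (?R * (D 2 * (?R * L))))"
      by (simp add: mult swap[OF RL'] cancel[OF L'K'(2)] L(2))
    also have "\<dots> = K * (D (- 2) * (D (- 2) * L))"
      by (simp add: mult swap[OF RD] cancel[OF RR])
    also have "\<dots> = K * (D (- 4) * L)"
      by (simp add: mult DD flip: assoc)
    finally show "X * ?R * M * ?R = K * (D (- 4) * L)" .
    have "?R * X * ?R * M = ?R * (K * (D (- 2) * (K' * (?R * (L' * (D 2 * L))))))"
      by (simp add: X' M' assoc mult)
    also have "\<dots> = K * (?R * (D (- 2) * (?R * (D 2 * L))))"
      by (simp add: mult swap[OF RL'] cancel[OF L'K'(2)] swap[OF RK])
    also have "\<dots> = K * (D 2 * (D 2 * L))"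
      by (simp add: mult swap[OF RD] cancel[OF RR])
    also have "\<dots> = K * (D 4 * L)"
      by (simp add: mult DD flip: assoc)
    finally show "?R * X * ?R * M = K * (D 4 * L)" .
  qed
  also have "\<dots> = K * (D 4 + D (- 4)) * L"
    by (simp add: assoc mult mult_add_distrib_mat[of _ N N _ N] add_mult_distrib_mat[of _ N N _ _ N]
        comm_add_mat[of _ N N])
  also have "D 4 + D (- 4) = mat_diag N (\<lambda>i. of_real (2 * cosh (signed_angle n p (\<lambda>i. 4 * \<theta> i) i)))"
    using hyp_rot_add_inverse[of n p "\<lambda>i. 4 * \<theta> i", where ?'a = 'a] by (simp add: D_def N_def)
  finally show ?thesis
    unfolding N_def[symmetric] using K by (intro similar_matI[of _ _ K L N]) (auto simp: mult)
qed

text \<open>Positivity holds because the form at \<open>x\<close> is the squared norm of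
  \<open>S x\<close>, which is nonzero by invertibility of \<open>S\<close>.\<close>

lemma gram_symplectic_pair:
  fixes S :: "'a :: {conjugatable_ordered_field, real_field} mat"
  assumes rc: "real_or_complex TYPE('a)" and "p \<le> n" and S: "S \<in> symplectic_group n"
  shows "symplectic_pair (2 * n) n p (conj_mat S\<^sup>T * S)"
proof -
  interpret real_or_complex "TYPE('a)" by (rule rc)
  note Sc = symplectic_groupD(1)[OF S]
  have M: "conj_mat S\<^sup>T * S \<in> symplectic_group n"
    using S by (intro symplectic_group_mult symplectic_group_conj_mat symplectic_group_transpose)
  show ?thesis
  proof
    show "conj_mat (conj_mat S\<^sup>T * S) = (conj_mat S\<^sup>T * S)\<^sup>T"
      using Sc by (simp add: conj_mat_mult[of _ "2*n" "2*n" _ "2*n"] transpose_mult[of _ "2*n" "2*n" _ "2*n"]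
          transpose_conj_mat)
    fix x :: "'a vec" assume x: "x \<in> carrier_vec (2 * n)" "x \<noteq> 0\<^sub>v (2 * n)"
    define y where "y = S *\<^sub>v x"
    have y: "y \<in> carrier_vec (2 * n)"
      using Sc x by (auto simp: y_def intro!: mult_mat_vec_carrier)
    have "y \<noteq> 0\<^sub>v (2 * n)"
    proof
      obtain K where K: "K \<in> symplectic_group n" "K * S = 1\<^sub>m (2 * n)"
        using symplectic_group_inverse_closed[OF S] by blast
      have "x = K *\<^sub>v y"
        using assoc_mult_mat_vec[OF symplectic_groupD(1)[OF K(1)] Sc x(1)] x(1) by (simp add: y_def K(2))
      moreover assume "y = 0\<^sub>v (2 * n)"
      ultimately have "x = 0\<^sub>v (2 * n)"
        using symplectic_groupD(1)[OF K(1)] by (auto intro!: eq_vecI)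
      with x show False by blast
    qed
    have "conjugate x \<bullet> (conj_mat S\<^sup>T * S *\<^sub>v x) = conjugate x \<bullet> (conj_mat S\<^sup>T *\<^sub>v y)"
      using Sc x by (simp add: y_def assoc_mult_mat_vec[of _ "2*n" "2*n" _ "2*n"])
    also have "\<dots> = ((conj_mat S\<^sup>T)\<^sup>T *\<^sub>v conjugate x) \<bullet> y"
      using Sc x y by (intro transpose_vec_mult_scalar[symmetric]) auto
    also have "(conj_mat S\<^sup>T)\<^sup>T *\<^sub>v conjugate x = conjugate y"
      using Sc x by (simp add: y_def conj_mat_mult_vec[of _ "2*n" "2*n"] transpose_conj_mat)
    also have "conjugate y \<bullet> y = y \<bullet>c y"
      using y by (intro comm_scalar_prod[of _ "2*n"]) auto
    finally show "0 < conjugate x \<bullet> (conj_mat S\<^sup>T * S *\<^sub>v x)"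
      using y \<open>y \<noteq> 0\<^sub>v (2 * n)\<close> by simp
  qed (use assms symplectic_groupD[OF M] in auto)
qed

theorem hyp_factorization_exists_unique:
  fixes S :: "'a :: {conjugatable_ordered_field, real_field} mat"
  assumes rc: "real_or_complex TYPE('a)" and q: "q \<le> p" and n: "n = p + q"
    and S: "S \<in> symplectic_group n"
  shows "\<exists>U Sp Sq \<theta>. hyp_factorization (unitary_symplectic_group n) p q S U Sp Sq \<theta> \<and>
    (\<forall>U' Sp' Sq' \<theta>'. hyp_factorization (unitary_symplectic_group n) p q S U' Sp' Sq' \<theta>' \<longrightarrow>
      eq_up_to_order_and_signs q \<theta> \<theta>')"
proof -
  have np: "p \<le> n" "n - p \<le> p"
    using q n by auto
  define N where "N = 2 * n"
  define M where "M = conj_mat S\<^sup>T * S"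
  interpret symplectic_pair "TYPE('a)" N n p M
    unfolding N_def M_def by (rule gram_symplectic_pair[OF rc np(1) S])
  have reflect_eq: "mat_diag N sg = reflection n p"
    by (simp add: reflection_def N_def sg_def[abs_def])
  obtain L \<theta> where L: "L \<in> carrier_mat N N" "L\<^sup>T * J * L = J"
    "reflection n p * L = L * reflection n p"
    "conj_mat L\<^sup>T * M * L = hyp_rot n p (\<lambda>i. 2 * \<theta> i)"
    using exists_normal_form[OF np(2)] unfolding reflect_eq by metis
  have LS: "L \<in> symplectic_group n"
    using L by (simp add: symplectic_group_def N_def)
  obtain K where K: "K \<in> symplectic_group n" "L * K = 1\<^sub>m N" "K * L = 1\<^sub>m N"
    using symplectic_group_inverse_closed[OF LS] unfolding N_def by blast
  define D where "D t = (hyp_rot n p (\<lambda>i. t * \<theta> i) :: 'a mat)" for t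
  have c [simp]: "L \<in> carrier_mat N N" "K \<in> carrier_mat N N" "S \<in> carrier_mat N N"
    "reflection n p \<in> carrier_mat N N" "D t \<in> carrier_mat N N" for t
    using L(1) symplectic_groupD(1)[OF K(1)] symplectic_groupD(1)[OF S] by (auto simp: N_def D_def)
  have DD: "D s * D t = D (s + t)" for s t
    unfolding D_def by (subst hyp_rot_mult[OF np]) (simp add: distrib_right)
  have D0: "D 0 = 1\<^sub>m N"
    by (simp add: D_def N_def hyp_rot_zero)
  have assoc: "A * B * C = A * (B * C)"
    if "A \<in> carrier_mat N N" "B \<in> carrier_mat N N" "C \<in> carrier_mat N N" for A B C :: "'a mat"
    using that by (rule assoc_mult_mat)
  have mult: "A * B \<in> carrier_mat N N" if "A \<in> carrier_mat N N" "B \<in> carrier_mat N N" for A B :: "'a mat"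
    using that by (rule mult_carrier_mat)
  have one: "1\<^sub>m N * A = A" "A * 1\<^sub>m N = A" if "A \<in> carrier_mat N N" for A :: "'a mat"
    using that by auto
  have cancel: "A * (B * C) = C" if "A * B = 1\<^sub>m N" "A \<in> carrier_mat N N" "B \<in> carrier_mat N N" "C \<in> carrier_mat N N"
    for A B C :: "'a mat"
    using assoc[OF that(2-4)] that by simp
  \<comment> \<open>The inverse of a matrix commuting with Sigma commutes as well; this makes
    \<open>K\<close> the direct sum factor of the factorization.\<close>
  have RK: "reflection n p * K = K * reflection n p"
  proof -
    have "reflection n p * K = K * L * (reflection n p * K)"
      by (simp add: K mult one)
    also have "\<dots> = K * (reflection n p * L) * K"
      unfolding L(3) by (simp add: assoc mult)
    also have "\<dots> = K * reflection n p"
      by (simp add: assoc mult K one)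
    finally show ?thesis .
  qed
  obtain Sp Sq where Spq: "Sp \<in> carrier_mat (2 * p) (2 * p)" "Sq \<in> carrier_mat (2 * q) (2 * q)"
    "K = symplectic_direct_sum p q Sp Sq"
    using commute_reflection_imp_direct_sum[of K p q] symplectic_groupD(1)[OF K(1)] RK unfolding n by blast
  have SpSq: "Sp \<in> symplectic_group p" "Sq \<in> symplectic_group q"
    using K(1) symplectic_direct_sum_symplectic_iff[OF Spq(1,2)] unfolding Spq(3) n by auto
  \<comment> \<open>Forced by S = U D K with K inverse to L. It is unitary because L^* M L is the
    square of D.\<close>
  define U where "U = S * L * D (- 1)"
  have Uc: "U \<in> carrier_mat N N"
    by (simp add: U_def mult)
  have "D (- 1) \<in> symplectic_group n"
    unfolding D_def by (rule hyp_rot_symplectic[OF np])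
  hence U: "U \<in> symplectic_group n"
    unfolding U_def by (intro symplectic_group_mult S LS)
  have "conj_mat U\<^sup>T = D (- 1) * (conj_mat L\<^sup>T * conj_mat S\<^sup>T)"
    by (simp add: U_def transpose_mult[of _ N N _ N] conj_mat_mult[of _ N N _ N] mult)
      (simp add: D_def transpose_hyp_rot[OF np] conj_mat_hyp_rot[OF rc])
  hence "conj_mat U\<^sup>T * U = D (- 1) * ((conj_mat L\<^sup>T * M * L) * D (- 1))"
    by (simp add: U_def M_def assoc mult)
  also have "\<dots> = 1\<^sub>m N"
    unfolding L(4) D_def[symmetric, of 2] by (simp add: DD D0)
  finally have UU: "conj_mat U\<^sup>T * U = 1\<^sub>m N" .
  have "U * conj_mat U\<^sup>T = 1\<^sub>m N"
    by (rule mat_mult_left_right_inverse[OF _ Uc UU]) (simp add: Uc)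
  hence "U \<in> unitary_symplectic_group n"
    using U UU Uc by (auto simp: unitary_symplectic_group_def inverts_mat_def mat_adjoint_eq)
  moreover have "S = U * D 1 * K"
    by (simp add: U_def assoc mult cancel[of "D (- 1)" "D 1"] DD D0 K one)
  ultimately have hf: "hyp_factorization (unitary_symplectic_group n) p q S U Sp Sq \<theta>"
    using SpSq by (simp add: hyp_factorization_def hyp_rot_four_block[OF q] D_def n Spq(3))
  have "eq_up_to_order_and_signs q \<theta> \<theta>'"
    if hf': "hyp_factorization (unitary_symplectic_group n) p q S U' Sp' Sq' \<theta>'" for U' Sp' Sq' \<theta>'
  proof -
    have MS: "M \<in> symplectic_group n"
      unfolding M_def using S by (intro symplectic_group_mult symplectic_group_conj_mat symplectic_group_transpose)
    obtain X where X: "X \<in> symplectic_group n" "X * M = 1\<^sub>m (2 * n)"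
      using symplectic_group_inverse_closed[OF MS] by blast
    note Xc = symplectic_groupD(1)[OF X(1)]
    obtain L1 where L1: "L1 \<in> symplectic_group n" "reflection n p * L1 = L1 * reflection n p"
      "M = conj_mat L1\<^sup>T * hyp_rot n p (\<lambda>i. 2 * \<theta> i) * L1"
      unfolding M_def by (rule hyp_factorizationD[OF rc q n hf])
    obtain L2 where L2: "L2 \<in> symplectic_group n" "reflection n p * L2 = L2 * reflection n p"
      "M = conj_mat L2\<^sup>T * hyp_rot n p (\<lambda>i. 2 * \<theta>' i) * L2"
      unfolding M_def by (rule hyp_factorizationD[OF rc q n hf'])
    \<comment> \<open>Both factorizations make one and the same matrix, formed from \<open>M\<close>
      and Sigma alone, similar to their respective cosh diagonals.\<close>
    from similar_mat_trans[OF similar_mat_sym[OF cosh_normal_form[OF np L1 Xc X(2)]]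
        cosh_normal_form[OF np L2 Xc X(2)]]
    show ?thesis
      unfolding n by (rule eq_up_to_order_and_signsI[OF q])
  qed
  with hf show ?thesis
    by blast
qed

theorem theorem6p7:
  fixes n p q :: nat
  assumes "n = p + q" and "q \<le> p"
  shows
    "(\<forall>S :: real mat \<in> symplectic_group n. \<exists>U Sp Sq \<theta>.
        hyp_factorization (orthogonal_symplectic n) p q S U Sp Sq \<theta> \<and>
        inverts_mat (hyp_mat p q \<theta> :: real mat) (hyp_mat_inv p q \<theta>) \<and>
        inverts_mat (hyp_mat_inv p q \<theta>) (hyp_mat p q \<theta> :: real mat) \<and>
        (\<forall>U' Sp' Sq' \<theta>'.
           hyp_factorization (orthogonal_symplectic n) p q S U' Sp' Sq' \<theta>' \<longrightarrow>
           eq_up_to_order_and_signs q \<theta> \<theta>')) \<and>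
     (\<forall>S :: complex mat \<in> symplectic_group n. \<exists>U Sp Sq \<theta>.
        hyp_factorization (unitary_symplectic n) p q S U Sp Sq \<theta> \<and>
        inverts_mat (hyp_mat p q \<theta> :: complex mat) (hyp_mat_inv p q \<theta>) \<and>
        inverts_mat (hyp_mat_inv p q \<theta>) (hyp_mat p q \<theta> :: complex mat) \<and>
        (\<forall>U' Sp' Sq' \<theta>'.
           hyp_factorization (unitary_symplectic n) p q S U' Sp' Sq' \<theta>' \<longrightarrow>
           eq_up_to_order_and_signs q \<theta> \<theta>'))"
proof -
  have "mat_adjoint U = U\<^sup>T" for U :: "real mat"
    by (auto simp: mat_adjoint_eq intro!: eq_matI)
  hence real: "orthogonal_symplectic n = unitary_symplectic_group n"
    by (simp add: orthogonal_symplectic_def unitary_symplectic_group_def)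
  have complex: "unitary_symplectic n = unitary_symplectic_group n"
    by (simp add: unitary_symplectic_def unitary_symplectic_group_def)
  show ?thesis
    unfolding real complex
  proof (intro conjI ballI)
    fix S :: "real mat" assume "S \<in> symplectic_group n"
    from hyp_factorization_exists_unique[OF real_or_complex_real assms(2,1) this]
    show "\<exists>U Sp Sq \<theta>. hyp_factorization (unitary_symplectic_group n) p q S U Sp Sq \<theta> \<and>
        inverts_mat (hyp_mat p q \<theta> :: real mat) (hyp_mat_inv p q \<theta>) \<and>
        inverts_mat (hyp_mat_inv p q \<theta>) (hyp_mat p q \<theta> :: real mat) \<and>
        (\<forall>U' Sp' Sq' \<theta>'. hyp_factorization (unitary_symplectic_group n) p q S U' Sp' Sq' \<theta>' \<longrightarrow>
           eq_up_to_order_and_signs q \<theta> \<theta>')"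
      using hyp_mat_inverts[OF assms(2), where ?'a = real] by blast
  next
    fix S :: "complex mat" assume "S \<in> symplectic_group n"
    from hyp_factorization_exists_unique[OF real_or_complex_complex assms(2,1) this]
    show "\<exists>U Sp Sq \<theta>. hyp_factorization (unitary_symplectic_group n) p q S U Sp Sq \<theta> \<and>
        inverts_mat (hyp_mat p q \<theta> :: complex mat) (hyp_mat_inv p q \<theta>) \<and>
        inverts_mat (hyp_mat_inv p q \<theta>) (hyp_mat p q \<theta> :: complex mat) \<and>
        (\<forall>U' Sp' Sq' \<theta>'. hyp_factorization (unitary_symplectic_group n) p q S U' Sp' Sq' \<theta>' \<longrightarrow>
           eq_up_to_order_and_signs q \<theta> \<theta>')"
      using hyp_mat_inverts[OF assms(2), where ?'a = complex] by blast
  qed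
qed

end
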